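(* Let $d_0,d_1,\ell_1,\ell_2>0$ and let $\alpha,\kappa,\theta\in\mathbb R$ be the numbers determined by $d_0,d_1,\ell_1,\ell_2$ through the formulas in the context. Consider the control system $$\dot z=u_1g_1(z)+u_2g_2(z),\qquad z\in\mathbb R^5,\ u=(u_1,u_2)^\top\in\mathbb R^2,$$ $$g_1(z)=\begin{pmatrix}1\\0\\-z_2\\-z_3\\ \kappa z_2^3-z_4\end{pmatrix},\qquad g_2(z)=\begin{pmatrix}0\\1\\0\\-\alpha z_2^2\\-\theta z_2z_3\end{pmatrix}.$$ Let $\gamma>0$, and let $k_{12},k_{112},k_{1112}$ be positive integers such that there are no resonances of order up to $4$ in each of the tuples $$(k_{12},k_{112},k_{1112}),\quad (k_{12},2k_{112},k_{1112}),\quad (k_{12},k_{112},3k_{1112}),\quad (k_{12},2k_{112},3k_{1112}).$$ For $\varepsilon>0$ let $u_1^\varepsilon(t,z),u_2^\varepsilon(t,z)$ be the time-varying feedback law defined in the context (with parameters $\gamma,k_{12},k_{112},k_{1112}$). Then for any $\Delta>0$ there exists an $\bar\varepsilon>0$ such that for any $\varepsilon\in(0,\bar\varepsilon)$ and any $z^0\in B_\Delta(0)=\{z\in\mathbb R^5:\|z\|<\Delta\}$, the corresponding $\pi_\varepsilon$-solution $z(t)$ of the control system with initial data $z(0)=z^0$ and feedback law $(u_1^\varepsilon,u_2^\varepsilon)$ converges exponentially to zero as $t\to+\infty$ (that is, there are constants $C,\lambda>0$ with $\|z(t)\|\le Ce^{-\lambda t}$ for all $t\ge 0$).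
   Context: Parameters. The constants $\alpha,\kappa,\theta$ are given in terms of the length parameters $d_0,d_1,\ell_1,\ell_2$ by $$\alpha=\frac{d_0^3\left[\ell_1^3+\ell_1^2\ell_2-\ell_1\ell_2^2-d_1\ell_2(d_1+\ell_2)\right]+d_0\ell_1^3\left[d_0(\ell_1+2\ell_2)+\ell_2(\ell_1+\ell_2)\right]}{2(d_0+\ell_2)\ell_1^3},$$ $$\kappa=\frac{d_0^2\left[\frac32\ell_2^2(d_0+\ell_1)(d_1+\ell_1)-\ell_2\left(\ell_1^3+\frac12d_0\ell_1^2-d_1\ell_1\left(d_0+\frac32d_1\right)-\frac32d_0d_1^2\right)+\frac12d_0d_1^2\ell_1\right]}{3(d_0+\ell_2)\ell_1^3},$$ $$\theta=\frac{d_0^2\left[\ell_2^2(d_1+\ell_1)(d_0+\ell_1)+\left(d_0d_1+(d_0+d_1)\ell_1\right)d_1\ell_2+d_0d_1^2\ell_1\right]}{(d_0+\ell_2)\ell_1^3}.$$ Resonance. A tuple of numbers $(k_1,\dots,k_s)$ is in resonance of order $K$ ($K\in\mathbb N$) if there exist setwise coprime integers $(c_1,\dots,c_s)$ such that $\sum_{i=1}^s|c_i|=K$ and $\sum_{i=1}^sc_ik_i=0$. "No resonances of order up to $4$" means that the tuple is not in resonance of order $K$ for any $K\in\{1,2,3,4\}$. Feedback law. Put $\omega=2\pi/\varepsilon$ and $$a_1(z)=-\gamma z_1,\quad a_2(z)=-\gamma z_2,\quad a_{12}(z)=-\gamma(z_1z_2+z_3),\quad a_{112}(z)=-\gamma(z_1z_3+z_4+\alpha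 z_2^3),$$ $$a_{1112}(z)=-\gamma\left((\alpha+2\kappa-\theta)z_1z_2^3+(\alpha+3\kappa)z_2^2z_3+z_1z_4+z_5\right).$$ Then $$\begin{aligned}u_1^\varepsilon(t,z)={}&a_1(z)+\left(2k_{12}\omega|a_{12}(z)|\right)^{1/2}\cos(k_{12}\omega t)\\&+(2k_{112}\omega)^{2/3}|a_{112}(z)|^{1/3}\cos(k_{112}\omega t)+2(k_{1112}\omega)^{3/4}|a_{1112}(z)|^{1/4}\cos(k_{1112}\omega t),\end{aligned}$$ $$\begin{aligned}u_2^\varepsilon(t,z)={}&a_2(z)+\left(2k_{12}\omega|a_{12}(z)|\right)^{1/2}\,\mathrm{sign}(a_{12}(z))\,\sin(k_{12}\omega t)\\&-2(2k_{112}\omega)^{2/3}|a_{112}(z)|^{1/3}\,\mathrm{sign}(a_{112}(z))\,\cos(2k_{112}\omega t)\\&-6(k_{1112}\omega)^{3/4}|a_{1112}(z)|^{1/4}\,\mathrm{sign}(a_{1112}(z))\,\sin(3k_{1112}\omega t).\end{aligned}$$ $\pi_\varepsilon$-solution. For $\varepsilon>0$ let $t_j=j\varepsilon$, $j=0,1,2,\dots$. A function $z:[0,+\infty)\to\mathbb R^5$ is a $\pi_\varepsilon$-solution of the control system with the feedback law $(u_1^\varepsilon,u_2^\varepsilon)$ if $z(t)$ is continuous on $[0,+\infty)$ and, for each $j=0,1,2,\dots$, $$\dot z(t)=u_1^\varepsilon(t,z(t_j))\,g_1(z(t))+u_2^\varepsilon(t,z(t_j))\,g_2(z(t)),\qquad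 t\in[t_j,t_{j+1}).$$ Here $\|\cdot\|$ is the Euclidean norm. *)

theory Defs
  imports "HOL-Analysis.Analysis"
begin

definition alpha_param :: "real \<Rightarrow> real \<Rightarrow> real \<Rightarrow> real \<Rightarrow> real" where
  "alpha_param d0 d1 l1 l2 =
     (d0^3 * (l1^3 + l1^2 * l2 - l1 * l2^2 - d1 * l2 * (d1 + l2))
        + d0 * l1^3 * (d0 * (l1 + 2 * l2) + l2 * (l1 + l2)))
     / (2 * (d0 + l2) * l1^3)"

definition kappa_param :: "real \<Rightarrow> real \<Rightarrow> real \<Rightarrow> real \<Rightarrow> real" where
  "kappa_param d0 d1 l1 l2 =
     (d0^2 * (3/2 * l2^2 * (d0 + l1) * (d1 + l1)
        - l2 * (l1^3 + 1/2 * d0 * l1^2 - d1 * l1 * (d0 + 3/2 * d1) - 3/2 * d0 * d1^2)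
        + 1/2 * d0 * d1^2 * l1))
     / (3 * (d0 + l2) * l1^3)"

definition theta_param :: "real \<Rightarrow> real \<Rightarrow> real \<Rightarrow> real \<Rightarrow> real" where
  "theta_param d0 d1 l1 l2 =
     (d0^2 * (l2^2 * (d1 + l1) * (d0 + l1)
        + (d0 * d1 + (d0 + d1) * l1) * d1 * l2
        + d0 * d1^2 * l1))
     / ((d0 + l2) * l1^3)"

text \<open>Tuples are lists; setwise coprimality is \<open>Gcd (set cs) = 1\<close>, so the zero
  coefficient vector is excluded.\<close>

definition in_resonance :: "real list \<Rightarrow> nat \<Rightarrow> bool" where
  "in_resonance ks K \<longleftrightarrow>
     (\<exists>cs :: int list. length cs = length ks \<and> Gcd (set cs) = 1 \<and>
        (\<Sum>i<length ks. \<bar>cs ! i\<bar>) = int K \<and>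
        (\<Sum>i<length ks. of_int (cs ! i) * ks ! i) = 0)"

definition no_resonance_upto :: "nat \<Rightarrow> real list \<Rightarrow> bool" where
  "no_resonance_upto N ks \<longleftrightarrow> (\<forall>K\<in>{1..N}. \<not> in_resonance ks K)"

text \<open>In the index type \<open>5\<close> the numeral \<open>5\<close> coincides with \<open>0\<close>, so
  \<open>1, 2, 3, 4, 5\<close> are five distinct indices.\<close>

lemma vector_5 [simp]:
  "(vector [a, b, c, d, e] :: 'a::zero^5) $ 1 = a"
  "(vector [a, b, c, d, e] :: 'a::zero^5) $ 2 = b"
  "(vector [a, b, c, d, e] :: 'a::zero^5) $ 3 = c"
  "(vector [a, b, c, d, e] :: 'a::zero^5) $ 4 = d"
  "(vector [a, b, c, d, e] :: 'a::zero^5) $ 5 = e"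
  by (simp_all add: vector_def)

definition field_g1 :: "real \<Rightarrow> real^5 \<Rightarrow> real^5" where
  "field_g1 \<kappa> z = vector [1, 0, - z$2, - z$3, \<kappa> * (z$2)^3 - z$4]"

definition field_g2 :: "real \<Rightarrow> real \<Rightarrow> real^5 \<Rightarrow> real^5" where
  "field_g2 \<alpha> \<theta> z = vector [0, 1, 0, - \<alpha> * (z$2)^2, - \<theta> * z$2 * z$3]"

definition coeff_1 :: "real \<Rightarrow> real^5 \<Rightarrow> real" where
  "coeff_1 \<gamma> z = - \<gamma> * z$1"

definition coeff_2 :: "real \<Rightarrow> real^5 \<Rightarrow> real" where
  "coeff_2 \<gamma> z = - \<gamma> * z$2"

definition coeff_12 :: "real \<Rightarrow> real^5 \<Rightarrow> real" where
  "coeff_12 \<gamma> z = - \<gamma> * (z$1 * z$2 + z$3)"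

definition coeff_112 :: "real \<Rightarrow> real \<Rightarrow> real^5 \<Rightarrow> real" where
  "coeff_112 \<alpha> \<gamma> z = - \<gamma> * (z$1 * z$3 + z$4 + \<alpha> * (z$2)^3)"

definition coeff_1112 :: "real \<Rightarrow> real \<Rightarrow> real \<Rightarrow> real \<Rightarrow> real^5 \<Rightarrow> real" where
  "coeff_1112 \<alpha> \<kappa> \<theta> \<gamma> z =
     - \<gamma> * ((\<alpha> + 2 * \<kappa> - \<theta>) * z$1 * (z$2)^3
            + (\<alpha> + 3 * \<kappa>) * (z$2)^2 * z$3 + z$1 * z$4 + z$5)"

text \<open>All bases of \<open>powr\<close> below are nonnegative, and \<open>0 powr p = 0\<close> as intended.\<close>

definition feedback_u1 ::
  "real \<Rightarrow> real \<Rightarrow> real \<Rightarrow> real \<Rightarrow> nat \<Rightarrow> nat \<Rightarrow> nat \<Rightarrow> real \<Rightarrow> real \<Rightarrow> real^5 \<Rightarrow> real" where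
  "feedback_u1 \<alpha> \<kappa> \<theta> \<gamma> k12 k112 k1112 \<epsilon> t z =
     (let \<omega> = 2 * pi / \<epsilon>;
          a12 = coeff_12 \<gamma> z; a112 = coeff_112 \<alpha> \<gamma> z; a1112 = coeff_1112 \<alpha> \<kappa> \<theta> \<gamma> z
      in coeff_1 \<gamma> z
         + (2 * k12 * \<omega> * \<bar>a12\<bar>) powr (1/2) * cos (k12 * \<omega> * t)
         + (2 * k112 * \<omega>) powr (2/3) * \<bar>a112\<bar> powr (1/3) * cos (k112 * \<omega> * t)
         + 2 * (k1112 * \<omega>) powr (3/4) * \<bar>a1112\<bar> powr (1/4) * cos (k1112 * \<omega> * t))"

definition feedback_u2 ::
  "real \<Rightarrow> real \<Rightarrow> real \<Rightarrow> real \<Rightarrow> nat \<Rightarrow> nat \<Rightarrow> nat \<Rightarrow> real \<Rightarrow> real \<Rightarrow> real^5 \<Rightarrow> real" where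
  "feedback_u2 \<alpha> \<kappa> \<theta> \<gamma> k12 k112 k1112 \<epsilon> t z =
     (let \<omega> = 2 * pi / \<epsilon>;
          a12 = coeff_12 \<gamma> z; a112 = coeff_112 \<alpha> \<gamma> z; a1112 = coeff_1112 \<alpha> \<kappa> \<theta> \<gamma> z
      in coeff_2 \<gamma> z
         + (2 * k12 * \<omega> * \<bar>a12\<bar>) powr (1/2) * sgn a12 * sin (k12 * \<omega> * t)
         - 2 * (2 * k112 * \<omega>) powr (2/3) * \<bar>a112\<bar> powr (1/3) * sgn a112 * cos (2 * k112 * \<omega> * t)
         - 6 * (k1112 * \<omega>) powr (3/4) * \<bar>a1112\<bar> powr (1/4) * sgn a1112 * sin (3 * k1112 * \<omega> * t))"

text \<open>The state is sampled at \<open>t\<^sub>j = j * \<epsilon>\<close>; the derivative at \<open>t\<^sub>j\<close> is one-sided, and at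
  interior points of the sampling interval it is the ordinary derivative. Values at
  negative times are unconstrained.\<close>

definition pi_solution ::
  "real \<Rightarrow> ('a::real_normed_vector \<Rightarrow> 'a) \<Rightarrow> ('a \<Rightarrow> 'a)
    \<Rightarrow> (real \<Rightarrow> 'a \<Rightarrow> real) \<Rightarrow> (real \<Rightarrow> 'a \<Rightarrow> real) \<Rightarrow> (real \<Rightarrow> 'a) \<Rightarrow> bool" where
  "pi_solution \<epsilon> g1 g2 u1 u2 z \<longleftrightarrow>
     continuous_on {0..} z \<and>
     (\<forall>j::nat. \<forall>t\<in>{real j * \<epsilon>..<real (Suc j) * \<epsilon>}.
        (z has_vector_derivative
           u1 t (z (real j * \<epsilon>)) *\<^sub>R g1 (z t) + u2 t (z (real j * \<epsilon>)) *\<^sub>R g2 (z t))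
          (at t within {real j * \<epsilon>..<real (Suc j) * \<epsilon>}))"

end

theory Submission
  imports Defs
begin

text \<open>
  The vector fields \<open>g1\<close>, \<open>g2\<close> are homogeneous of degree \<open>-1\<close> and the feedback law is homogeneous of
  degree \<open>1\<close> for the dilation with weights \<open>1, 1, 2, 3, 4\<close>. The closed loop therefore commutes with this
  dilation, and the proof shows that the map from one sampled state to the next contracts all boxes
  \<open>weighted_box M r\<close> at a rate independent of \<open>r\<close> (\<open>closed_loop_contracts\<close>). Exponential convergence of
  the samples, and then of the whole trajectory, follows.

  Over one period the system is integrated in closed form (\<open>flow_solves\<close>): the state is a polynomial
  in the primitives \<open>V1\<close>, \<open>V2\<close> of the controls and in five of their moments. With \<open>\<epsilon> = \<eta> ^ 12\<close> the
  controls are combinations of modes that carry the factors \<open>\<eta> ^ 12\<close>, \<open>\<eta> ^ 6\<close>, \<open>\<eta> ^ 4\<close>, \<open>\<eta> ^ 3\<close>, so only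
  products of total weight at most \<open>12\<close> matter against the damping \<open>\<gamma> \<epsilon>\<close>. The time reversal of the
  period and the absence of resonances make most of their averages vanish. The surviving ones are
  \<open>\<epsilon>\<close> times \<open>a12\<close>, \<open>2 a112\<close> and \<open>6 a1112\<close>, and \<open>endpoint_expansion\<close> shows that the period map is
  \<open>(1 - \<gamma> \<epsilon>) z\<close> up to errors smaller than the damping by a factor of order \<open>\<eta>\<close>.

  One term escapes this scheme. The hypotheses allow \<open>k12 = 4 * k1112\<close>, and then \<open>\<integral> V2^2 v1\<close>, which
  multiplies \<open>[g2,[g1,g2]]\<close>, is in general of the same order \<open>\<epsilon>\<close> as the damping. This bracket acts on the last
  coordinate alone and is linear in \<open>z$2\<close>, while the moment grows at most with the power \<open>3/4\<close> of the last
  coordinate. Admitting a last coordinate up to \<open>(M r)^4\<close> with a large \<open>M\<close> turns this cascade structure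
  into a contraction.
\<close>

section \<open>Trigonometric integrals over one period\<close>

lemma has_integral_cos_period:
  "((\<lambda>s. cos (2 * pi * of_int m * s)) has_integral (if m = 0 then 1 else 0)) {0..1::real}"
proof (cases "m = 0")
  case True
  then show ?thesis using has_integral_const_real[of "1::real" 0 1] by simp
next
  case False
  have "((\<lambda>s. cos (2 * pi * of_int m * s)) has_integral
      (sin (2 * pi * of_int m * 1) / (2 * pi * of_int m) - sin (2 * pi * of_int m * 0) / (2 * pi * of_int m))) {0..1::real}"
    using False
    by (intro fundamental_theorem_of_calculus)
       (auto intro!: derivative_eq_intros simp: has_real_derivative_iff_has_vector_derivative[symmetric])
  moreover have "sin (2 * pi * of_int m) = 0"
    by (metis mult.commute sin_int_2pin)
  ultimately show ?thesis using False by simp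
qed

text \<open>The time reversal \<open>s \<mapsto> 1 - s\<close> of the period fixes cosines and flips sines. It removes every
  product with an odd number of sines whatever the frequencies are, which is how some resonances are
  harmless.\<close>

lemma integral_odd_about_half:
  fixes f :: "real \<Rightarrow> real"
  assumes "\<And>s. f (1 - s) = - f s"
  shows "integral {0..1} f = 0"
proof -
  have "integral {0..1} f = integral {0..1} (\<lambda>s. f (1 - s))"
  proof (cases "f integrable_on {0..1}")
    case True
    then have "(f has_integral integral {0..1} f) (cbox 0 1)"
      by (simp add: integrable_integral)
    from has_integral_affinity[OF this, of "-1" 1]
    have "((\<lambda>s. f (1 - s)) has_integral integral {0..1} f) ((\<lambda>x. 1 - x) ` {0..1})"
      by simp
    moreover have "(\<lambda>x. 1 - x) ` {0..1} = {0..1::real}"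
      by (auto simp: image_iff intro!: bexI[of _ "1 - _"])
    ultimately show ?thesis by (simp add: integral_unique)
  next
    case False
    have "\<not> (\<lambda>s. f (1 - s)) integrable_on {0..1}"
      using False by (simp add: assms integrable_neg_iff)
    with False show ?thesis by (simp add: not_integrable_integral)
  qed
  then show ?thesis by (simp add: assms)
qed

lemma sin_period_reflect: "sin (2 * pi * of_nat m * (1 - s)) = - sin (2 * pi * of_nat m * s)"
proof -
  have "2 * pi * of_nat m * (1 - s) = 2 * of_nat m * pi - 2 * pi * of_nat m * s"
    by (simp add: algebra_simps)
  then show ?thesis by (simp only: sin_diff sin_2npi cos_2npi mult_zero_left mult_1 diff_0 add_0_right add.right_neutral)
qed

lemma cos_period_reflect: "cos (2 * pi * of_nat m * (1 - s)) = cos (2 * pi * of_nat m * s)"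
proof -
  have "2 * pi * of_nat m * (1 - s) = 2 * of_nat m * pi - 2 * pi * of_nat m * s"
    by (simp add: algebra_simps)
  then show ?thesis by (simp only: cos_diff sin_2npi cos_2npi mult_zero_left mult_1 diff_0 add_0_right add.right_neutral)
qed

lemma integral_cos_period:
  "integral {0..1} (\<lambda>s. cos (2 * pi * of_int m * s)) = (if m = 0 then 1 else 0 :: real)"
  by (rule integral_unique[OF has_integral_cos_period])

lemma integrable_cos_period: "(\<lambda>s. cos (2 * pi * of_int m * s)) integrable_on {0..1::real}"
  using has_integral_cos_period by blast

lemma integral_sin_sin:
  "integral {0..1} (\<lambda>s. sin (2 * pi * of_nat a * s) * sin (2 * pi * of_nat b * s)) =
     (if a = b \<and> a > 0 then 1/2 else 0 :: real)"
proof -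
  have "(\<lambda>s. sin (2 * pi * of_nat a * s) * sin (2 * pi * of_nat b * s)) =
     (\<lambda>s. 1/2 * cos (2 * pi * of_int (int a - int b) * s) - 1/2 * cos (2 * pi * of_int (int a + int b) * s))"
    by (rule ext) (simp add: sin_times_sin algebra_simps diff_divide_distrib)
  then show ?thesis
    by (auto simp: integral_diff integral_mult_right integral_cos_period integrable_cos_period
        simp del: of_int_add of_int_diff intro!: integral_cong)
qed

lemma integral_sin_sin_cos:
  fixes a b c :: nat
  assumes "a > 0" "b > 0" "c > 0"
  shows "integral {0..1} (\<lambda>s. sin (2 * pi * of_nat a * s) * sin (2 * pi * of_nat b * s) * cos (2 * pi * of_nat c * s)) =
     ((if a = b + c then 1/4 else 0) + (if b = a + c then 1/4 else 0) - (if c = a + b then 1/4 else 0) :: real)"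
proof -
  let ?C = "\<lambda>m::int. \<lambda>s::real. 1/4 * cos (2 * pi * of_int m * s)"
  have "(\<lambda>s. sin (2 * pi * of_nat a * s) * sin (2 * pi * of_nat b * s) * cos (2 * pi * of_nat c * s)) =
     (\<lambda>s. ?C (int a - int b - int c) s + ?C (int a - int b + int c) s
          - ?C (int a + int b - int c) s - ?C (int a + int b + int c) s)"
  proof
    fix s
    let ?a = "2 * pi * of_nat a * s" and ?b = "2 * pi * of_nat b * s" and ?c = "2 * pi * of_nat c * s"
    have "sin ?a * sin ?b * cos ?c =
       1/4 * cos (?a - ?b - ?c) + 1/4 * cos (?a - ?b + ?c) - 1/4 * cos (?a + ?b - ?c) - 1/4 * cos (?a + ?b + ?c)"
      by (simp add: cos_add cos_diff sin_add sin_diff algebra_simps)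
    then show "sin ?a * sin ?b * cos ?c = ?C (int a - int b - int c) s + ?C (int a - int b + int c) s
          - ?C (int a + int b - int c) s - ?C (int a + int b + int c) s"
      by (simp add: algebra_simps)
  qed
  then show ?thesis using assms
    by (auto simp: integral_add integral_diff integral_mult_right integral_cos_period integrable_cos_period
        integrable_on_mult_right integrable_add integrable_diff
        simp del: of_int_add of_int_diff)
qed

lemma integral_cos_cos_cos:
  fixes a b c :: nat
  assumes "a > 0" "b > 0" "c > 0"
  shows "integral {0..1} (\<lambda>s. cos (2 * pi * of_nat a * s) * cos (2 * pi * of_nat b * s) * cos (2 * pi * of_nat c * s)) =
     ((if a = b + c then 1/4 else 0) + (if b = a + c then 1/4 else 0) + (if c = a + b then 1/4 else 0) :: real)"
proof -
  let ?C = "\<lambda>m::int. \<lambda>s::real. 1/4 * cos (2 * pi * of_int m * s)"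
  have "(\<lambda>s. cos (2 * pi * of_nat a * s) * cos (2 * pi * of_nat b * s) * cos (2 * pi * of_nat c * s)) =
     (\<lambda>s. ?C (int a - int b - int c) s + ?C (int a - int b + int c) s
          + ?C (int a + int b - int c) s + ?C (int a + int b + int c) s)"
  proof
    fix s
    let ?a = "2 * pi * of_nat a * s" and ?b = "2 * pi * of_nat b * s" and ?c = "2 * pi * of_nat c * s"
    have "cos ?a * cos ?b * cos ?c =
       1/4 * cos (?a - ?b - ?c) + 1/4 * cos (?a - ?b + ?c) + 1/4 * cos (?a + ?b - ?c) + 1/4 * cos (?a + ?b + ?c)"
      by (simp add: cos_add cos_diff sin_add sin_diff algebra_simps)
    then show "cos ?a * cos ?b * cos ?c = ?C (int a - int b - int c) s + ?C (int a - int b + int c) s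
          + ?C (int a + int b - int c) s + ?C (int a + int b + int c) s"
      by (simp add: algebra_simps)
  qed
  then show ?thesis using assms
    by (auto simp: integral_add integral_diff integral_mult_right integral_cos_period integrable_cos_period
        integrable_on_mult_right integrable_add integrable_diff
        simp del: of_int_add of_int_diff)
qed

lemma integral_sin_cubed_sin_triple:
  fixes k :: nat
  assumes "k > 0"
  shows "integral {0..1} (\<lambda>s. sin (2 * pi * of_nat k * s) ^ 3 * sin (2 * pi * of_nat (3 * k) * s)) = (- 1/8 :: real)"
proof -
  have sin3: "sin x ^ 3 * sin y = 3/4 * (sin x * sin y) - 1/4 * (sin (3 * x) * sin y)" for x y :: real
  proof -
    have "sin (3 * x) = 3 * sin x - 4 * sin x ^ 3"
    proof -
      have "sin (3 * x) = sin (2 * x + x)" by simp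
      also have "\<dots> = 3 * sin x * (cos x)^2 - sin x ^ 3"
        unfolding sin_add[of "2 * x"] sin_double cos_double
        by (simp add: algebra_simps power2_eq_square power3_eq_cube)
      also have "\<dots> = 3 * sin x - 4 * sin x ^ 3"
        unfolding cos_squared_eq by (simp add: algebra_simps power2_eq_square power3_eq_cube)
      finally show ?thesis .
    qed
    then show ?thesis by (simp only:) (simp add: algebra_simps)
  qed
  have "(\<lambda>s. sin (2 * pi * of_nat k * s) ^ 3 * sin (2 * pi * of_nat (3 * k) * s)) =
     (\<lambda>s. 3/4 * (sin (2 * pi * of_nat k * s) * sin (2 * pi * of_nat (3 * k) * s))
        - 1/4 * (sin (2 * pi * of_nat (3 * k) * s) * sin (2 * pi * of_nat (3 * k) * s)))"
    by (rule ext, subst sin3) (simp add: algebra_simps)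
  moreover have "(\<lambda>s. sin (2 * pi * of_nat a * s) * sin (2 * pi * of_nat b * s)) integrable_on {0..1::real}" for a b
    by (intro integrable_continuous_interval continuous_intros)
  ultimately show ?thesis using assms
    by (simp only: integral_diff integral_mult_right integrable_on_mult_right integral_sin_sin) simp
qed

lemma integral_cos_triple_cubed_cos:
  fixes k :: nat
  assumes "k > 0"
  shows "integral {0..1} (\<lambda>s. cos (2 * pi * of_nat (3 * k) * s) ^ 3 * cos (2 * pi * of_nat k * s)) = (0 :: real)"
proof -
  let ?C = "\<lambda>m::nat. \<lambda>s::real. 1/8 * cos (2 * pi * of_int (int m) * s)"
  have 1: "cos (3 * y) ^ 3 * cos y = 1/8 * cos (10 * y) + 1/8 * cos (8 * y) + 3 * (1/8 * cos (4 * y)) + 3 * (1/8 * cos (2 * y))" for y :: real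
  proof -
    have "cos x ^ 3 = 1/4 * cos (3 * x) + 3/4 * cos x" for x :: real
      by (simp only: cos_treble_cos) (simp add: field_simps)
    from this[of "3 * y"] have "cos (3 * y) ^ 3 * cos y = 1/4 * (cos (9 * y) * cos y) + 3/4 * (cos (3 * y) * cos y)"
      by (simp add: algebra_simps)
    moreover have "cos (9 * y) * cos y = 1/2 * (cos (8 * y) + cos (10 * y))"
      using cos_times_cos[of "9 * y" y] by (simp add: algebra_simps)
    moreover have "cos (3 * y) * cos y = 1/2 * (cos (2 * y) + cos (4 * y))"
      using cos_times_cos[of "3 * y" y] by (simp add: algebra_simps)
    ultimately show ?thesis by (simp only:) (simp add: field_simps)
  qed
  have "(\<lambda>s. cos (2 * pi * of_nat (3 * k) * s) ^ 3 * cos (2 * pi * of_nat k * s)) =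
     (\<lambda>s. ?C (10 * k) s + ?C (8 * k) s + 3 * ?C (4 * k) s + 3 * ?C (2 * k) s)"
  proof
    fix s
    show "cos (2 * pi * of_nat (3 * k) * s) ^ 3 * cos (2 * pi * of_nat k * s) =
      ?C (10 * k) s + ?C (8 * k) s + 3 * ?C (4 * k) s + 3 * ?C (2 * k) s"
      using 1[of "2 * pi * of_nat k * s"] by (simp add: algebra_simps)
  qed
  moreover have C: "(?C m has_integral 0) {0..1}" if "m > 0" for m
    using has_integral_mult_right[OF has_integral_cos_period[of "int m"], of "1/8"] that by simp
  have "((\<lambda>s. ?C (10 * k) s + ?C (8 * k) s + 3 * ?C (4 * k) s + 3 * ?C (2 * k) s) has_integral 0 + 0 + 3 * 0 + 3 * 0) {0..1}"
    by (intro has_integral_add has_integral_mult_right C) (use assms in auto)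
  ultimately show ?thesis by (simp only: integral_unique)
qed

section \<open>The modes of the feedback law and their resonances\<close>

text \<open>The drift and the three pairs of oscillating inputs; \<open>Osc12\<close>, \<open>Osc112\<close>, \<open>Osc1112\<close> are named after
  the Lie bracket that they generate.\<close>

datatype mode = Drift | Osc12 | Osc112 | Osc1112

lemma UNIV_mode: "UNIV = {Drift, Osc12, Osc112, Osc1112}"
  using mode.exhaust by auto

instance mode :: finite
  by standard (simp add: UNIV_mode)

lemma card_mode: "CARD(mode) = 4"
  by (simp add: UNIV_mode)

text \<open>The exponent of \<open>\<eta>\<close> with which a mode enters, where \<open>\<eta> ^ 12\<close> is the length of the sampling
  period.\<close>

fun weight :: "mode \<Rightarrow> nat" where
  "weight Drift = 12" | "weight Osc12 = 6" | "weight Osc112 = 4" | "weight Osc1112 = 3"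

lemma weight_ge_3: "3 \<le> weight i"
  by (cases i) auto

text \<open>The common pattern of all averages below: among the products of modes, those outside \<open>S\<close> either
  have a small coefficient (large weight) or a vanishing integral (parity or absence of resonance).\<close>

lemma integral_sum_near_special_terms:
  fixes \<phi> :: "'i \<Rightarrow> real \<Rightarrow> real" and c :: "'i \<Rightarrow> real" and B :: real
  assumes "finite I" "S \<subseteq> I" "B \<ge> 0"
    and cont: "\<And>i. i \<in> I \<Longrightarrow> continuous_on {0..1} (\<phi> i)"
    and le1: "\<And>i s. i \<in> I \<Longrightarrow> s \<in> {0..1} \<Longrightarrow> \<bar>\<phi> i s\<bar> \<le> 1"
    and negl: "\<And>i. i \<in> I - S \<Longrightarrow> \<bar>c i\<bar> \<le> B \<or> integral {0..1} (\<phi> i) = 0"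
  shows "\<bar>integral {0..1} (\<lambda>s. \<Sum>i\<in>I. c i * \<phi> i s) - (\<Sum>i\<in>S. c i * integral {0..1} (\<phi> i))\<bar> \<le> card I * B"
proof -
  have int: "\<phi> i integrable_on {0..1}" if "i \<in> I" for i
    using cont[OF that] by (rule integrable_continuous_interval)
  have abs_int: "\<bar>integral {0..1} (\<phi> i)\<bar> \<le> 1" if "i \<in> I" for i
    using integral_bound[of 0 1 "\<phi> i" 1] cont[OF that] le1[OF that] by simp
  have "integral {0..1} (\<lambda>s. \<Sum>i\<in>I. c i * \<phi> i s) = (\<Sum>i\<in>I. c i * integral {0..1} (\<phi> i))"
    using assms(1) int by (subst integral_sum) (auto intro: integrable_on_mult_right)
  also have "\<dots> - (\<Sum>i\<in>S. c i * integral {0..1} (\<phi> i)) = (\<Sum>i\<in>I - S. c i * integral {0..1} (\<phi> i))"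
    using assms(1,2) by (simp add: sum_diff)
  finally have eq: "integral {0..1} (\<lambda>s. \<Sum>i\<in>I. c i * \<phi> i s) - (\<Sum>i\<in>S. c i * integral {0..1} (\<phi> i))
     = (\<Sum>i\<in>I - S. c i * integral {0..1} (\<phi> i))" .
  have "\<bar>\<Sum>i\<in>I - S. c i * integral {0..1} (\<phi> i)\<bar> \<le> (\<Sum>i\<in>I - S. B)"
  proof (rule order_trans[OF sum_abs sum_mono])
    fix i assume i: "i \<in> I - S"
    show "\<bar>c i * integral {0..1} (\<phi> i)\<bar> \<le> B"
    proof (cases "integral {0..1} (\<phi> i) = 0")
      case False
      then have "\<bar>c i\<bar> \<le> B" using negl[OF i] by simp
      then have "\<bar>c i\<bar> * \<bar>integral {0..1} (\<phi> i)\<bar> \<le> B * 1"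
        using abs_int[of i] i \<open>B \<ge> 0\<close> by (intro mult_mono) auto
      then show ?thesis by (simp add: abs_mult)
    qed (use \<open>B \<ge> 0\<close> in simp)
  qed
  also have "\<dots> \<le> card I * B"
    using assms(1,3) by (simp add: card_mono mult_right_mono)
  finally show ?thesis by (simp add: eq)
qed

lemma sum_times_sum_modes:
  fixes c :: "'i::finite \<Rightarrow> real" and d :: "'j::finite \<Rightarrow> real"
  shows "(\<Sum>i\<in>UNIV. c i * f i) * (\<Sum>j\<in>UNIV. d j * g j) =
    (\<Sum>p\<in>UNIV. (c (fst p) * d (snd p)) * (f (fst p) * g (snd p)))"
  by (simp add: sum_product sum.cartesian_product case_prod_beta mult_ac flip: UNIV_Times_UNIV)

text \<open>The eight inequalities are what the averages of the mode products require once parity has been used: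
  weight at most \<open>12\<close> for the moments of \<open>V1\<close>, less than \<open>12\<close> for \<open>\<integral> V2^2 v1\<close>. Resonances that involve both \<open>k1112\<close> and \<open>3 * k1112\<close>, such as \<open>k12 = 4 * k1112\<close> or
  \<open>k112 = 4 * k1112\<close>, remain possible.\<close>

locale oscillation =
  fixes k12 k112 k1112 :: nat
  assumes freq_pos: "k12 > 0" "k112 > 0" "k1112 > 0"
    and nonresonant: "k12 \<noteq> k112" "k12 \<noteq> k1112" "k12 \<noteq> 3 * k1112" "k112 \<noteq> k1112"
      "k112 \<noteq> 3 * k1112" "k112 \<noteq> 6 * k1112" "k1112 \<noteq> 3 * k112" "k1112 \<noteq> 4 * k112"
begin

fun wave1 :: "mode \<Rightarrow> real \<Rightarrow> real" where
  "wave1 Drift s = 1"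
| "wave1 Osc12 s = cos (2 * pi * k12 * s)"
| "wave1 Osc112 s = cos (2 * pi * k112 * s)"
| "wave1 Osc1112 s = cos (2 * pi * k1112 * s)"

fun wave2 :: "mode \<Rightarrow> real \<Rightarrow> real" where
  "wave2 Drift s = 1"
| "wave2 Osc12 s = sin (2 * pi * k12 * s)"
| "wave2 Osc112 s = cos (2 * pi * real (2 * k112) * s)"
| "wave2 Osc1112 s = sin (2 * pi * real (3 * k1112) * s)"

fun prim1 :: "mode \<Rightarrow> real \<Rightarrow> real" where
  "prim1 Drift s = s"
| "prim1 Osc12 s = 1 / (2 * pi * k12) * sin (2 * pi * k12 * s)"
| "prim1 Osc112 s = 1 / (2 * pi * k112) * sin (2 * pi * k112 * s)"
| "prim1 Osc1112 s = 1 / (2 * pi * k1112) * sin (2 * pi * k1112 * s)"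

fun prim2 :: "mode \<Rightarrow> real \<Rightarrow> real" where
  "prim2 Drift s = s"
| "prim2 Osc12 s = - 1 / (2 * pi * k12) * cos (2 * pi * k12 * s)"
| "prim2 Osc112 s = 1 / (2 * pi * real (2 * k112)) * sin (2 * pi * real (2 * k112) * s)"
| "prim2 Osc1112 s = - 1 / (2 * pi * real (3 * k1112)) * cos (2 * pi * real (3 * k1112) * s)"

lemma prim1_deriv: "(prim1 i has_real_derivative wave1 i s) (at s within T)"
proof (cases i)
  case Drift
  then have "prim1 i = (\<lambda>s. s)" by auto
  with Drift show ?thesis by simp
next
  case Osc12
  then have "prim1 i = (\<lambda>s. 1 / (2 * pi * k12) * sin (2 * pi * k12 * s))" by auto
  with Osc12 freq_pos show ?thesis by (auto intro!: derivative_eq_intros simp del: of_nat_mult)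
next
  case Osc112
  then have "prim1 i = (\<lambda>s. 1 / (2 * pi * k112) * sin (2 * pi * k112 * s))" by auto
  with Osc112 freq_pos show ?thesis by (auto intro!: derivative_eq_intros simp del: of_nat_mult)
next
  case Osc1112
  then have "prim1 i = (\<lambda>s. 1 / (2 * pi * k1112) * sin (2 * pi * k1112 * s))" by auto
  with Osc1112 freq_pos show ?thesis by (auto intro!: derivative_eq_intros simp del: of_nat_mult)
qed

lemma prim2_deriv: "(prim2 i has_real_derivative wave2 i s) (at s within T)"
proof (cases i)
  case Drift
  then have "prim2 i = (\<lambda>s. s)" by auto
  with Drift show ?thesis by simp
next
  case Osc12
  then have "prim2 i = (\<lambda>s. - 1 / (2 * pi * k12) * cos (2 * pi * k12 * s))" by auto
  with Osc12 freq_pos show ?thesis by (auto intro!: derivative_eq_intros simp del: of_nat_mult)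
next
  case Osc112
  then have "prim2 i = (\<lambda>s. 1 / (2 * pi * real (2 * k112)) * sin (2 * pi * real (2 * k112) * s))" by auto
  with Osc112 freq_pos show ?thesis by (auto intro!: derivative_eq_intros simp del: of_nat_mult)
next
  case Osc1112
  then have "prim2 i = (\<lambda>s. - 1 / (2 * pi * real (3 * k1112)) * cos (2 * pi * real (3 * k1112) * s))" by auto
  with Osc1112 freq_pos show ?thesis by (auto intro!: derivative_eq_intros simp del: of_nat_mult)
qed

lemma continuous_wave [continuous_intros]:
  "continuous_on T (wave1 i)" "continuous_on T (wave2 i)"
  "continuous_on T (prim1 i)" "continuous_on T (prim2 i)"
proof -
  show "continuous_on T (prim1 i)" "continuous_on T (prim2 i)"
    by (rule DERIV_continuous_on, rule prim1_deriv prim2_deriv)+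
  have "continuous_on T (\<lambda>s. wave1 i s)"
    by (cases i) (auto intro!: continuous_intros)
  then show "continuous_on T (wave1 i)" by simp
  have "continuous_on T (\<lambda>s. wave2 i s)"
    by (cases i) (auto intro!: continuous_intros)
  then show "continuous_on T (wave2 i)" by simp
qed

lemma abs_over_freq_le_1:
  assumes "n > 0" "\<bar>x\<bar> \<le> 1" shows "\<bar>x\<bar> / (2 * pi * of_nat n) \<le> (1::real)"
proof -
  have "1 * 1 \<le> (2 * pi) * of_nat n"
    using assms(1) pi_gt3 by (intro mult_mono) auto
  then show ?thesis using assms(2) by (simp add: divide_le_eq)
qed

lemma abs_wave_le_1:
  "\<bar>wave1 i s\<bar> \<le> 1" "\<bar>wave2 i s\<bar> \<le> 1"
  "s \<in> {0..1} \<Longrightarrow> \<bar>prim1 i s\<bar> \<le> 1" "s \<in> {0..1} \<Longrightarrow> \<bar>prim2 i s\<bar> \<le> 1"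
proof -
  show "\<bar>wave1 i s\<bar> \<le> 1" "\<bar>wave2 i s\<bar> \<le> 1" by (cases i; simp)+
  show "s \<in> {0..1} \<Longrightarrow> \<bar>prim1 i s\<bar> \<le> 1"
    using freq_pos abs_over_freq_le_1[of k12 "sin (2 * pi * k12 * s)"]
       abs_over_freq_le_1[of k112 "sin (2 * pi * k112 * s)"]
       abs_over_freq_le_1[of k1112 "sin (2 * pi * k1112 * s)"]
    by (cases i) (auto simp: abs_mult simp del: of_nat_mult)
  show "s \<in> {0..1} \<Longrightarrow> \<bar>prim2 i s\<bar> \<le> 1"
    using freq_pos abs_over_freq_le_1[of k12 "cos (2 * pi * k12 * s)"]
       abs_over_freq_le_1[of "2 * k112" "sin (2 * pi * real (2 * k112) * s)"]
       abs_over_freq_le_1[of "3 * k1112" "cos (2 * pi * real (3 * k1112) * s)"]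
    by (cases i) (auto simp: abs_mult simp del: of_nat_mult)
qed

lemma wave_reflect:
  assumes "i \<noteq> Drift"
  shows "wave1 i (1 - s) = wave1 i s" "prim1 i (1 - s) = - prim1 i s"
    "wave2 i (1 - s) = (if i = Osc112 then wave2 i s else - wave2 i s)"
    "prim2 i (1 - s) = (if i = Osc112 then - prim2 i s else prim2 i s)"
  using assms cos_period_reflect[of _ s] sin_period_reflect[of _ s]
    cos_period_reflect[of "2 * k112" s] sin_period_reflect[of "2 * k112" s]
    cos_period_reflect[of "3 * k1112" s] sin_period_reflect[of "3 * k1112" s]
  by (cases i; simp del: of_nat_mult)+

lemma integral_prim1_wave2:
  assumes "weight i + weight j \<le> 12" "(i, j) \<noteq> (Osc12, Osc12)"
  shows "integral {0..1} (\<lambda>s. prim1 i s * wave2 j s) = 0"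
proof -
  from assms have nd: "i \<noteq> Drift" "j \<noteq> Drift"
    using weight_ge_3[of i] weight_ge_3[of j] by auto
  show ?thesis
  proof (cases "j = Osc112")
    case True
    then show ?thesis
      by (intro integral_odd_about_half) (simp add: wave_reflect nd del: wave1.simps wave2.simps prim1.simps prim2.simps)
  next
    case False
    then show ?thesis using nd assms(2) freq_pos nonresonant
        integral_sin_sin[of k12 k12] integral_sin_sin[of k12 "3 * k1112"]
        integral_sin_sin[of k112 k12] integral_sin_sin[of k112 "3 * k1112"]
        integral_sin_sin[of k1112 k12] integral_sin_sin[of k1112 "3 * k1112"]
      by (cases i; cases j) (simp_all del: of_nat_mult)
  qed
qed

lemma integral_prim1_wave2_Osc12:
  "integral {0..1} (\<lambda>s. prim1 Osc12 s * wave2 Osc12 s) = 1 / (4 * pi * k12)"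
proof -
  have "(\<lambda>s. prim1 Osc12 s * wave2 Osc12 s) =
    (\<lambda>s. 1 / (2 * pi * k12) * (sin (2 * pi * k12 * s) * sin (2 * pi * k12 * s)))" by simp
  then show ?thesis
    using integral_sin_sin[of k12 k12] freq_pos by (simp only: integral_mult_right) simp
qed

text \<open>For \<open>k \<noteq> Osc112\<close> the integrand is a product of three sines, hence odd about the middle of the period;
  this covers the resonance \<open>k112 = 4 * k1112\<close>.\<close>

lemma integral_prim1_sq_wave2:
  assumes "weight i + weight j + weight k \<le> 12" "((i, j), k) \<noteq> ((Osc112, Osc112), Osc112)"
  shows "integral {0..1} (\<lambda>s. prim1 i s * prim1 j s * wave2 k s) = 0"
proof -
  from assms have nd: "i \<noteq> Drift" "j \<noteq> Drift" "k \<noteq> Drift"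
    using weight_ge_3[of i] weight_ge_3[of j] weight_ge_3[of k] by auto
  show ?thesis
  proof (cases "k = Osc112")
    case False
    then show ?thesis
      by (intro integral_odd_about_half) (simp add: wave_reflect nd del: wave1.simps wave2.simps prim1.simps prim2.simps)
  next
    case True
    then have 1: "i \<noteq> Osc12" "j \<noteq> Osc12"
      using assms weight_ge_3[of i] weight_ge_3[of j] by auto
    define m where "m = (if i = Osc112 then k112 else k1112)"
    define n where "n = (if j = Osc112 then k112 else k1112)"
    have "prim1 i s = 1 / (2 * pi * m) * sin (2 * pi * m * s)"
      "prim1 j s = 1 / (2 * pi * n) * sin (2 * pi * n * s)" for s
      using 1 nd by (cases i; cases j; simp add: m_def n_def)+
    then have "(\<lambda>s. prim1 i s * prim1 j s * wave2 k s) =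
      (\<lambda>s. 1 / (2 * pi * m) * (1 / (2 * pi * n))
         * (sin (2 * pi * m * s) * sin (2 * pi * n * s) * cos (2 * pi * real (2 * k112) * s)))"
      using True by simp
    moreover have "m > 0" "n > 0" "m \<noteq> n + 2 * k112" "n \<noteq> m + 2 * k112" "2 * k112 \<noteq> m + n"
      using 1 nd assms(2) True freq_pos nonresonant by (cases i; cases j; simp add: m_def n_def)+
    ultimately show ?thesis
      using integral_sin_sin_cos[of m n "2 * k112"] freq_pos
      by (simp only: integral_mult_right) simp
  qed
qed

lemma integral_prim1_sq_wave2_Osc112:
  "integral {0..1} (\<lambda>s. prim1 Osc112 s * prim1 Osc112 s * wave2 Osc112 s) = - 1 / (4 * (2 * pi * k112)^2)"
proof -
  have "(\<lambda>s. prim1 Osc112 s * prim1 Osc112 s * wave2 Osc112 s) =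
    (\<lambda>s. 1 / (2 * pi * k112)^2 * (sin (2 * pi * k112 * s) * sin (2 * pi * k112 * s) * cos (2 * pi * real (2 * k112) * s)))"
    by (auto simp: power2_eq_square field_simps simp del: of_nat_mult)
  then show ?thesis
    using integral_sin_sin_cos[of k112 k112 "2 * k112"] freq_pos
    by (simp only: integral_mult_right) (simp del: of_nat_mult)
qed

text \<open>Strict inequality of the weights is essential: for \<open>k12 = 4 * k1112\<close> the product of one \<open>Osc12\<close> and
  two \<open>Osc1112\<close> modes has weight \<open>12\<close> and a nonzero average.\<close>

lemma integral_prim2_sq_wave1:
  assumes "weight i + weight j + weight k < 12"
  shows "integral {0..1} (\<lambda>s. prim2 i s * prim2 j s * wave1 k s) = 0"
proof -
  from assms have nd: "i \<noteq> Drift" "j \<noteq> Drift" "k \<noteq> Drift" "i \<noteq> Osc12" "j \<noteq> Osc12" "k \<noteq> Osc12"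
    using weight_ge_3[of i] weight_ge_3[of j] weight_ge_3[of k] by auto
  consider (odd) "(i = Osc112) \<noteq> (j = Osc112)" | (oo) "i = Osc112" "j = Osc112" "k = Osc1112"
    | (cc) "i = Osc1112" "j = Osc1112" "k = Osc112 \<or> k = Osc1112"
    using assms nd by (cases i; cases j; cases k) auto
  then show ?thesis
  proof cases
    case odd
    then show ?thesis
      by (intro integral_odd_about_half) (auto simp: wave_reflect nd simp del: wave1.simps wave2.simps prim1.simps prim2.simps)
  next
    case oo
    have "(\<lambda>s. prim2 i s * prim2 j s * wave1 k s) =
      (\<lambda>s. 1 / (2 * pi * real (2 * k112))^2 * (sin (2 * pi * real (2 * k112) * s) * sin (2 * pi * real (2 * k112) * s) * cos (2 * pi * k1112 * s)))"
      using oo by (auto simp: power2_eq_square field_simps simp del: of_nat_mult)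
    then show ?thesis
      using integral_sin_sin_cos[of "2 * k112" "2 * k112" k1112] freq_pos nonresonant
      by (simp only: integral_mult_right) (simp del: of_nat_mult)
  next
    case cc
    define m where "m = (if k = Osc112 then k112 else k1112)"
    have m: "m > 0" "m \<noteq> 6 * k1112" using freq_pos nonresonant by (auto simp: m_def)
    have "(\<lambda>s. prim2 i s * prim2 j s * wave1 k s) =
      (\<lambda>s. 1 / (2 * pi * real (3 * k1112))^2 * (cos (2 * pi * real (3 * k1112) * s) * cos (2 * pi * real (3 * k1112) * s) * cos (2 * pi * m * s)))"
      using cc by (auto simp: power2_eq_square field_simps m_def simp del: of_nat_mult)
    then show ?thesis
      using integral_cos_cos_cos[of "3 * k1112" "3 * k1112" m] freq_pos m
      by (simp only: integral_mult_right) (simp del: of_nat_mult)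
  qed
qed

lemma integral_prim1_cubed_wave2:
  "integral {0..1} (\<lambda>s. prim1 Osc1112 s * prim1 Osc1112 s * prim1 Osc1112 s * wave2 Osc1112 s)
    = - 1 / (8 * (2 * pi * k1112)^3)"
proof -
  have "(\<lambda>s. prim1 Osc1112 s * prim1 Osc1112 s * prim1 Osc1112 s * wave2 Osc1112 s) =
    (\<lambda>s. 1 / (2 * pi * k1112)^3 * (sin (2 * pi * k1112 * s)^3 * sin (2 * pi * real (3 * k1112) * s)))"
    by (auto simp: power3_eq_cube field_simps simp del: of_nat_mult)
  then show ?thesis
    using integral_sin_cubed_sin_triple[of k1112] freq_pos
    by (simp only: integral_mult_right) (simp del: of_nat_mult)
qed

lemma integral_prim2_cubed_wave1:
  "integral {0..1} (\<lambda>s. prim2 Osc1112 s * prim2 Osc1112 s * prim2 Osc1112 s * wave1 Osc1112 s) = 0"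
proof -
  have "(\<lambda>s. prim2 Osc1112 s * prim2 Osc1112 s * prim2 Osc1112 s * wave1 Osc1112 s) =
    (\<lambda>s. - 1 / (2 * pi * real (3 * k1112))^3 * (cos (2 * pi * real (3 * k1112) * s)^3 * cos (2 * pi * k1112 * s)))"
    by (auto simp: power3_eq_cube field_simps simp del: of_nat_mult)
  then show ?thesis
    using integral_cos_triple_cubed_cos[of k1112] freq_pos
    by (simp only: integral_mult_right mult_zero_right)
qed

end

section \<open>Moments of the controls\<close>

text \<open>With \<open>\<epsilon> = \<eta> ^ 12\<close>, the four modes enter the controls, multiplied by the length \<open>\<epsilon>\<close> of the
  period, with the factors \<open>\<eta> ^ 12\<close>, \<open>\<eta> ^ 6\<close>, \<open>\<eta> ^ 4\<close> and \<open>\<eta> ^ 3\<close>; these are the powers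
  \<open>1\<close>, \<open>1/2\<close>, \<open>1/3\<close> and \<open>1/4\<close> of \<open>\<epsilon>\<close>. The amplitudes \<open>c\<close> and \<open>d\<close> depend on the sampled state,
  and \<open>R\<close> measures its size. Every moment below is a sum of products of modes, so it is known up to
  \<open>\<eta> ^ 13\<close> as soon as the products of total weight at most \<open>12\<close> are known.\<close>

locale modulated_oscillation = oscillation +
  fixes \<eta> R :: real and c d :: "mode \<Rightarrow> real"
  assumes \<eta>: "0 \<le> \<eta>" "\<eta> \<le> 1" and R: "0 \<le> R"
    and c_le: "\<And>i. \<bar>c i\<bar> \<le> R" and d_le: "\<And>i. \<bar>d i\<bar> \<le> R"
begin

definition v1 :: "real \<Rightarrow> real" where
  "v1 s = (\<Sum>i\<in>UNIV. (\<eta> ^ weight i * c i) * wave1 i s)"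

definition v2 :: "real \<Rightarrow> real" where
  "v2 s = (\<Sum>i\<in>UNIV. (\<eta> ^ weight i * d i) * wave2 i s)"

definition V1 :: "real \<Rightarrow> real" where
  "V1 s = (\<Sum>i\<in>UNIV. (\<eta> ^ weight i * c i) * prim1 i s)"

text \<open>\<open>V2c\<close> is the primitive of \<open>v2\<close> in which every oscillating mode has mean zero, so that its moments
  are trigonometric averages; the state is expressed by \<open>V2\<close>, which vanishes at \<open>0\<close>.\<close>

definition V2c :: "real \<Rightarrow> real" where
  "V2c s = (\<Sum>i\<in>UNIV. (\<eta> ^ weight i * d i) * prim2 i s)"

definition V2 :: "real \<Rightarrow> real" where
  "V2 s = V2c s - V2c 0"

lemma V1_deriv: "(V1 has_real_derivative v1 s) (at s within T)"
  unfolding V1_def v1_def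
  by (intro DERIV_sum DERIV_cmult prim1_deriv)

lemma V2c_deriv: "(V2c has_real_derivative v2 s) (at s within T)"
  unfolding V2c_def v2_def
  by (intro DERIV_sum DERIV_cmult prim2_deriv)

lemma V2_deriv: "(V2 has_real_derivative v2 s) (at s within T)"
  unfolding V2_def using DERIV_diff[OF V2c_deriv DERIV_const] by fastforce

lemma continuous_v [continuous_intros]:
  "continuous_on T v1" "continuous_on T v2" "continuous_on T V1" "continuous_on T V2c" "continuous_on T V2"
proof -
  show "continuous_on T V1" "continuous_on T V2" "continuous_on T V2c"
    by (rule DERIV_continuous_on, rule V1_deriv V2_deriv V2c_deriv)+
  show "continuous_on T v1" "continuous_on T v2"
    unfolding v1_def[abs_def] v2_def[abs_def] by (intro continuous_intros)+
qed

lemma amplitude_le: "\<bar>\<eta> ^ weight i * c i\<bar> \<le> \<eta> ^ weight i * R ^ 1" "\<bar>\<eta> ^ weight i * d i\<bar> \<le> \<eta> ^ weight i * R ^ 1"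
  using \<eta> c_le[of i] d_le[of i] by (simp_all add: abs_mult mult_left_mono)

lemma amplitude_product_le:
  assumes "\<bar>x\<bar> \<le> \<eta> ^ m * R ^ k" "\<bar>y\<bar> \<le> \<eta> ^ n * R ^ l"
  shows "\<bar>x * y\<bar> \<le> \<eta> ^ (m + n) * R ^ (k + l)"
proof -
  have "\<bar>x\<bar> * \<bar>y\<bar> \<le> (\<eta> ^ m * R ^ k) * (\<eta> ^ n * R ^ l)"
    using assms \<eta> R by (intro mult_mono) auto
  then show ?thesis by (simp add: abs_mult power_add mult_ac)
qed

lemma amplitude_product_le_order:
  assumes "\<bar>x\<bar> \<le> \<eta> ^ m * B" "n \<le> m" "0 \<le> B"
  shows "\<bar>x\<bar> \<le> \<eta> ^ n * B"
  using assms(1) mult_right_mono[OF power_decreasing[OF \<open>n \<le> m\<close> \<eta>] \<open>0 \<le> B\<close>] by linarith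

lemma abs_prod_le_1: "\<bar>x\<bar> \<le> 1 \<Longrightarrow> \<bar>y\<bar> \<le> 1 \<Longrightarrow> \<bar>x * y\<bar> \<le> (1::real)"
  by (simp add: abs_mult mult_le_one)

lemma abs_V_le:
  "\<bar>v1 s\<bar> \<le> 4 * (\<eta> ^ 3 * R)" "\<bar>v2 s\<bar> \<le> 4 * (\<eta> ^ 3 * R)"
  "s \<in> {0..1} \<Longrightarrow> \<bar>V2c s\<bar> \<le> 4 * (\<eta> ^ 3 * R)"
proof -
  have *: "\<bar>\<Sum>i\<in>(UNIV::mode set). a i * f i\<bar> \<le> 4 * (\<eta> ^ 3 * R)"
    if "\<And>i. \<bar>a i\<bar> \<le> \<eta> ^ weight i * R ^ 1" "\<And>i. \<bar>f i\<bar> \<le> 1" for a f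
  proof -
    have "\<bar>a i * f i\<bar> \<le> \<eta> ^ 3 * R" for i
    proof -
      have "\<bar>a i\<bar> \<le> \<eta> ^ 3 * R"
        using amplitude_product_le_order[OF that(1)[of i], of 3] weight_ge_3 R by simp
      then have "\<bar>a i\<bar> * \<bar>f i\<bar> \<le> (\<eta> ^ 3 * R) * 1"
        using that(2)[of i] \<eta> R by (intro mult_mono) auto
      then show ?thesis by (simp add: abs_mult)
    qed
    then have "\<bar>\<Sum>i\<in>(UNIV::mode set). a i * f i\<bar> \<le> (\<Sum>i\<in>(UNIV::mode set). \<eta> ^ 3 * R)"
      by (intro order_trans[OF sum_abs sum_mono])
    then show ?thesis by (simp add: card_mode)
  qed
  show "\<bar>v1 s\<bar> \<le> 4 * (\<eta> ^ 3 * R)" "\<bar>v2 s\<bar> \<le> 4 * (\<eta> ^ 3 * R)"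
    "s \<in> {0..1} \<Longrightarrow> \<bar>V2c s\<bar> \<le> 4 * (\<eta> ^ 3 * R)"
    unfolding v1_def v2_def V2c_def
    by (rule *, rule amplitude_le, erule abs_wave_le_1 | rule *, rule amplitude_le, rule abs_wave_le_1)+
qed

lemma V_at_ends: "V1 0 = 0" "V2 0 = 0" "V1 1 = \<eta> ^ 12 * c Drift" "V2 1 = \<eta> ^ 12 * d Drift"
proof -
  have sin0: "sin (2 * pi * real m) = 0" and cos1: "cos (2 * pi * real m) = 1" for m :: nat
    using sin_2npi[of m] cos_2npi[of m] by (simp_all only: mult.commute mult.left_commute)
  show "V1 0 = 0" "V2 0 = 0" "V1 1 = \<eta> ^ 12 * c Drift" "V2 1 = \<eta> ^ 12 * d Drift"
    by (simp_all add: V1_def V2_def V2c_def UNIV_mode sin0 cos1 del: of_nat_mult)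
qed

lemma area_average:
  "\<bar>integral {0..1} (\<lambda>s. V1 s * v2 s) - \<eta> ^ 12 * (c Osc12 * d Osc12 / (4 * pi * k12))\<bar>
     \<le> 16 * (\<eta> ^ 13 * R ^ 2)"
proof -
  let ?a = "\<lambda>i. \<eta> ^ weight i * c i" and ?b = "\<lambda>i. \<eta> ^ weight i * d i"
  let ?\<phi> = "\<lambda>p s. prim1 (fst p) s * wave2 (snd p) s"
  let ?c = "\<lambda>p. ?a (fst p) * ?b (snd p)"
  have "\<bar>integral {0..1} (\<lambda>s. \<Sum>p\<in>UNIV. ?c p * ?\<phi> p s) - (\<Sum>p\<in>{(Osc12, Osc12)}. ?c p * integral {0..1} (?\<phi> p))\<bar>
    \<le> real (card (UNIV :: (mode \<times> mode) set)) * (\<eta> ^ 13 * R ^ 2)"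
  proof (rule integral_sum_near_special_terms)
    fix p assume p: "p \<in> UNIV - {(Osc12, Osc12)}"
    show "\<bar>?c p\<bar> \<le> \<eta> ^ 13 * R\<^sup>2 \<or> integral {0..1} (?\<phi> p) = 0"
    proof (cases "weight (fst p) + weight (snd p) \<le> 12")
      case True
      then show ?thesis using p integral_prim1_wave2[of "fst p" "snd p"] by auto
    next
      case False
      have "\<bar>?c p\<bar> \<le> \<eta> ^ (weight (fst p) + weight (snd p)) * R ^ (1 + 1)"
        by (intro amplitude_product_le amplitude_le)
      from amplitude_product_le_order[OF this, of 13] False R show ?thesis by (simp add: numeral_2_eq_2)
    qed
  qed (use \<eta> R in \<open>auto intro!: continuous_intros abs_prod_le_1 abs_wave_le_1\<close>)
  moreover have "(\<Sum>p\<in>{(Osc12, Osc12)}. ?c p * integral {0..1} (?\<phi> p)) = \<eta> ^ 12 * (c Osc12 * d Osc12 / (4 * pi * k12))"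
    by (simp add: integral_prim1_wave2_Osc12 power_add[symmetric] del: wave2.simps prim1.simps)
  ultimately show ?thesis
    by (simp add: V1_def v2_def sum_times_sum_modes card_mode del: wave2.simps prim1.simps)
qed

lemma third_order_average:
  "\<bar>integral {0..1} (\<lambda>s. V1 s ^ 2 * v2 s) + \<eta> ^ 12 * (c Osc112 ^ 2 * d Osc112 / (4 * (2 * pi * k112)^2))\<bar>
     \<le> 64 * (\<eta> ^ 13 * R ^ 3)"
proof -
  let ?a = "\<lambda>i. \<eta> ^ weight i * c i" and ?b = "\<lambda>i. \<eta> ^ weight i * d i"
  let ?\<phi> = "\<lambda>p s. prim1 (fst (fst p)) s * prim1 (snd (fst p)) s * wave2 (snd p) s"
  let ?c = "\<lambda>p. ?a (fst (fst p)) * ?a (snd (fst p)) * ?b (snd p)"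
  let ?s = "((Osc112, Osc112), Osc112)"
  have "\<bar>integral {0..1} (\<lambda>s. \<Sum>p\<in>UNIV. ?c p * ?\<phi> p s) - (\<Sum>p\<in>{?s}. ?c p * integral {0..1} (?\<phi> p))\<bar>
    \<le> real (card (UNIV :: ((mode \<times> mode) \<times> mode) set)) * (\<eta> ^ 13 * R ^ 3)"
  proof (rule integral_sum_near_special_terms)
    fix p assume p: "p \<in> UNIV - {?s}"
    let ?w = "weight (fst (fst p)) + weight (snd (fst p)) + weight (snd p)"
    show "\<bar>?c p\<bar> \<le> \<eta> ^ 13 * R ^ 3 \<or> integral {0..1} (?\<phi> p) = 0"
    proof (cases "?w \<le> 12")
      case True
      then show ?thesis using p integral_prim1_sq_wave2[of "fst (fst p)" "snd (fst p)" "snd p"] by auto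
    next
      case False
      have "\<bar>?c p\<bar> \<le> \<eta> ^ ?w * R ^ (1 + 1 + 1)"
        by (intro amplitude_product_le amplitude_le)
      from amplitude_product_le_order[OF this, of 13] False R show ?thesis by (simp add: numeral_3_eq_3)
    qed
  qed (use \<eta> R in \<open>auto intro!: continuous_intros abs_prod_le_1 abs_wave_le_1\<close>)
  moreover have "(\<Sum>p\<in>{?s}. ?c p * integral {0..1} (?\<phi> p)) = - (\<eta> ^ 12 * (c Osc112 ^ 2 * d Osc112 / (4 * (2 * pi * k112)^2)))"
    by (simp add: integral_prim1_sq_wave2_Osc112 power_add[symmetric] power2_eq_square del: wave2.simps prim1.simps)
  ultimately show ?thesis
    by (simp add: V1_def v2_def power2_eq_square sum_times_sum_modes card_mode del: wave2.simps prim1.simps)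
qed

lemma fourth_order_average:
  "\<bar>integral {0..1} (\<lambda>s. V1 s ^ 3 * v2 s) + \<eta> ^ 12 * (c Osc1112 ^ 3 * d Osc1112 / (8 * (2 * pi * k1112)^3))\<bar>
     \<le> 256 * (\<eta> ^ 13 * R ^ 4)"
proof -
  let ?a = "\<lambda>i. \<eta> ^ weight i * c i" and ?b = "\<lambda>i. \<eta> ^ weight i * d i"
  let ?\<phi> = "\<lambda>p s. prim1 (fst (fst (fst p))) s * prim1 (snd (fst (fst p))) s * prim1 (snd (fst p)) s * wave2 (snd p) s"
  let ?c = "\<lambda>p. ?a (fst (fst (fst p))) * ?a (snd (fst (fst p))) * ?a (snd (fst p)) * ?b (snd p)"
  let ?s = "(((Osc1112, Osc1112), Osc1112), Osc1112)"
  have "\<bar>integral {0..1} (\<lambda>s. \<Sum>p\<in>UNIV. ?c p * ?\<phi> p s) - (\<Sum>p\<in>{?s}. ?c p * integral {0..1} (?\<phi> p))\<bar>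
    \<le> real (card (UNIV :: (((mode \<times> mode) \<times> mode) \<times> mode) set)) * (\<eta> ^ 13 * R ^ 4)"
  proof (rule integral_sum_near_special_terms)
    fix p assume p: "p \<in> UNIV - {?s}"
    let ?w = "weight (fst (fst (fst p))) + weight (snd (fst (fst p))) + weight (snd (fst p)) + weight (snd p)"
    obtain i j k l where "p = (((i, j), k), l)" by (metis prod.collapse)
    then have "13 \<le> ?w"
      using p by (cases i; cases j; cases k; cases l) auto
    moreover have "\<bar>?c p\<bar> \<le> \<eta> ^ ?w * R ^ (1 + 1 + 1 + 1)"
      by (intro amplitude_product_le amplitude_le)
    ultimately show "\<bar>?c p\<bar> \<le> \<eta> ^ 13 * R ^ 4 \<or> integral {0..1} (?\<phi> p) = 0"
      using amplitude_product_le_order[of _ ?w "R^4" 13] R by (simp add: eval_nat_numeral)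
  qed (use \<eta> R in \<open>auto intro!: continuous_intros abs_prod_le_1 abs_wave_le_1\<close>)
  moreover have "(\<Sum>p\<in>{?s}. ?c p * integral {0..1} (?\<phi> p)) = - (\<eta> ^ 12 * (c Osc1112 ^ 3 * d Osc1112 / (8 * (2 * pi * k1112)^3)))"
    by (simp add: integral_prim1_cubed_wave2 power_add[symmetric] power3_eq_cube del: wave2.simps prim1.simps)
       (simp add: power_numeral_reduce)
  ultimately show ?thesis
    by (simp add: V1_def v2_def power3_eq_cube sum_times_sum_modes card_mode del: wave2.simps prim1.simps)
qed

text \<open>Products of weight exactly \<open>12\<close> are only bounded here, because a resonance can make them nonzero.\<close>

lemma third_order_average_swapped:
  "\<bar>integral {0..1} (\<lambda>s. V2c s ^ 2 * v1 s)\<bar> \<le> 64 * (\<eta> ^ 12 * R ^ 3)"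
proof -
  let ?a = "\<lambda>i. \<eta> ^ weight i * c i" and ?b = "\<lambda>i. \<eta> ^ weight i * d i"
  let ?\<phi> = "\<lambda>p s. prim2 (fst (fst p)) s * prim2 (snd (fst p)) s * wave1 (snd p) s"
  let ?c = "\<lambda>p. ?b (fst (fst p)) * ?b (snd (fst p)) * ?a (snd p)"
  have "\<bar>integral {0..1} (\<lambda>s. \<Sum>p\<in>UNIV. ?c p * ?\<phi> p s) - (\<Sum>p\<in>{}. ?c p * integral {0..1} (?\<phi> p))\<bar>
    \<le> real (card (UNIV :: ((mode \<times> mode) \<times> mode) set)) * (\<eta> ^ 12 * R ^ 3)"
  proof (rule integral_sum_near_special_terms)
    fix p
    let ?w = "weight (fst (fst p)) + weight (snd (fst p)) + weight (snd p)"
    show "\<bar>?c p\<bar> \<le> \<eta> ^ 12 * R ^ 3 \<or> integral {0..1} (?\<phi> p) = 0"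
    proof (cases "?w < 12")
      case True
      then show ?thesis using integral_prim2_sq_wave1[of "fst (fst p)" "snd (fst p)" "snd p"] by auto
    next
      case False
      have "\<bar>?c p\<bar> \<le> \<eta> ^ ?w * R ^ (1 + 1 + 1)"
        by (intro amplitude_product_le amplitude_le)
      from amplitude_product_le_order[OF this, of 12] False R show ?thesis by (simp add: numeral_3_eq_3)
    qed
  qed (use \<eta> R in \<open>auto intro!: continuous_intros abs_prod_le_1 abs_wave_le_1\<close>)
  then show ?thesis
    by (simp add: V2c_def v1_def power2_eq_square sum_times_sum_modes card_mode del: wave1.simps prim2.simps)
qed

lemma fourth_order_average_swapped:
  "\<bar>integral {0..1} (\<lambda>s. V2c s ^ 3 * v1 s)\<bar> \<le> 256 * (\<eta> ^ 13 * R ^ 4)"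
proof -
  let ?a = "\<lambda>i. \<eta> ^ weight i * c i" and ?b = "\<lambda>i. \<eta> ^ weight i * d i"
  let ?\<phi> = "\<lambda>p s. prim2 (fst (fst (fst p))) s * prim2 (snd (fst (fst p))) s * prim2 (snd (fst p)) s * wave1 (snd p) s"
  let ?c = "\<lambda>p. ?b (fst (fst (fst p))) * ?b (snd (fst (fst p))) * ?b (snd (fst p)) * ?a (snd p)"
  let ?s = "(((Osc1112, Osc1112), Osc1112), Osc1112)"
  have "\<bar>integral {0..1} (\<lambda>s. \<Sum>p\<in>UNIV. ?c p * ?\<phi> p s) - (\<Sum>p\<in>{?s}. ?c p * integral {0..1} (?\<phi> p))\<bar>
    \<le> real (card (UNIV :: (((mode \<times> mode) \<times> mode) \<times> mode) set)) * (\<eta> ^ 13 * R ^ 4)"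
  proof (rule integral_sum_near_special_terms)
    fix p assume p: "p \<in> UNIV - {?s}"
    let ?w = "weight (fst (fst (fst p))) + weight (snd (fst (fst p))) + weight (snd (fst p)) + weight (snd p)"
    obtain i j k l where "p = (((i, j), k), l)" by (metis prod.collapse)
    then have "13 \<le> ?w"
      using p by (cases i; cases j; cases k; cases l) auto
    moreover have "\<bar>?c p\<bar> \<le> \<eta> ^ ?w * R ^ (1 + 1 + 1 + 1)"
      by (intro amplitude_product_le amplitude_le)
    ultimately show "\<bar>?c p\<bar> \<le> \<eta> ^ 13 * R ^ 4 \<or> integral {0..1} (?\<phi> p) = 0"
      using amplitude_product_le_order[of _ ?w "R^4" 13] R by (simp add: eval_nat_numeral)
  qed (use \<eta> R in \<open>auto intro!: continuous_intros abs_prod_le_1 abs_wave_le_1\<close>)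
  then show ?thesis
    by (simp add: V2c_def v1_def power3_eq_cube sum_times_sum_modes card_mode integral_prim2_cubed_wave1 del: wave1.simps prim2.simps)
qed

end

section \<open>Explicit integration of the control system\<close>

lemma exhaust_5:
  fixes i :: 5
  shows "i = 1 \<or> i = 2 \<or> i = 3 \<or> i = 4 \<or> i = 5"
proof (induct i)
  case (of_int z)
  then have "z = 0 \<or> z = 1 \<or> z = 2 \<or> z = 3 \<or> z = 4" by fastforce
  then show ?case by auto
qed

lemma forall_5: "(\<forall>i::5. P i) \<longleftrightarrow> P 1 \<and> P 2 \<and> P 3 \<and> P 4 \<and> P 5"
  by (metis exhaust_5)

lemma UNIV_5: "UNIV = {1, 2, 3, 4, 5::5}"
  using exhaust_5 by auto

lemma sum_5: "sum f (UNIV::5 set) = f 1 + f 2 + f 3 + f 4 + f 5"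
  unfolding UNIV_5 by (simp add: ac_simps)

lemma has_vector_derivative_cart:
  "(f has_vector_derivative f') (at t within S) \<longleftrightarrow>
     (\<forall>i. ((\<lambda>t. f t $ i) has_real_derivative f' $ i) (at t within S))"
  for f :: "real \<Rightarrow> real ^ 'n"
  unfolding has_vector_derivative_def has_derivative_componentwise_within[of f]
    has_real_derivative_iff_has_vector_derivative
  by (simp add: Basis_vec_def inner_axis)

lemma field_g1_nth:
  "field_g1 \<kappa> z $ 1 = 1" "field_g1 \<kappa> z $ 2 = 0" "field_g1 \<kappa> z $ 3 = - z $ 2"
  "field_g1 \<kappa> z $ 4 = - z $ 3" "field_g1 \<kappa> z $ 5 = \<kappa> * (z $ 2) ^ 3 - z $ 4"
  by (simp_all only: field_g1_def vector_5)

lemma field_g2_nth: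
  "field_g2 \<alpha> \<theta> z $ 1 = 0" "field_g2 \<alpha> \<theta> z $ 2 = 1" "field_g2 \<alpha> \<theta> z $ 3 = 0"
  "field_g2 \<alpha> \<theta> z $ 4 = - \<alpha> * (z $ 2)\<^sup>2" "field_g2 \<alpha> \<theta> z $ 5 = - \<theta> * z $ 2 * z $ 3"
  by (simp_all only: field_g2_def vector_5)

text \<open>Integration of the triangular system in closed form. Repeated integration by parts reduces all
  iterated integrals of the controls to the two primitives \<open>x\<close>, \<open>y\<close> of \<open>v1\<close>, \<open>v2\<close> and the moments
  \<open>n = \<integral> x v2\<close>, \<open>l = \<integral> x^2 v2\<close>, \<open>m = \<integral> x^3 v2\<close>, \<open>j = \<integral> y^2 v1\<close>, \<open>k = \<integral> y^3 v1\<close>. The abbreviations \<open>w\<close>,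
  \<open>g\<close>, \<open>h\<close> are the iterated integrals \<open>w = \<integral> y v1\<close>, \<open>g = \<integral> w v1\<close>, \<open>h = \<integral> g v1\<close>.\<close>

definition flow :: "real \<Rightarrow> real \<Rightarrow> real \<Rightarrow> real^5 \<Rightarrow> real \<Rightarrow> real \<Rightarrow> real \<Rightarrow> real \<Rightarrow> real \<Rightarrow> real \<Rightarrow> real \<Rightarrow> real^5" where
  "flow \<alpha> \<kappa> \<theta> z x y n l m j k =
    (let w = x * y - n;
         g = x * w - x^2 * y / 2 + l / 2;
         h = x * g - x^2 * w / 2 + x^3 * y / 6 - m / 6
     in vector
      [z$1 + x,
       z$2 + y,
       z$3 - z$2 * x - w,
       z$4 - z$3 * x + z$2 * x^2 / 2 + g - \<alpha> * ((z$2)^2 * y + z$2 * y^2 + y^3 / 3),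
       z$5 + \<kappa> * ((z$2)^3 * x + 3 * (z$2)^2 * w + 3 * z$2 * j + k)
           - (z$4 * x - z$3 * x^2 / 2 + z$2 * x^3 / 6 + h - \<alpha> * ((z$2)^2 * w + z$2 * j + k / 3))
           - \<theta> * (z$2 * z$3 * y - (z$2)^2 * n - z$2 * (w * y - j) + z$3 * y^2 / 2
                - z$2 * (x * y^2 - j) / 2 - (w * y^2 - k) / 2)])"

lemma flow_nth:
  "flow \<alpha> \<kappa> \<theta> z x y n l m j k $ 1 = z$1 + x"
  "flow \<alpha> \<kappa> \<theta> z x y n l m j k $ 2 = z$2 + y"
  "flow \<alpha> \<kappa> \<theta> z x y n l m j k $ 3 = z$3 - z$2 * x - (x * y - n)"
  "flow \<alpha> \<kappa> \<theta> z x y n l m j k $ 4 =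
     z$4 - z$3 * x + z$2 * x^2 / 2 + (x * (x * y - n) - x^2 * y / 2 + l / 2)
       - \<alpha> * ((z$2)^2 * y + z$2 * y^2 + y^3 / 3)"
  "flow \<alpha> \<kappa> \<theta> z x y n l m j k $ 5 =
     z$5 + \<kappa> * ((z$2)^3 * x + 3 * (z$2)^2 * (x * y - n) + 3 * z$2 * j + k)
       - (z$4 * x - z$3 * x^2 / 2 + z$2 * x^3 / 6
           + (x * (x * (x * y - n) - x^2 * y / 2 + l / 2) - x^2 * (x * y - n) / 2 + x^3 * y / 6 - m / 6)
           - \<alpha> * ((z$2)^2 * (x * y - n) + z$2 * j + k / 3))
       - \<theta> * (z$2 * z$3 * y - (z$2)^2 * n - z$2 * ((x * y - n) * y - j) + z$3 * y^2 / 2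
           - z$2 * (x * y^2 - j) / 2 - ((x * y - n) * y^2 - k) / 2)"
  by (simp_all only: flow_def Let_def vector_5)

lemma flow_zero: "flow \<alpha> \<kappa> \<theta> z 0 0 0 0 0 0 0 = z"
  by (simp add: vec_eq_iff forall_5 flow_nth)

lemma flow_solves:
  fixes x y n l m j k :: "real \<Rightarrow> real" and \<alpha> \<kappa> \<theta> :: real and z :: "real^5"
  assumes "(x has_real_derivative v1) (at s within S)"
    and "(y has_real_derivative v2) (at s within S)"
    and "(n has_real_derivative x s * v2) (at s within S)"
    and "(l has_real_derivative x s ^ 2 * v2) (at s within S)"
    and "(m has_real_derivative x s ^ 3 * v2) (at s within S)"
    and "(j has_real_derivative y s ^ 2 * v1) (at s within S)"
    and "(k has_real_derivative y s ^ 3 * v1) (at s within S)"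
  defines "f \<equiv> \<lambda>s. flow \<alpha> \<kappa> \<theta> z (x s) (y s) (n s) (l s) (m s) (j s) (k s)"
  shows "(f has_vector_derivative (v1 *\<^sub>R field_g1 \<kappa> (f s) + v2 *\<^sub>R field_g2 \<alpha> \<theta> (f s))) (at s within S)"
proof -
  have "((\<lambda>s. f s $ 1) has_real_derivative v1) (at s within S)"
    "((\<lambda>s. f s $ 2) has_real_derivative v2) (at s within S)"
    unfolding f_def flow_nth by (auto intro!: derivative_eq_intros assms(1,2))
  moreover have "((\<lambda>s. f s $ 3) has_real_derivative v1 * - f s $ 2) (at s within S)"
    unfolding f_def flow_nth
    by (rule assms(1-7) | rule derivative_eq_intros | rule refl)+ (simp add: algebra_simps)
  moreover have "((\<lambda>s. f s $ 4) has_real_derivative v1 * - f s $ 3 + v2 * (- \<alpha> * (f s $ 2)^2)) (at s within S)"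
    unfolding f_def flow_nth
    by (rule assms(1-7) | rule derivative_eq_intros | rule refl | (simp; fail))+ (simp add: field_simps power2_eq_square power3_eq_cube)
  moreover have "((\<lambda>s. f s $ 5) has_real_derivative v1 * (\<kappa> * (f s $ 2) ^ 3 - f s $ 4) + v2 * (- \<theta> * f s $ 2 * f s $ 3)) (at s within S)"
    unfolding f_def flow_nth
    by (rule assms(1-7) | rule derivative_eq_intros | rule refl | (simp; fail))+ (simp add: field_simps power2_eq_square power3_eq_cube)
  ultimately show ?thesis
    unfolding has_vector_derivative_cart forall_5
    by (simp add: field_g1_nth field_g2_nth)
qed

text \<open>The right-hand side of each coordinate depends only on the earlier coordinates, so the
  coordinates of two solutions agree one after the other.\<close>

lemma control_solution_unique:
  fixes y z :: "real \<Rightarrow> real^5"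
  assumes "a < b" and y: "continuous_on {a..b} y" and z: "continuous_on {a..b} z"
    and y': "\<And>t. a < t \<Longrightarrow> t < b \<Longrightarrow>
       (y has_vector_derivative (u1 t *\<^sub>R field_g1 \<kappa> (y t) + u2 t *\<^sub>R field_g2 \<alpha> \<theta> (y t))) (at t)"
    and z': "\<And>t. a < t \<Longrightarrow> t < b \<Longrightarrow>
       (z has_vector_derivative (u1 t *\<^sub>R field_g1 \<kappa> (z t) + u2 t *\<^sub>R field_g2 \<alpha> \<theta> (z t))) (at t)"
    and "y a = z a" and "t \<in> {a..b}"
  shows "y t = z t"
proof -
  have step: "\<forall>t\<in>{a..b}. y t $ i = z t $ i"
    if "\<And>t. a < t \<Longrightarrow> t < b \<Longrightarrow>
      (u1 t *\<^sub>R field_g1 \<kappa> (y t) + u2 t *\<^sub>R field_g2 \<alpha> \<theta> (y t)) $ i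
      = (u1 t *\<^sub>R field_g1 \<kappa> (z t) + u2 t *\<^sub>R field_g2 \<alpha> \<theta> (z t)) $ i" for i
  proof
    fix t assume t: "t \<in> {a..b}"
    have "y t $ i - z t $ i = y a $ i - z a $ i"
    proof (rule DERIV_isconst2[OF \<open>a < b\<close>])
      show "continuous_on {a..b} (\<lambda>t. y t $ i - z t $ i)"
        by (intro continuous_intros y z)
      fix t assume t: "a < t" "t < b"
      show "((\<lambda>t. y t $ i - z t $ i) has_real_derivative 0) (at t)"
        using DERIV_diff[OF y'[OF t, unfolded has_vector_derivative_cart, rule_format, of i]
            z'[OF t, unfolded has_vector_derivative_cart, rule_format, of i]]
          that[OF t] by simp
    qed (use t in auto)
    then show "y t $ i = z t $ i" using \<open>y a = z a\<close> by simp
  qed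
  have 1: "\<forall>t\<in>{a..b}. y t $ 1 = z t $ 1"
    by (rule step) (simp add: field_g1_nth field_g2_nth)
  have 2: "\<forall>t\<in>{a..b}. y t $ 2 = z t $ 2"
    by (rule step) (simp add: field_g1_nth field_g2_nth)
  have 3: "\<forall>t\<in>{a..b}. y t $ 3 = z t $ 3"
    by (rule step) (simp add: field_g1_nth field_g2_nth 2)
  have 4: "\<forall>t\<in>{a..b}. y t $ 4 = z t $ 4"
    by (rule step) (simp add: field_g1_nth field_g2_nth 2 3)
  have 5: "\<forall>t\<in>{a..b}. y t $ 5 = z t $ 5"
    by (rule step) (simp add: field_g1_nth field_g2_nth 2 3 4)
  show ?thesis using \<open>t \<in> {a..b}\<close> 1 2 3 4 5 by (simp add: vec_eq_iff forall_5)
qed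

lemma abs_change_le:
  fixes f :: "real \<Rightarrow> real"
  assumes "\<And>s. s \<in> {0..1} \<Longrightarrow> (f has_real_derivative f' s) (at s within {0..1})"
    and "\<And>s. s \<in> {0..1} \<Longrightarrow> \<bar>f' s\<bar> \<le> B" and "0 \<le> B" "s \<in> {0..1}"
  shows "\<bar>f s\<bar> \<le> \<bar>f 0\<bar> + B"
proof -
  have "norm (f s - f 0) \<le> B * norm (s - 0)"
    by (rule field_differentiable_bound[where S = "{0..1}"]) (use assms in auto)
  also have "\<dots> \<le> B" using assms(3,4) by (simp add: mult_left_le)
  finally show ?thesis by simp
qed

text \<open>Growth inside one sampling interval, again one coordinate after the other. The powers of \<open>T\<close>
  are the weights of the coordinates.\<close>

lemma control_solution_bound:
  fixes f :: "real \<Rightarrow> real^5"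
  assumes f': "\<And>s. s \<in> {0..1} \<Longrightarrow>
       (f has_vector_derivative (v1 s *\<^sub>R field_g1 \<kappa> (f s) + v2 s *\<^sub>R field_g2 \<alpha> \<theta> (f s))) (at s within {0..1})"
    and v: "\<And>s. s \<in> {0..1} \<Longrightarrow> \<bar>v1 s\<bar> \<le> T" "\<And>s. s \<in> {0..1} \<Longrightarrow> \<bar>v2 s\<bar> \<le> T"
    and init: "\<bar>f 0 $ 1\<bar> \<le> T" "\<bar>f 0 $ 2\<bar> \<le> T" "\<bar>f 0 $ 3\<bar> \<le> T^2" "\<bar>f 0 $ 4\<bar> \<le> T^3" "\<bar>f 0 $ 5\<bar> \<le> T^4"
    and s: "s \<in> {0..1}"
  shows "norm (f s) \<le> 4 * T + 3 * T^2 + (4 + 4 * \<bar>\<alpha>\<bar>) * T^3 + (5 + 8 * \<bar>\<kappa>\<bar> + 4 * \<bar>\<alpha>\<bar> + 6 * \<bar>\<theta>\<bar>) * T^4"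
proof -
  have T: "0 \<le> T" using init(1) by linarith
  note d = f'[unfolded has_vector_derivative_cart, rule_format]
  have 1: "\<bar>f s $ 1\<bar> \<le> T + T" if s: "s \<in> {0..1}" for s
    using abs_change_le[OF d[of _ 1], of T s] v T s init by (simp add: field_g1_nth field_g2_nth)
  have 2: "\<bar>f s $ 2\<bar> \<le> 2 * T" if s: "s \<in> {0..1}" for s
    using abs_change_le[OF d[of _ 2], of T s] v T s init by (simp add: field_g1_nth field_g2_nth)
  have 3: "\<bar>f s $ 3\<bar> \<le> 3 * T^2" if s: "s \<in> {0..1}" for s
  proof -
    have "\<bar>v1 s * - f s $ 2\<bar> \<le> 2 * T^2" if "s \<in> {0..1}" for s
      using mult_mono[OF v(1)[OF that] 2[OF that] T] by (simp add: abs_mult power2_eq_square)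
    then show ?thesis
      using abs_change_le[OF d[of _ 3], of "2 * T^2" s] s init T by (simp add: field_g1_nth field_g2_nth)
  qed
  have 4: "\<bar>f s $ 4\<bar> \<le> (4 + 4 * \<bar>\<alpha>\<bar>) * T^3" if s: "s \<in> {0..1}" for s
  proof -
    have b: "\<bar>v1 s * - f s $ 3 + v2 s * (- \<alpha> * (f s $ 2)^2)\<bar> \<le> (3 + 4 * \<bar>\<alpha>\<bar>) * T^3" if "s \<in> {0..1}" for s
    proof -
      have "\<bar>v1 s * - f s $ 3\<bar> \<le> 3 * T^3"
        using mult_mono[OF v(1)[OF that] 3[OF that] T] by (simp add: abs_mult eval_nat_numeral)
      moreover have "\<bar>v2 s\<bar> * (\<bar>\<alpha>\<bar> * \<bar>f s $ 2\<bar>^2) \<le> T * (\<bar>\<alpha>\<bar> * (2 * T)^2)"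
        by (intro mult_mono power_mono v 2 that) (auto simp: T)
      ultimately show ?thesis
        by (intro order_trans[OF abs_triangle_ineq]) (simp add: abs_mult algebra_simps eval_nat_numeral)
    qed
    then show ?thesis
      using abs_change_le[OF d[of _ 4], of "(3 + 4 * \<bar>\<alpha>\<bar>) * T^3" s] s init T
      by (simp add: field_g1_nth field_g2_nth algebra_simps)
  qed
  have 5: "\<bar>f s $ 5\<bar> \<le> (5 + 8 * \<bar>\<kappa>\<bar> + 4 * \<bar>\<alpha>\<bar> + 6 * \<bar>\<theta>\<bar>) * T^4" if s: "s \<in> {0..1}" for s
  proof -
    have b: "\<bar>v1 s * (\<kappa> * (f s $ 2) ^ 3 - f s $ 4) + v2 s * (- \<theta> * f s $ 2 * f s $ 3)\<bar>
        \<le> (4 + 8 * \<bar>\<kappa>\<bar> + 4 * \<bar>\<alpha>\<bar> + 6 * \<bar>\<theta>\<bar>) * T^4" if "s \<in> {0..1}" for s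
    proof -
      have "\<bar>v1 s\<bar> * (\<bar>\<kappa>\<bar> * \<bar>f s $ 2\<bar> ^ 3) \<le> T * (\<bar>\<kappa>\<bar> * (2 * T) ^ 3)"
        by (intro mult_mono power_mono v 2 that) (auto simp: T)
      moreover have "\<bar>v1 s\<bar> * \<bar>f s $ 4\<bar> \<le> T * ((4 + 4 * \<bar>\<alpha>\<bar>) * T^3)"
        by (intro mult_mono v 4 that) (auto simp: T)
      moreover have "\<bar>v2 s\<bar> * (\<bar>\<theta>\<bar> * \<bar>f s $ 2\<bar> * \<bar>f s $ 3\<bar>) \<le> T * (\<bar>\<theta>\<bar> * (2 * T) * (3 * T^2))"
        by (intro mult_mono v 2 3 that) (auto simp: T)
      moreover have "\<bar>v1 s * (\<kappa> * (f s $ 2) ^ 3 - f s $ 4) + v2 s * (- \<theta> * f s $ 2 * f s $ 3)\<bar>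
        \<le> \<bar>v1 s\<bar> * (\<bar>\<kappa>\<bar> * \<bar>f s $ 2\<bar> ^ 3) + \<bar>v1 s\<bar> * \<bar>f s $ 4\<bar> + \<bar>v2 s\<bar> * (\<bar>\<theta>\<bar> * \<bar>f s $ 2\<bar> * \<bar>f s $ 3\<bar>)"
      proof -
        have "v1 s * (\<kappa> * (f s $ 2) ^ 3 - f s $ 4) + v2 s * (- \<theta> * f s $ 2 * f s $ 3)
          = v1 s * (\<kappa> * (f s $ 2) ^ 3) - v1 s * f s $ 4 - v2 s * (\<theta> * f s $ 2 * f s $ 3)"
          by (simp add: algebra_simps)
        then have "\<bar>v1 s * (\<kappa> * (f s $ 2) ^ 3 - f s $ 4) + v2 s * (- \<theta> * f s $ 2 * f s $ 3)\<bar>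
          \<le> \<bar>v1 s * (\<kappa> * (f s $ 2) ^ 3)\<bar> + \<bar>v1 s * f s $ 4\<bar> + \<bar>v2 s * (\<theta> * f s $ 2 * f s $ 3)\<bar>"
          by linarith
        then show ?thesis by (simp only: abs_mult power_abs)
      qed
      ultimately show ?thesis by (simp add: algebra_simps eval_nat_numeral)
    qed
    then show ?thesis
      using abs_change_le[OF d[of _ 5], of "(4 + 8 * \<bar>\<kappa>\<bar> + 4 * \<bar>\<alpha>\<bar> + 6 * \<bar>\<theta>\<bar>) * T^4" s] s init T
      by (simp add: field_g1_nth field_g2_nth algebra_simps)
  qed
  show ?thesis
    using norm_le_l1_cart[of "f s"] 1[OF s] 2[OF s] 3[OF s] 4[OF s] 5[OF s]
    by (simp add: sum_5)
qed

section \<open>The state after one sampling period\<close>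

lemma abs_mult_le: "\<bar>x\<bar> \<le> a \<Longrightarrow> \<bar>y\<bar> \<le> b \<Longrightarrow> \<bar>x * y\<bar> \<le> a * (b::real)"
  by (simp add: abs_mult mult_mono')

lemma abs_add_le: "\<bar>x\<bar> \<le> a \<Longrightarrow> \<bar>y\<bar> \<le> b \<Longrightarrow> \<bar>x + y\<bar> \<le> a + (b::real)"
  by linarith

context modulated_oscillation
begin

definition area where "area s = integral {0..s} (\<lambda>s. V1 s * v2 s)"
definition moment112 where "moment112 s = integral {0..s} (\<lambda>s. V1 s ^ 2 * v2 s)"
definition moment1112 where "moment1112 s = integral {0..s} (\<lambda>s. V1 s ^ 3 * v2 s)"
definition moment221 where "moment221 s = integral {0..s} (\<lambda>s. V2 s ^ 2 * v1 s)"
definition moment2221 where "moment2221 s = integral {0..s} (\<lambda>s. V2 s ^ 3 * v1 s)"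

lemma moment_derivs:
  assumes "s \<in> {0..1}"
  shows "(area has_real_derivative V1 s * v2 s) (at s within {0..1})"
    and "(moment112 has_real_derivative V1 s ^ 2 * v2 s) (at s within {0..1})"
    and "(moment1112 has_real_derivative V1 s ^ 3 * v2 s) (at s within {0..1})"
    and "(moment221 has_real_derivative V2 s ^ 2 * v1 s) (at s within {0..1})"
    and "(moment2221 has_real_derivative V2 s ^ 3 * v1 s) (at s within {0..1})"
  unfolding area_def[abs_def] moment112_def[abs_def] moment1112_def[abs_def]
    moment221_def[abs_def] moment2221_def[abs_def]
  using assms by (auto intro!: integral_has_real_derivative continuous_intros)

lemma moments_at_0: "area 0 = 0" "moment112 0 = 0" "moment1112 0 = 0" "moment221 0 = 0" "moment2221 0 = 0"
  by (simp_all add: area_def moment112_def moment1112_def moment221_def moment2221_def)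

lemma eta_powers: "0 \<le> \<eta> ^ n" "n \<le> m \<Longrightarrow> \<eta> ^ m \<le> \<eta> ^ n"
  using \<eta> by (auto intro: power_decreasing)

lemma scaled_power_le: "n \<le> m \<Longrightarrow> \<eta> ^ m * R ^ k \<le> \<eta> ^ n * R ^ k"
  using eta_powers R by (simp add: mult_right_mono)

lemma endpoint_le: "\<bar>V1 1\<bar> \<le> \<eta> ^ 12 * R" "\<bar>V2 1\<bar> \<le> \<eta> ^ 12 * R"
  using c_le d_le eta_powers(1)[of 12] by (simp_all add: V_at_ends abs_mult mult_left_mono)

lemma Osc12_product_le: "\<bar>c Osc12 * d Osc12 / (4 * pi * k12)\<bar> \<le> R ^ 2"
proof -
  have "1 * 1 \<le> (4 * pi) * real k12"
    using freq_pos pi_gt3 by (intro mult_mono) auto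
  then have "\<bar>c Osc12 * d Osc12\<bar> / (4 * pi * k12) \<le> \<bar>c Osc12 * d Osc12\<bar>"
    by (simp add: divide_le_eq mult_right_mono mult_le_cancel_left1)
  also have "\<dots> \<le> R * R" by (intro abs_mult_le c_le d_le)
  finally show ?thesis by (simp add: abs_mult power2_eq_square)
qed

lemma area_le: "\<bar>area 1\<bar> \<le> 17 * (\<eta> ^ 12 * R ^ 2)"
proof -
  have "\<bar>\<eta> ^ 12 * (c Osc12 * d Osc12 / (4 * pi * k12))\<bar> \<le> \<eta> ^ 12 * R ^ 2"
    using Osc12_product_le eta_powers(1)[of 12] by (intro abs_mult_le) auto
  then show ?thesis
    using area_average scaled_power_le[of 12 13 2] unfolding area_def by linarith
qed

lemma swapped_area: "integral {0..1} (\<lambda>s. V2 s * v1 s) = V1 1 * V2 1 - area 1"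
proof -
  have "((\<lambda>s. V2 s * v1 s) has_integral
     (V1 1 * V2 1 - area 1) - (V1 0 * V2 0 - area 0)) {0..1}"
  proof (rule fundamental_theorem_of_calculus)
    fix s :: real assume "s \<in> {0..1}"
    then show "((\<lambda>s. V1 s * V2 s - area s) has_vector_derivative V2 s * v1 s) (at s within {0..1})"
      unfolding has_real_derivative_iff_has_vector_derivative[symmetric]
      by (auto intro!: derivative_eq_intros V1_deriv V2_deriv moment_derivs)
  qed simp
  then show ?thesis by (simp add: integral_unique V_at_ends moments_at_0)
qed

lemma swapped_area_le: "\<bar>V1 1 * V2 1 - area 1\<bar> \<le> 18 * (\<eta> ^ 12 * R ^ 2)"
proof -
  have "\<bar>V1 1 * V2 1\<bar> \<le> (\<eta> ^ 12 * R) * (\<eta> ^ 12 * R)"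
    by (intro abs_mult_le endpoint_le)
  also have "\<dots> = \<eta> ^ 24 * R ^ 2" by (simp add: power2_eq_square flip: power_add)
  finally show ?thesis using area_le scaled_power_le[of 12 24 2] by linarith
qed

text \<open>The moments of \<open>V2\<close> follow from those of the centred primitive \<open>V2c = V2 - a\<close> by the binomial theorem.
  Since \<open>a\<close> is of order \<open>\<eta> ^ 3\<close> and the moments of \<open>V2c\<close> of degree at most \<open>2\<close> are \<open>O(\<eta> ^ 12)\<close>, the
  corrections are negligible.\<close>

lemma swapped_moments_le:
  "\<bar>moment221 1\<bar> \<le> 256 * (\<eta> ^ 12 * R ^ 3)" "\<bar>moment2221 1\<bar> \<le> 2144 * (\<eta> ^ 13 * R ^ 4)"
proof -
  define a where "a = - V2c 0"
  define J where "J = integral {0..1} (\<lambda>s. V2c s ^ 2 * v1 s)"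
  define K where "K = integral {0..1} (\<lambda>s. V2c s ^ 3 * v1 s)"
  define W where "W = integral {0..1} (\<lambda>s. V2c s * v1 s)"
  have V2_eq: "V2 s = V2c s + a" for s by (simp add: V2_def a_def)
  have int: "(\<lambda>s. V2c s ^ n * v1 s) integrable_on {0..1}" for n
    by (intro integrable_continuous_interval continuous_intros)
  have v: "(v1 has_integral V1 1) {0..1}"
    using fundamental_theorem_of_calculus[of 0 1 V1 v1] V1_deriv
    by (simp add: has_real_derivative_iff_has_vector_derivative V_at_ends(1))
  have W: "((\<lambda>s. V2c s * v1 s) has_integral W) {0..1}"
    and J: "((\<lambda>s. V2c s ^ 2 * v1 s) has_integral J) {0..1}"
    and K: "((\<lambda>s. V2c s ^ 3 * v1 s) has_integral K) {0..1}"
    using int[of 1] int[of 2] int[of 3] by (simp_all add: W_def J_def K_def integrable_integral)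
  have "((\<lambda>s. V2c s * v1 s + a * v1 s) has_integral (W + a * V1 1)) {0..1}"
    by (intro has_integral_add has_integral_mult_right v W)
  moreover have "(\<lambda>s. V2c s * v1 s + a * v1 s) = (\<lambda>s. V2 s * v1 s)"
    by (simp add: V2_eq algebra_simps)
  ultimately have "((\<lambda>s. V2 s * v1 s) has_integral (W + a * V1 1)) {0..1}"
    by simp
  from integral_unique[OF this] have W_eq: "W = (V1 1 * V2 1 - area 1) - a * V1 1"
    unfolding swapped_area by simp
  have a: "\<bar>a\<bar> \<le> 4 * (\<eta> * R)"
    using abs_V_le(3)[of 0] scaled_power_le[of 1 3 1] by (simp add: a_def)
  have aV: "\<bar>a * V1 1\<bar> \<le> 4 * (\<eta> ^ 13 * R ^ 2)"
    using abs_mult_le[OF a endpoint_le(1)] by (simp add: power2_eq_square eval_nat_numeral mult_ac)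
  have W_le: "\<bar>W\<bar> \<le> 22 * (\<eta> ^ 12 * R ^ 2)"
    using W_eq swapped_area_le aV scaled_power_le[of 12 13 2] by linarith
  have J_le: "\<bar>J\<bar> \<le> 64 * (\<eta> ^ 12 * R ^ 3)"
    unfolding J_def by (rule third_order_average_swapped)
  have K_le: "\<bar>K\<bar> \<le> 256 * (\<eta> ^ 13 * R ^ 4)"
    unfolding K_def by (rule fourth_order_average_swapped)
  have aW: "\<bar>a * W\<bar> \<le> 88 * (\<eta> ^ 13 * R ^ 3)"
    using abs_mult_le[OF a W_le] by (simp add: eval_nat_numeral mult_ac)
  have aaV: "\<bar>a * (a * V1 1)\<bar> \<le> 16 * (\<eta> ^ 13 * R ^ 3)"
    using abs_mult_le[OF a aV] scaled_power_le[of 13 14 3] by (simp add: eval_nat_numeral mult_ac)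
  have aJ: "\<bar>a * J\<bar> \<le> 256 * (\<eta> ^ 13 * R ^ 4)"
    using abs_mult_le[OF a J_le] by (simp add: eval_nat_numeral mult_ac)
  have aaW: "\<bar>a * (a * W)\<bar> \<le> 352 * (\<eta> ^ 13 * R ^ 4)"
    using abs_mult_le[OF a aW] scaled_power_le[of 13 14 4] by (simp add: eval_nat_numeral mult_ac)
  have aaaV: "\<bar>a * (a * (a * V1 1))\<bar> \<le> 64 * (\<eta> ^ 13 * R ^ 4)"
    using abs_mult_le[OF a aaV] scaled_power_le[of 13 14 4] by (simp add: eval_nat_numeral mult_ac)
  have "((\<lambda>s. V2c s ^ 2 * v1 s + (2 * a) * (V2c s * v1 s) + a\<^sup>2 * v1 s) has_integral
      (J + (2 * a) * W + a\<^sup>2 * V1 1)) {0..1}"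
    by (intro has_integral_add has_integral_mult_right v W J)
  moreover have "(\<lambda>s. V2c s ^ 2 * v1 s + (2 * a) * (V2c s * v1 s) + a\<^sup>2 * v1 s) = (\<lambda>s. V2 s ^ 2 * v1 s)"
    by (simp add: V2_eq algebra_simps power2_eq_square)
  ultimately have "moment221 1 = J + 2 * (a * W) + a * (a * V1 1)"
    unfolding moment221_def by (simp add: integral_unique power2_eq_square mult_ac)
  then show "\<bar>moment221 1\<bar> \<le> 256 * (\<eta> ^ 12 * R ^ 3)"
    using J_le aW aaV scaled_power_le[of 12 13 3] by linarith
  have "((\<lambda>s. V2c s ^ 3 * v1 s + (3 * a) * (V2c s ^ 2 * v1 s) + (3 * a\<^sup>2) * (V2c s * v1 s) + a ^ 3 * v1 s) has_integral
      (K + (3 * a) * J + (3 * a\<^sup>2) * W + a ^ 3 * V1 1)) {0..1}"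
    by (intro has_integral_add has_integral_mult_right v W J K)
  moreover have "(\<lambda>s. V2c s ^ 3 * v1 s + (3 * a) * (V2c s ^ 2 * v1 s) + (3 * a\<^sup>2) * (V2c s * v1 s) + a ^ 3 * v1 s)
      = (\<lambda>s. V2 s ^ 3 * v1 s)"
    by (simp add: V2_eq algebra_simps power2_eq_square power3_eq_cube)
  ultimately have "moment2221 1 = K + 3 * (a * J) + 3 * (a * (a * W)) + a * (a * (a * V1 1))"
    unfolding moment2221_def by (simp add: integral_unique power2_eq_square power3_eq_cube mult_ac)
  then show "\<bar>moment2221 1\<bar> \<le> 2144 * (\<eta> ^ 13 * R ^ 4)"
    using K_le aJ aaW aaaV by linarith
qed

definition state :: "real \<Rightarrow> real \<Rightarrow> real \<Rightarrow> real^5 \<Rightarrow> real \<Rightarrow> real^5" where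
  "state \<alpha> \<kappa> \<theta> z s = flow \<alpha> \<kappa> \<theta> z (V1 s) (V2 s) (area s) (moment112 s) (moment1112 s) (moment221 s) (moment2221 s)"

lemma state_0: "state \<alpha> \<kappa> \<theta> z 0 = z"
  by (simp add: state_def moments_at_0 V_at_ends flow_zero)

lemma state_solves:
  assumes "s \<in> {0..1}"
  shows "(state \<alpha> \<kappa> \<theta> z has_vector_derivative
     (v1 s *\<^sub>R field_g1 \<kappa> (state \<alpha> \<kappa> \<theta> z s) + v2 s *\<^sub>R field_g2 \<alpha> \<theta> (state \<alpha> \<kappa> \<theta> z s))) (at s within {0..1})"
  unfolding state_def[abs_def]
  by (rule flow_solves V1_deriv V2_deriv moment_derivs assms)+

end

text \<open>The first-order part of the endpoint is \<open>z + \<epsilon> (a1 g1 + a2 g2 + a12 [g1,g2] + a112 [g1,[g1,g2]]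
  + a1112 [g1,[g1,[g1,g2]]])\<close> with all vector fields taken at \<open>z\<close>, and the coefficients of the
  feedback law solve the triangular linear system that makes this vector equal to \<open>(1 - \<gamma> \<epsilon>) z\<close>. The
  remaining terms are of order \<open>\<delta> = \<eta> ^ 13\<close>, except for the one with \<open>j\<close>: it carries the bracket
  \<open>[g2,[g1,g2]]\<close>, which is a multiple of \<open>z$2\<close> in the last coordinate.\<close>

lemma endpoint_expansion:
  fixes \<epsilon> \<delta> R \<alpha> \<kappa> \<theta> \<gamma> x y n l m j k :: real and z :: "real^5"
  assumes small: "0 \<le> \<delta>" "\<delta> \<le> \<epsilon>" "\<epsilon> * \<epsilon> \<le> \<delta>" "\<epsilon> \<le> 1" "0 \<le> R"
    and z: "\<bar>z$2\<bar> \<le> R" "\<bar>z$3\<bar> \<le> R^2"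
    and x: "x = \<epsilon> * coeff_1 \<gamma> z" "\<bar>x\<bar> \<le> \<epsilon> * R" and y: "y = \<epsilon> * coeff_2 \<gamma> z" "\<bar>y\<bar> \<le> \<epsilon> * R"
    and n: "\<bar>n - \<epsilon> * coeff_12 \<gamma> z\<bar> \<le> 16 * (\<delta> * R^2)"
    and w: "\<bar>x * y - n\<bar> \<le> 18 * (\<epsilon> * R^2)"
    and l: "\<bar>l - \<epsilon> * (2 * coeff_112 \<alpha> \<gamma> z)\<bar> \<le> 64 * (\<delta> * R^3)" "\<bar>coeff_112 \<alpha> \<gamma> z\<bar> \<le> R^3"
    and m: "\<bar>m - \<epsilon> * (6 * coeff_1112 \<alpha> \<kappa> \<theta> \<gamma> z)\<bar> \<le> 256 * (\<delta> * R^4)"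
    and k: "\<bar>k\<bar> \<le> 2144 * (\<delta> * R^4)"
  defines "f \<equiv> flow \<alpha> \<kappa> \<theta> z x y n l m j k"
  shows "f $ 1 = (1 - \<gamma> * \<epsilon>) * z$1" "f $ 2 = (1 - \<gamma> * \<epsilon>) * z$2"
    "\<bar>f $ 3 - (1 - \<gamma> * \<epsilon>) * z$3\<bar> \<le> 17 * (\<delta> * R^2)"
    "\<bar>f $ 4 - (1 - \<gamma> * \<epsilon>) * z$4\<bar> \<le> (51 + 2 * \<bar>\<alpha>\<bar>) * (\<delta> * R^3)"
    "\<bar>f $ 5 - (1 - \<gamma> * \<epsilon>) * z$5 - (3 * \<kappa> + \<alpha> - 3/2 * \<theta>) * z$2 * j\<bar>
       \<le> (17 * \<bar>3 * \<kappa> + \<alpha>\<bar> + 54 * \<bar>\<theta>\<bar> + 2144 * \<bar>\<kappa> + \<alpha>/3 - \<theta>/2\<bar> + 116) * (\<delta> * R^4)"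
proof -
  define en where "en = n - \<epsilon> * coeff_12 \<gamma> z"
  define el where "el = l - \<epsilon> * (2 * coeff_112 \<alpha> \<gamma> z)"
  define em where "em = m - \<epsilon> * (6 * coeff_1112 \<alpha> \<kappa> \<theta> \<gamma> z)"
  define W where "W = x * y - n"
  have n': "n = en + \<epsilon> * coeff_12 \<gamma> z" and l': "l = el + \<epsilon> * (2 * coeff_112 \<alpha> \<gamma> z)"
    and m': "m = em + \<epsilon> * (6 * coeff_1112 \<alpha> \<kappa> \<theta> \<gamma> z)"
    by (simp_all add: en_def el_def em_def)
  have \<epsilon>: "0 \<le> \<epsilon>" using small by linarith
  have order2: "A * (\<epsilon> * \<epsilon> * R^i) \<le> A * (\<delta> * R^i)" if "0 \<le> A" for A i
    using small that by (intro mult_left_mono mult_right_mono) auto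
  have xx: "\<bar>x * x\<bar> \<le> \<delta> * R^2" and xy: "\<bar>x * y\<bar> \<le> \<delta> * R^2" and yy: "\<bar>y * y\<bar> \<le> \<delta> * R^2"
    using abs_mult_le[OF x(2) x(2)] abs_mult_le[OF x(2) y(2)] abs_mult_le[OF y(2) y(2)] order2[of 1 2]
    by (simp_all add: power2_eq_square mult_ac)
  have drop: "\<delta> * R^i * \<epsilon> \<le> \<delta> * R^i" for i
    using small by (simp add: mult_left_le)
  have drop2: "\<delta> * R^2 * (\<epsilon> * R) \<le> \<delta> * R^3" and drop3: "(\<epsilon> * R) * (\<delta> * R^3) \<le> \<delta> * R^4"
    using drop[of 3] drop[of 4] by (simp_all only: power2_eq_square power3_eq_cube power4_eq_xxxx ac_simps)
  have W: "\<bar>W\<bar> \<le> 18 * (\<epsilon> * R^2)" using w by (simp add: W_def)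
  have xW: "\<bar>x * W\<bar> \<le> 18 * (\<delta> * R^3)" and yW: "\<bar>y * W\<bar> \<le> 18 * (\<delta> * R^3)"
    using abs_mult_le[OF x(2) W] abs_mult_le[OF y(2) W] order2[of 18 3]
    by (simp_all add: eval_nat_numeral mult_ac)
  show "f $ 1 = (1 - \<gamma> * \<epsilon>) * z$1" and "f $ 2 = (1 - \<gamma> * \<epsilon>) * z$2"
    by (simp_all add: f_def flow_nth x(1) y(1) coeff_1_def coeff_2_def algebra_simps)
  have "f $ 3 - (1 - \<gamma> * \<epsilon>) * z$3 = en - x * y"
    by (simp add: f_def flow_nth n' x(1) coeff_1_def coeff_12_def algebra_simps)
  then show "\<bar>f $ 3 - (1 - \<gamma> * \<epsilon>) * z$3\<bar> \<le> 17 * (\<delta> * R^2)"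
    using n xy unfolding en_def[symmetric] by linarith
  have xxy: "\<bar>x * x * y\<bar> \<le> \<delta> * R^3" and yyy: "\<bar>y * y * y\<bar> \<le> \<delta> * R^3"
    and xxx: "\<bar>x * x * x\<bar> \<le> \<delta> * R^3" and xyy: "\<bar>x * y * y\<bar> \<le> \<delta> * R^3"
    using order_trans[OF abs_mult_le[OF xx y(2)] drop2] order_trans[OF abs_mult_le[OF yy y(2)] drop2]
      order_trans[OF abs_mult_le[OF xx x(2)] drop2] order_trans[OF abs_mult_le[OF xy y(2)] drop2] .
  have zxx: "\<bar>z$2 * (x * x)\<bar> \<le> \<delta> * R^3" and zyy: "\<bar>z$2 * (y * y)\<bar> \<le> \<delta> * R^3"
    using abs_mult_le[OF z(1) xx] abs_mult_le[OF z(1) yy] by (simp_all add: eval_nat_numeral mult_ac)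
  have "f $ 4 - (1 - \<gamma> * \<epsilon>) * z$4
      = z$2 * (x * x) / 2 + x * W - x * x * y / 2 + el / 2 - \<alpha> * (z$2 * (y * y) + y * y * y / 3)"
  proof -
    have "f $ 4 = z$4 - z$3 * x + z$2 * (x * x) / 2 + x * W - x * x * y / 2 + el / 2 + \<epsilon> * coeff_112 \<alpha> \<gamma> z
       - \<alpha> * (z$2 * z$2 * y) - \<alpha> * (z$2 * (y * y) + y * y * y / 3)"
      by (simp add: f_def flow_nth W_def l' power2_eq_square power3_eq_cube algebra_simps add_divide_distrib)
    moreover have "z$4 - z$3 * x + \<epsilon> * coeff_112 \<alpha> \<gamma> z - \<alpha> * (z$2 * z$2 * y) = (1 - \<gamma> * \<epsilon>) * z$4"
      by (simp add: x(1) y(1) coeff_1_def coeff_2_def coeff_112_def power3_eq_cube algebra_simps)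
    ultimately show ?thesis by linarith
  qed
  moreover have "\<bar>\<alpha> * (z$2 * (y * y) + y * y * y / 3)\<bar> \<le> \<bar>\<alpha>\<bar> * (2 * (\<delta> * R^3))"
    by (rule abs_mult_le[OF order_refl]) (use zyy yyy in linarith)
  ultimately have "\<bar>f $ 4 - (1 - \<gamma> * \<epsilon>) * z$4\<bar> \<le> 51 * (\<delta> * R^3) + \<bar>\<alpha>\<bar> * (2 * (\<delta> * R^3))"
    using zxx xW xxy l(1) unfolding el_def[symmetric] by linarith
  then show "\<bar>f $ 4 - (1 - \<gamma> * \<epsilon>) * z$4\<bar> \<le> (51 + 2 * \<bar>\<alpha>\<bar>) * (\<delta> * R^3)"
    by (simp add: algebra_simps)
  define G where "G = x * W - x * x * y / 2 + l / 2"
  have up: "A * (\<delta> * R^i) \<le> A * (\<epsilon> * R^i)" if "0 \<le> A" for A i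
    using small that by (intro mult_left_mono mult_right_mono) auto
  have "\<bar>\<epsilon> * (2 * coeff_112 \<alpha> \<gamma> z)\<bar> \<le> \<epsilon> * (2 * R^3)"
    using l(2) \<epsilon> by (intro abs_mult_le) auto
  then have "\<bar>l\<bar> \<le> 66 * (\<epsilon> * R^3)"
    using l(1) up[of 64 3] by linarith
  then have G: "\<bar>G\<bar> \<le> 52 * (\<epsilon> * R^3)"
    unfolding G_def using xW xxy up[of 18 3] up[of 1 3] by linarith
  have xG: "\<bar>x * G\<bar> \<le> 52 * (\<delta> * R^4)"
    using abs_mult_le[OF x(2) G] order2[of 52 4] by (simp add: eval_nat_numeral mult_ac)
  have en: "\<bar>en\<bar> \<le> 16 * (\<delta> * R^2)" and em: "\<bar>em\<bar> \<le> 256 * (\<delta> * R^4)"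
    using n m by (simp_all add: en_def em_def)
  have zz: "\<bar>z$2 * z$2\<bar> \<le> R^2"
    using abs_mult_le[OF z(1) z(1)] by (simp add: power2_eq_square)
  have zzen: "\<bar>z$2 * z$2 * en\<bar> \<le> 16 * (\<delta> * R^4)" and zzxy: "\<bar>z$2 * z$2 * (x * y)\<bar> \<le> \<delta> * R^4"
    using abs_mult_le[OF zz en] abs_mult_le[OF zz xy] by (simp_all add: eval_nat_numeral mult_ac)
  have z3xx: "\<bar>z$3 * (x * x)\<bar> \<le> \<delta> * R^4" and z3yy: "\<bar>z$3 * (y * y)\<bar> \<le> \<delta> * R^4"
    using abs_mult_le[OF z(2) xx] abs_mult_le[OF z(2) yy] by (simp_all add: eval_nat_numeral mult_ac)
  have zxxx: "\<bar>z$2 * (x * x * x)\<bar> \<le> \<delta> * R^4" and zxyy: "\<bar>z$2 * (x * y * y)\<bar> \<le> \<delta> * R^4"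
    and zyW: "\<bar>z$2 * (y * W)\<bar> \<le> 18 * (\<delta> * R^4)"
    using abs_mult_le[OF z(1) xxx] abs_mult_le[OF z(1) xyy] abs_mult_le[OF z(1) yW]
    by (simp_all add: eval_nat_numeral mult_ac)
  have xxW: "\<bar>x * (x * W)\<bar> \<le> 18 * (\<delta> * R^4)" and yyW: "\<bar>y * (y * W)\<bar> \<le> 18 * (\<delta> * R^4)"
    and xxxy: "\<bar>x * (x * x * y)\<bar> \<le> \<delta> * R^4"
    using abs_mult_le[OF x(2) xW] abs_mult_le[OF y(2) yW] order_trans[OF abs_mult_le[OF x(2) xxy] drop3] drop3
    by linarith+
  define P where "P = \<theta> * (z$2 * (y * W) - z$3 * (y * y) / 2 + z$2 * (x * y * y) / 2 + y * (y * W) / 2)"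
  have "\<bar>P\<bar> \<le> \<bar>\<theta>\<bar> * (38 * (\<delta> * R^4))"
    unfolding P_def by (rule abs_mult_le[OF order_refl]) (use zyW z3yy zxyy yyW in linarith)
  moreover have "\<bar>(3 * \<kappa> + \<alpha>) * (z$2 * z$2 * (x * y) - z$2 * z$2 * en)\<bar> \<le> \<bar>3 * \<kappa> + \<alpha>\<bar> * (17 * (\<delta> * R^4))"
    by (rule abs_mult_le[OF order_refl]) (use zzen zzxy in linarith)
  moreover have "\<bar>\<theta> * (z$2 * z$2 * en)\<bar> \<le> \<bar>\<theta>\<bar> * (16 * (\<delta> * R^4))"
    by (rule abs_mult_le[OF order_refl zzen])
  moreover have "\<bar>(\<kappa> + \<alpha>/3 - \<theta>/2) * k\<bar> \<le> \<bar>\<kappa> + \<alpha>/3 - \<theta>/2\<bar> * (2144 * (\<delta> * R^4))"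
    by (rule abs_mult_le[OF order_refl k])
  moreover have "f $ 5 - (1 - \<gamma> * \<epsilon>) * z$5 - (3 * \<kappa> + \<alpha> - 3/2 * \<theta>) * z$2 * j
      = (3 * \<kappa> + \<alpha>) * (z$2 * z$2 * (x * y) - z$2 * z$2 * en) + \<theta> * (z$2 * z$2 * en) + (\<kappa> + \<alpha>/3 - \<theta>/2) * k
        + (z$3 * (x * x) / 2 - z$2 * (x * x * x) / 6 - x * G) + (x * (x * W) / 2 - x * (x * x * y) / 6 + em / 6) + P"
  proof -
    have "f $ 5 = z$5 + \<kappa> * (z$2 * z$2 * z$2 * x) + (3 * \<kappa> + \<alpha>) * (z$2 * z$2 * W) + \<theta> * (z$2 * z$2 * n)
        - z$4 * x - \<theta> * (z$2 * z$3 * y) + m / 6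
        + (3 * \<kappa> + \<alpha> - 3/2 * \<theta>) * z$2 * j + (\<kappa> + \<alpha>/3 - \<theta>/2) * k
        + z$3 * (x * x) / 2 - z$2 * (x * x * x) / 6 - x * G + x * (x * W) / 2 - x * (x * x * y) / 6 + P"
      unfolding f_def flow_nth G_def P_def W_def
      by (simp add: power2_eq_square power3_eq_cube field_simps)
    moreover have "z$5 + \<kappa> * (z$2 * z$2 * z$2 * x) + (3 * \<kappa> + \<alpha>) * (z$2 * z$2 * W) + \<theta> * (z$2 * z$2 * n)
        - z$4 * x - \<theta> * (z$2 * z$3 * y) + m / 6
      = (1 - \<gamma> * \<epsilon>) * z$5 + (3 * \<kappa> + \<alpha>) * (z$2 * z$2 * (x * y) - z$2 * z$2 * en) + \<theta> * (z$2 * z$2 * en) + em / 6"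
      unfolding W_def n' m' x(1) y(1) coeff_1_def coeff_2_def coeff_12_def coeff_1112_def
      by (simp add: power2_eq_square power3_eq_cube field_simps)
    ultimately show ?thesis by linarith
  qed
  moreover have "\<bar>z$3 * (x * x) / 2 - z$2 * (x * x * x) / 6 - x * G\<bar> \<le> 53 * (\<delta> * R^4)"
    using z3xx zxxx xG by linarith
  moreover have "\<bar>x * (x * W) / 2 - x * (x * x * y) / 6 + em / 6\<bar> \<le> 63 * (\<delta> * R^4)"
    using xxW xxxy em by linarith
  ultimately have "\<bar>f $ 5 - (1 - \<gamma> * \<epsilon>) * z$5 - (3 * \<kappa> + \<alpha> - 3/2 * \<theta>) * z$2 * j\<bar>
     \<le> \<bar>3 * \<kappa> + \<alpha>\<bar> * (17 * (\<delta> * R^4)) + \<bar>\<theta>\<bar> * (16 * (\<delta> * R^4))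
       + \<bar>\<kappa> + \<alpha>/3 - \<theta>/2\<bar> * (2144 * (\<delta> * R^4)) + 53 * (\<delta> * R^4) + 63 * (\<delta> * R^4)
       + \<bar>\<theta>\<bar> * (38 * (\<delta> * R^4))"
    by (simp only:) (intro abs_add_le)
  then show "\<bar>f $ 5 - (1 - \<gamma> * \<epsilon>) * z$5 - (3 * \<kappa> + \<alpha> - 3/2 * \<theta>) * z$2 * j\<bar>
       \<le> (17 * \<bar>3 * \<kappa> + \<alpha>\<bar> + 54 * \<bar>\<theta>\<bar> + 2144 * \<bar>\<kappa> + \<alpha>/3 - \<theta>/2\<bar> + 116) * (\<delta> * R^4)"
    by (simp add: algebra_simps)
qed

section \<open>Sampled solutions\<close>

lemma has_vector_derivative_rescale:
  fixes f :: "real \<Rightarrow> 'a::real_normed_vector"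
  assumes "\<epsilon> > 0"
    and "(f has_vector_derivative \<epsilon> *\<^sub>R f') (at (t / \<epsilon> - a) within {0..1})"
    and "(\<lambda>t. t / \<epsilon> - a) ` S \<subseteq> {0..1}"
  shows "((\<lambda>t. f (t / \<epsilon> - a)) has_vector_derivative f') (at t within S)"
proof -
  have "((\<lambda>t. t / \<epsilon> - a) has_real_derivative 1 / \<epsilon>) (at t within S)"
    using \<open>\<epsilon> > 0\<close> by (auto intro!: derivative_eq_intros)
  then have "((\<lambda>t. t / \<epsilon> - a) has_vector_derivative 1 / \<epsilon>) (at t within S)"
    by (simp add: has_real_derivative_iff_has_vector_derivative)
  from vector_diff_chain_within[OF this has_vector_derivative_within_subset[OF assms(2,3)]]
  show ?thesis using \<open>\<epsilon> > 0\<close> by (simp add: o_def)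
qed

lemma continuous_on_sampled:
  fixes z :: "real \<Rightarrow> 'a::topological_space"
  assumes "\<epsilon> > 0" and cont: "\<And>j::nat. continuous_on {real j * \<epsilon>..real (Suc j) * \<epsilon>} z"
  shows "continuous_on {0..} z"
proof -
  have upto: "continuous_on {0..real n * \<epsilon>} z" for n
  proof (induction n)
    case (Suc n)
    have "{0..real (Suc n) * \<epsilon>} = {0..real n * \<epsilon>} \<union> {real n * \<epsilon>..real (Suc n) * \<epsilon>}"
      using \<open>\<epsilon> > 0\<close> by (intro ivl_disj_un_two_touch(4)[symmetric]) auto
    with Suc cont[of n] show ?case by (simp add: continuous_on_closed_Un)
  qed simp
  show ?thesis
    unfolding continuous_on_eq_continuous_within
  proof
    fix t :: real assume "t \<in> {0..}"
    obtain n :: nat where n: "t < real n * \<epsilon>"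
      using reals_Archimedean3[OF \<open>\<epsilon> > 0\<close>] by blast
    have "at t within {0..} = at t within {0..real n * \<epsilon>}"
      by (rule at_within_nhd[of _ "{..<real n * \<epsilon>}"]) (use n in auto)
    then show "continuous (at t within {0..}) z"
      using upto[of n] n \<open>t \<in> {0..}\<close> by (simp add: continuous_on_eq_continuous_within)
  qed
qed

text \<open>\<open>F z\<close> is the solution over one period in the normalised time \<open>s\<close>, started and sampled at \<open>z\<close>; a sampled
  solution is obtained by restarting it from its endpoint.\<close>

lemma glue_pi_solution:
  fixes F :: "'a::real_normed_vector \<Rightarrow> real \<Rightarrow> 'a" and \<epsilon> :: real
  assumes "\<epsilon> > 0" and start: "\<And>z. F z 0 = z"
    and F': "\<And>z s j. s \<in> {0..1} \<Longrightarrow>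
      (F z has_vector_derivative
         \<epsilon> *\<^sub>R (u1 (\<epsilon> * (real j + s)) z *\<^sub>R g1 (F z s) + u2 (\<epsilon> * (real j + s)) z *\<^sub>R g2 (F z s)))
       (at s within {0..1})"
  obtains z where "pi_solution \<epsilon> g1 g2 u1 u2 z"
    "\<And>j t. t \<in> {real j * \<epsilon>..real (Suc j) * \<epsilon>} \<Longrightarrow> z t = F (((\<lambda>z. F z 1) ^^ j) z0) (t / \<epsilon> - real j)"
proof -
  define Z where "Z j = ((\<lambda>z. F z 1) ^^ j) z0" for j
  define z where "z t = (let j = nat \<lfloor>t / \<epsilon>\<rfloor> in F (Z j) (t / \<epsilon> - real j))" for t
  have z_open: "z t = F (Z j) (t / \<epsilon> - real j)" if "t \<in> {real j * \<epsilon>..<real (Suc j) * \<epsilon>}" for t j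
  proof -
    have "real j \<le> t / \<epsilon>" "t / \<epsilon> < real j + 1"
      using that \<open>\<epsilon> > 0\<close> by (simp_all add: field_simps)
    then have "\<lfloor>t / \<epsilon>\<rfloor> = int j" by linarith
    then show ?thesis by (simp add: z_def)
  qed
  have z_closed: "z t = F (Z j) (t / \<epsilon> - real j)" if t: "t \<in> {real j * \<epsilon>..real (Suc j) * \<epsilon>}" for t j
  proof (cases "t = real (Suc j) * \<epsilon>")
    case True
    have "z t = F (Z (Suc j)) (t / \<epsilon> - real (Suc j))"
      by (rule z_open) (use True \<open>\<epsilon> > 0\<close> in auto)
    also have "\<dots> = F (Z j) (t / \<epsilon> - real j)"
      using True \<open>\<epsilon> > 0\<close> by (simp add: start Z_def)
    finally show ?thesis .
  qed (use t z_open in auto)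
  have range: "(\<lambda>t. t / \<epsilon> - real j) ` {real j * \<epsilon>..real (Suc j) * \<epsilon>} \<subseteq> {0..1}" for j
    using \<open>\<epsilon> > 0\<close> by (auto simp: field_simps)
  have der: "((\<lambda>t. F (Z j) (t / \<epsilon> - real j)) has_vector_derivative
      (u1 t (Z j) *\<^sub>R g1 (F (Z j) (t / \<epsilon> - real j)) + u2 t (Z j) *\<^sub>R g2 (F (Z j) (t / \<epsilon> - real j))))
      (at t within {real j * \<epsilon>..real (Suc j) * \<epsilon>})"
    if t: "t \<in> {real j * \<epsilon>..real (Suc j) * \<epsilon>}" for t j
  proof (rule has_vector_derivative_rescale[OF \<open>\<epsilon> > 0\<close> _ range])
    have "t / \<epsilon> - real j \<in> {0..1}" using t range by blast
    moreover have "\<epsilon> * (real j + (t / \<epsilon> - real j)) = t" using \<open>\<epsilon> > 0\<close> by simp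
    ultimately show "(F (Z j) has_vector_derivative \<epsilon> *\<^sub>R
        (u1 t (Z j) *\<^sub>R g1 (F (Z j) (t / \<epsilon> - real j)) + u2 t (Z j) *\<^sub>R g2 (F (Z j) (t / \<epsilon> - real j))))
        (at (t / \<epsilon> - real j) within {0..1})"
      using F'[of "t / \<epsilon> - real j" "Z j" j] by simp
  qed
  have "pi_solution \<epsilon> g1 g2 u1 u2 z"
    unfolding pi_solution_def
  proof (intro conjI allI ballI)
    show "continuous_on {0..} z"
    proof (rule continuous_on_sampled[OF \<open>\<epsilon> > 0\<close>])
      fix j
      have "continuous_on {real j * \<epsilon>..real (Suc j) * \<epsilon>} (\<lambda>t. F (Z j) (t / \<epsilon> - real j))"
        using der by (intro continuous_on_vector_derivative) auto
      then show "continuous_on {real j * \<epsilon>..real (Suc j) * \<epsilon>} z"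
        by (rule continuous_on_eq) (simp add: z_closed)
    qed
    fix j t assume t: "t \<in> {real j * \<epsilon>..<real (Suc j) * \<epsilon>}"
    have "z (real j * \<epsilon>) = Z j" using z_open[of "real j * \<epsilon>" j] \<open>\<epsilon> > 0\<close> by (simp add: start)
    moreover have "(z has_vector_derivative
      (u1 t (Z j) *\<^sub>R g1 (F (Z j) (t / \<epsilon> - real j)) + u2 t (Z j) *\<^sub>R g2 (F (Z j) (t / \<epsilon> - real j))))
      (at t within {real j * \<epsilon>..<real (Suc j) * \<epsilon>})"
      by (rule has_vector_derivative_transform[OF t _ has_vector_derivative_within_subset[OF der]])
         (use t z_open in auto)
    ultimately show "(z has_vector_derivative
         u1 t (z (real j * \<epsilon>)) *\<^sub>R g1 (z t) + u2 t (z (real j * \<epsilon>)) *\<^sub>R g2 (z t))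
        (at t within {real j * \<epsilon>..<real (Suc j) * \<epsilon>})"
      using z_open[OF t] by simp
  qed
  with z_closed show ?thesis using that unfolding Z_def by blast
qed

lemma pi_solution_unique:
  assumes "\<epsilon> > 0" and y: "pi_solution \<epsilon> (field_g1 \<kappa>) (field_g2 \<alpha> \<theta>) u1 u2 y"
    and z: "pi_solution \<epsilon> (field_g1 \<kappa>) (field_g2 \<alpha> \<theta>) u1 u2 z" and "y 0 = z 0" and "t \<ge> 0"
  shows "y t = z t"
proof -
  have step: "y t = z t"
    if eq: "y (real j * \<epsilon>) = z (real j * \<epsilon>)" and t: "t \<in> {real j * \<epsilon>..real (Suc j) * \<epsilon>}" for j t
  proof (rule control_solution_unique[where ?u1.0 = "\<lambda>t. u1 t (z (real j * \<epsilon>))" and ?u2.0 = "\<lambda>t. u2 t (z (real j * \<epsilon>))"])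
    show "real j * \<epsilon> < real (Suc j) * \<epsilon>" using \<open>\<epsilon> > 0\<close> by simp
    have "{real j * \<epsilon>..real (Suc j) * \<epsilon>} \<subseteq> {0..}" using \<open>\<epsilon> > 0\<close> by (auto intro: order_trans[rotated])
    then show "continuous_on {real j * \<epsilon>..real (Suc j) * \<epsilon>} y" "continuous_on {real j * \<epsilon>..real (Suc j) * \<epsilon>} z"
      using y z unfolding pi_solution_def by (blast intro: continuous_on_subset)+
    fix s assume s: "real j * \<epsilon> < s" "s < real (Suc j) * \<epsilon>"
    then have at: "at s within {real j * \<epsilon>..<real (Suc j) * \<epsilon>} = at s"
      by (intro at_within_interior) auto
    from s have "s \<in> {real j * \<epsilon>..<real (Suc j) * \<epsilon>}" by simp
    with y z show
      "(y has_vector_derivative u1 s (z (real j * \<epsilon>)) *\<^sub>R field_g1 \<kappa> (y s) + u2 s (z (real j * \<epsilon>)) *\<^sub>R field_g2 \<alpha> \<theta> (y s)) (at s)"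
      "(z has_vector_derivative u1 s (z (real j * \<epsilon>)) *\<^sub>R field_g1 \<kappa> (z s) + u2 s (z (real j * \<epsilon>)) *\<^sub>R field_g2 \<alpha> \<theta> (z s)) (at s)"
      unfolding pi_solution_def eq[symmetric] at[symmetric] using eq by metis+
  qed (use eq t in auto)
  have nodes: "y (real j * \<epsilon>) = z (real j * \<epsilon>)" for j
  proof (induction j)
    case (Suc j)
    show ?case by (rule step[OF Suc]) (use \<open>\<epsilon> > 0\<close> in simp)
  qed (simp add: \<open>y 0 = z 0\<close>)
  have "t \<in> {real (nat \<lfloor>t / \<epsilon>\<rfloor>) * \<epsilon>..real (Suc (nat \<lfloor>t / \<epsilon>\<rfloor>)) * \<epsilon>}"
  proof -
    have "real (nat \<lfloor>t / \<epsilon>\<rfloor>) \<le> t / \<epsilon>" "t / \<epsilon> \<le> real (Suc (nat \<lfloor>t / \<epsilon>\<rfloor>))"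
      using \<open>t \<ge> 0\<close> \<open>\<epsilon> > 0\<close> by (auto simp: le_nat_floor) linarith+
    then show ?thesis using \<open>\<epsilon> > 0\<close> by (simp add: field_simps)
  qed
  then show ?thesis by (rule step[OF nodes])
qed

section \<open>The feedback law in terms of the modes\<close>

context oscillation
begin

text \<open>The amplitudes of the modes after multiplication by \<open>\<epsilon>\<close> and removal of the power of \<open>\<eta>\<close>.\<close>

fun amp1 :: "real \<Rightarrow> real \<Rightarrow> real \<Rightarrow> real \<Rightarrow> real^5 \<Rightarrow> mode \<Rightarrow> real" where
  "amp1 \<alpha> \<kappa> \<theta> \<gamma> z Drift = coeff_1 \<gamma> z"
| "amp1 \<alpha> \<kappa> \<theta> \<gamma> z Osc12 = (4 * pi * k12 * \<bar>coeff_12 \<gamma> z\<bar>) powr (1/2)"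
| "amp1 \<alpha> \<kappa> \<theta> \<gamma> z Osc112 = (4 * pi * k112) powr (2/3) * \<bar>coeff_112 \<alpha> \<gamma> z\<bar> powr (1/3)"
| "amp1 \<alpha> \<kappa> \<theta> \<gamma> z Osc1112 = 2 * (2 * pi * k1112) powr (3/4) * \<bar>coeff_1112 \<alpha> \<kappa> \<theta> \<gamma> z\<bar> powr (1/4)"

fun amp2 :: "real \<Rightarrow> real \<Rightarrow> real \<Rightarrow> real \<Rightarrow> real^5 \<Rightarrow> mode \<Rightarrow> real" where
  "amp2 \<alpha> \<kappa> \<theta> \<gamma> z Drift = coeff_2 \<gamma> z"
| "amp2 \<alpha> \<kappa> \<theta> \<gamma> z Osc12 = amp1 \<alpha> \<kappa> \<theta> \<gamma> z Osc12 * sgn (coeff_12 \<gamma> z)"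
| "amp2 \<alpha> \<kappa> \<theta> \<gamma> z Osc112 = - 2 * (amp1 \<alpha> \<kappa> \<theta> \<gamma> z Osc112 * sgn (coeff_112 \<alpha> \<gamma> z))"
| "amp2 \<alpha> \<kappa> \<theta> \<gamma> z Osc1112 = - 3 * (amp1 \<alpha> \<kappa> \<theta> \<gamma> z Osc1112 * sgn (coeff_1112 \<alpha> \<kappa> \<theta> \<gamma> z))"

lemma eta_powr:
  assumes "(\<eta>::real) > 0" "p = real m / 12"
  shows "(\<eta> ^ 12) powr p = \<eta> ^ m"
proof -
  have "(\<eta> ^ 12) powr p = (\<eta> powr 12) powr p"
    using assms powr_realpow[of \<eta> 12] by simp
  also have "\<dots> = \<eta> powr real m" by (simp add: powr_powr assms(2))
  finally show ?thesis by (simp only: powr_realpow[OF assms(1)])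
qed

lemma cos_shift_period: "cos (2 * pi * real k * (real j + s)) = cos (2 * pi * real k * s)"
  and sin_shift_period: "sin (2 * pi * real k * (real j + s)) = sin (2 * pi * real k * s)"
proof -
  have "2 * pi * real k * (real j + s) = 2 * pi * real k * s + 2 * real (k * j) * pi"
    by (simp add: algebra_simps)
  then show "cos (2 * pi * real k * (real j + s)) = cos (2 * pi * real k * s)"
    "sin (2 * pi * real k * (real j + s)) = sin (2 * pi * real k * s)"
    by (simp_all only: cos_add sin_add cos_2npi sin_2npi mult_zero_right mult_1_right diff_zero add_0_right)
qed

lemma feedback_as_modes:
  assumes "\<eta> > 0"
  defines "\<epsilon> \<equiv> \<eta> ^ 12"
  shows "\<epsilon> * feedback_u1 \<alpha> \<kappa> \<theta> \<gamma> k12 k112 k1112 \<epsilon> (\<epsilon> * (real j + s)) z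
      = (\<Sum>i\<in>UNIV. (\<eta> ^ weight i * amp1 \<alpha> \<kappa> \<theta> \<gamma> z i) * wave1 i s)" (is ?u1)
    and "\<epsilon> * feedback_u2 \<alpha> \<kappa> \<theta> \<gamma> k12 k112 k1112 \<epsilon> (\<epsilon> * (real j + s)) z
      = (\<Sum>i\<in>UNIV. (\<eta> ^ weight i * amp2 \<alpha> \<kappa> \<theta> \<gamma> z i) * wave2 i s)" (is ?u2)
proof -
  have \<epsilon>: "\<epsilon> > 0" using assms by simp
  have phase: "real k * (2 * pi / \<epsilon>) * (\<epsilon> * (real j + s)) = 2 * pi * real k * (real j + s)" for k
    using \<epsilon> by simp
  have A: "(2 * real k12 * (2 * pi / \<epsilon>) * \<bar>a\<bar>) powr (1/2) = (4 * pi * k12 * \<bar>a\<bar>) powr (1/2) / \<eta> ^ 6" for a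
  proof -
    have "2 * real k12 * (2 * pi / \<epsilon>) * \<bar>a\<bar> = (4 * pi * k12 * \<bar>a\<bar>) / \<epsilon>" by simp
    then show ?thesis
      using eta_powr[OF \<open>\<eta> > 0\<close>, of "1/2" 6] \<epsilon> by (simp only: powr_divide) (simp add: \<epsilon>_def powr_divide)
  qed
  have B: "(2 * real k112 * (2 * pi / \<epsilon>)) powr (2/3) = (4 * pi * k112) powr (2/3) / \<eta> ^ 8"
  proof -
    have "2 * real k112 * (2 * pi / \<epsilon>) = (4 * pi * k112) / \<epsilon>" by simp
    then show ?thesis
      using eta_powr[OF \<open>\<eta> > 0\<close>, of "2/3" 8] \<epsilon> by (simp only: powr_divide) (simp add: \<epsilon>_def powr_divide)
  qed
  have C: "(k1112 * (2 * pi / \<epsilon>)) powr (3/4) = (2 * pi * k1112) powr (3/4) / \<eta> ^ 9"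
  proof -
    have "k1112 * (2 * pi / \<epsilon>) = (2 * pi * k1112) / \<epsilon>" by simp
    then show ?thesis
      using eta_powr[OF \<open>\<eta> > 0\<close>, of "3/4" 9] \<epsilon> by (simp only: powr_divide) (simp add: \<epsilon>_def powr_divide)
  qed
  have p: "\<epsilon> / \<eta> ^ 6 = \<eta> ^ 6" "\<epsilon> / \<eta> ^ 8 = \<eta> ^ 4" "\<epsilon> / \<eta> ^ 9 = \<eta> ^ 3"
    using \<open>\<eta> > 0\<close> by (simp_all add: \<epsilon>_def power_diff[symmetric])
  have e: "\<epsilon> * (x / a * y) = (\<epsilon> / a) * x * y" for x y a by simp
  have p': "\<epsilon> * (x / \<eta> ^ 6 * y) = \<eta> ^ 6 * x * y" "\<epsilon> * (x / \<eta> ^ 8 * y) = \<eta> ^ 4 * x * y"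
    "\<epsilon> * (x / \<eta> ^ 9 * y) = \<eta> ^ 3 * x * y" for x y
    unfolding e p by (rule refl)+
  have c2: "2 * real k112 * (2 * pi / \<epsilon>) * t = real (2 * k112) * (2 * pi / \<epsilon>) * t"
    "3 * real k1112 * (2 * pi / \<epsilon>) * t = real (3 * k1112) * (2 * pi / \<epsilon>) * t" for t by simp_all
  have "\<epsilon> * feedback_u1 \<alpha> \<kappa> \<theta> \<gamma> k12 k112 k1112 \<epsilon> (\<epsilon> * (real j + s)) z
    = \<epsilon> * coeff_1 \<gamma> z
      + \<epsilon> * ((4 * pi * k12 * \<bar>coeff_12 \<gamma> z\<bar>) powr (1/2) / \<eta> ^ 6 * cos (2 * pi * k12 * s))
      + \<epsilon> * ((4 * pi * k112) powr (2/3) / \<eta> ^ 8 * (\<bar>coeff_112 \<alpha> \<gamma> z\<bar> powr (1/3) * cos (2 * pi * k112 * s)))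
      + \<epsilon> * ((2 * pi * k1112) powr (3/4) / \<eta> ^ 9 * (2 * \<bar>coeff_1112 \<alpha> \<kappa> \<theta> \<gamma> z\<bar> powr (1/4) * cos (2 * pi * k1112 * s)))"
    unfolding feedback_u1_def Let_def A B C phase cos_shift_period by (simp only: distrib_left mult_ac)
  then show ?u1
    unfolding p' by (simp add: UNIV_mode \<epsilon>_def)
  have "\<epsilon> * feedback_u2 \<alpha> \<kappa> \<theta> \<gamma> k12 k112 k1112 \<epsilon> (\<epsilon> * (real j + s)) z
    = \<epsilon> * coeff_2 \<gamma> z
      + \<epsilon> * ((4 * pi * k12 * \<bar>coeff_12 \<gamma> z\<bar>) powr (1/2) / \<eta> ^ 6 * (sgn (coeff_12 \<gamma> z) * sin (2 * pi * k12 * s)))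
      - \<epsilon> * ((4 * pi * k112) powr (2/3) / \<eta> ^ 8 * (2 * \<bar>coeff_112 \<alpha> \<gamma> z\<bar> powr (1/3) * sgn (coeff_112 \<alpha> \<gamma> z) * cos (2 * pi * real (2 * k112) * s)))
      - \<epsilon> * ((2 * pi * k1112) powr (3/4) / \<eta> ^ 9 * (6 * \<bar>coeff_1112 \<alpha> \<kappa> \<theta> \<gamma> z\<bar> powr (1/4) * sgn (coeff_1112 \<alpha> \<kappa> \<theta> \<gamma> z) * sin (2 * pi * real (3 * k1112) * s)))"
    unfolding feedback_u2_def Let_def A B C c2 phase cos_shift_period sin_shift_period
    by (simp only: distrib_left right_diff_distrib mult_ac)
  then show ?u2
    unfolding p' by (simp add: UNIV_mode \<epsilon>_def del: of_nat_mult)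
qed

lemma amp1_powers:
  "amp1 \<alpha> \<kappa> \<theta> \<gamma> z Osc12 ^ 2 = 4 * pi * k12 * \<bar>coeff_12 \<gamma> z\<bar>"
  "amp1 \<alpha> \<kappa> \<theta> \<gamma> z Osc112 ^ 3 = (4 * pi * k112)^2 * \<bar>coeff_112 \<alpha> \<gamma> z\<bar>"
  "amp1 \<alpha> \<kappa> \<theta> \<gamma> z Osc1112 ^ 4 = 16 * (2 * pi * k1112)^3 * \<bar>coeff_1112 \<alpha> \<kappa> \<theta> \<gamma> z\<bar>"
proof -
  have root: "(x powr p) ^ n = x ^ m" if "x \<ge> 0" "p * real n = real m" "m > 0" for x p n m
  proof (cases "x = 0")
    case True
    with that show ?thesis by (cases "n = 0") (auto simp: power_0_left)
  next
    case False
    then have "(x powr p) ^ n = x powr (p * real n)"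
      using that by (simp add: powr_power mult.commute)
    also have "\<dots> = x ^ m" using that False by (simp add: powr_realpow)
    finally show ?thesis .
  qed
  show "amp1 \<alpha> \<kappa> \<theta> \<gamma> z Osc12 ^ 2 = 4 * pi * k12 * \<bar>coeff_12 \<gamma> z\<bar>"
    using root[of "4 * pi * k12 * \<bar>coeff_12 \<gamma> z\<bar>" "1/2" 2 1] by simp
  show "amp1 \<alpha> \<kappa> \<theta> \<gamma> z Osc112 ^ 3 = (4 * pi * k112)^2 * \<bar>coeff_112 \<alpha> \<gamma> z\<bar>"
    using root[of "4 * pi * k112" "2/3" 3 2] root[of "\<bar>coeff_112 \<alpha> \<gamma> z\<bar>" "1/3" 3 1]
    by (simp only: amp1.simps power_mult_distrib) simp
  show "amp1 \<alpha> \<kappa> \<theta> \<gamma> z Osc1112 ^ 4 = 16 * (2 * pi * k1112)^3 * \<bar>coeff_1112 \<alpha> \<kappa> \<theta> \<gamma> z\<bar>"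
    using root[of "2 * pi * k1112" "3/4" 4 3] root[of "\<bar>coeff_1112 \<alpha> \<kappa> \<theta> \<gamma> z\<bar>" "1/4" 4 1]
    by (simp only: amp1.simps power_mult_distrib) simp
qed

lemma amp1_nonneg: "i \<noteq> Drift \<Longrightarrow> amp1 \<alpha> \<kappa> \<theta> \<gamma> z i \<ge> 0"
  by (cases i) auto

text \<open>The products that survive averaging reproduce the coefficients of the feedback law; this is what
  fixes the roots and the numerical factors in the feedback law.\<close>

lemma averaged_amplitudes:
  fixes \<alpha> \<kappa> \<theta> \<gamma> :: real and z :: "real^5"
  defines "c \<equiv> amp1 \<alpha> \<kappa> \<theta> \<gamma> z" and "d \<equiv> amp2 \<alpha> \<kappa> \<theta> \<gamma> z"
  shows "c Osc12 * d Osc12 / (4 * pi * k12) = coeff_12 \<gamma> z"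
    "c Osc112 ^ 2 * d Osc112 / (4 * (2 * pi * k112)^2) = - 2 * coeff_112 \<alpha> \<gamma> z"
    "c Osc1112 ^ 3 * d Osc1112 / (8 * (2 * pi * k1112)^3) = - 6 * coeff_1112 \<alpha> \<kappa> \<theta> \<gamma> z"
proof -
  note pw = amp1_powers[of \<alpha> \<kappa> \<theta> \<gamma> z, folded c_def]
  have sg: "\<bar>a\<bar> * sgn a = a" for a :: real by (simp add: abs_mult_sgn)
  have "c Osc12 * d Osc12 = c Osc12 ^ 2 * sgn (coeff_12 \<gamma> z)"
    by (simp add: c_def d_def power2_eq_square del: amp1.simps)
  also have "\<dots> = 4 * pi * k12 * coeff_12 \<gamma> z"
    unfolding pw mult.assoc sg ..
  finally show "c Osc12 * d Osc12 / (4 * pi * k12) = coeff_12 \<gamma> z"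
    using freq_pos by simp
  have "c Osc112 ^ 2 * d Osc112 = - 2 * (c Osc112 ^ 3 * sgn (coeff_112 \<alpha> \<gamma> z))"
    by (simp add: c_def d_def power2_eq_square power3_eq_cube del: amp1.simps)
  also have "\<dots> = - 2 * ((4 * pi * k112)^2 * coeff_112 \<alpha> \<gamma> z)"
    unfolding pw mult.assoc sg ..
  finally show "c Osc112 ^ 2 * d Osc112 / (4 * (2 * pi * k112)^2) = - 2 * coeff_112 \<alpha> \<gamma> z"
    using freq_pos by (simp add: power_mult_distrib field_simps)
  have "c Osc1112 ^ 3 * d Osc1112 = - 3 * (c Osc1112 ^ 4 * sgn (coeff_1112 \<alpha> \<kappa> \<theta> \<gamma> z))"
    by (simp add: c_def d_def power4_eq_xxxx power3_eq_cube del: amp1.simps)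
  also have "\<dots> = - 3 * (16 * ((2 * pi * k1112)^3 * coeff_1112 \<alpha> \<kappa> \<theta> \<gamma> z))"
    unfolding pw mult.assoc sg ..
  finally show "c Osc1112 ^ 3 * d Osc1112 / (8 * (2 * pi * k1112)^3) = - 6 * coeff_1112 \<alpha> \<kappa> \<theta> \<gamma> z"
    using freq_pos by (simp add: power_mult_distrib field_simps)
qed

end

text \<open>Boxes for the weights \<open>1, 1, 2, 3, 4\<close> of the coordinates. The extra factor \<open>M\<close> in the last coordinate
  makes room for the resonant part of \<open>\<integral> V2^2 v1\<close>.\<close>

definition weighted_box :: "real \<Rightarrow> real \<Rightarrow> (real^5) set" where
  "weighted_box M r = {z. \<bar>z$1\<bar> \<le> r \<and> \<bar>z$2\<bar> \<le> r \<and> \<bar>z$3\<bar> \<le> r^2 \<and> \<bar>z$4\<bar> \<le> r^3 \<and> \<bar>z$5\<bar> \<le> (M * r)^4}"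

lemma le_by_power:
  fixes x Q q y :: real
  assumes "x ^ n \<le> q * y ^ n" "q \<le> Q" "1 \<le> Q" "0 \<le> y" "n > 0"
  shows "x \<le> Q * y"
proof -
  obtain m where n: "n = Suc m" using \<open>n > 0\<close> by (cases n) auto
  have "q \<le> Q ^ n" using self_le_power[of Q n] assms by linarith
  then have "x ^ n \<le> (Q * y) ^ n"
    using assms(1,4) by (simp add: power_mult_distrib) (meson mult_right_mono order_trans zero_le_power)
  then show ?thesis unfolding n by (rule power_le_imp_le_base) (use assms in auto)
qed

context oscillation
begin

lemma amplitudes_in_weighted_box:
  assumes "\<gamma> > 0"
  obtains Q where "Q \<ge> 1"
    "\<And>M r z i. 1 \<le> M \<Longrightarrow> 0 \<le> r \<Longrightarrow> z \<in> weighted_box M r \<Longrightarrow>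
       \<bar>amp1 \<alpha> \<kappa> \<theta> \<gamma> z i\<bar> \<le> Q * (M * r) \<and> \<bar>amp2 \<alpha> \<kappa> \<theta> \<gamma> z i\<bar> \<le> Q * (M * r) \<and>
       \<bar>coeff_112 \<alpha> \<gamma> z\<bar> \<le> (Q * (M * r)) ^ 3"
proof -
  \<comment> \<open>\<open>8 = 2 ^ 3\<close> and \<open>81 = 3 ^ 4\<close> come from the factors \<open>2\<close> and \<open>3\<close> in the amplitudes of the second control.\<close>
  define q2 where "q2 = 4 * pi * k12 * (2 * \<gamma>)"
  define q3 where "q3 = 8 * ((4 * pi * k112)^2 * ((2 + \<bar>\<alpha>\<bar>) * \<gamma>))"
  define q4 where "q4 = 81 * (16 * (2 * pi * k1112)^3 * ((\<bar>\<alpha> + 2 * \<kappa> - \<theta>\<bar> + \<bar>\<alpha> + 3 * \<kappa>\<bar> + 2) * \<gamma>))"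
  define q where "q = (2 + \<bar>\<alpha>\<bar>) * \<gamma>"
  define Q where "Q = 1 + \<gamma> + q + q2 + q3 + q4"
  have "0 \<le> q" "0 \<le> q2" "0 \<le> q3" "0 \<le> q4" using \<open>\<gamma> > 0\<close> by (simp_all add: q_def q2_def q3_def q4_def)
  with \<open>\<gamma> > 0\<close> have Q: "1 \<le> Q" "\<gamma> \<le> Q" "q \<le> Q" "q2 \<le> Q" "q3 \<le> Q" "q4 \<le> Q" by (simp_all add: Q_def)
  have "\<bar>amp1 \<alpha> \<kappa> \<theta> \<gamma> z i\<bar> \<le> Q * (M * r) \<and> \<bar>amp2 \<alpha> \<kappa> \<theta> \<gamma> z i\<bar> \<le> Q * (M * r) \<and>
       \<bar>coeff_112 \<alpha> \<gamma> z\<bar> \<le> (Q * (M * r)) ^ 3"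
    if M: "1 \<le> M" and r: "0 \<le> r" and z: "z \<in> weighted_box M r" for M r z i
  proof -
    define y where "y = M * r"
    have ry: "r \<le> y" "0 \<le> y" using M r by (simp_all add: y_def mult_le_cancel_right1)
    have pw: "r ^ n \<le> y ^ n" for n using ry r by (simp add: power_mono)
    have z1: "\<bar>z$1\<bar> \<le> y" and z2: "\<bar>z$2\<bar> \<le> y" and z3: "\<bar>z$3\<bar> \<le> y^2" and z4: "\<bar>z$4\<bar> \<le> y^3" and z5: "\<bar>z$5\<bar> \<le> y^4"
      using z ry pw[of 2] pw[of 3] by (auto simp: weighted_box_def y_def)
    have z22: "\<bar>(z$2)^2\<bar> \<le> y^2" and z23: "\<bar>(z$2)^3\<bar> \<le> y^3"
      using z2 by (simp_all only: power_abs power_mono abs_ge_zero)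
    have \<gamma>mult: "\<bar>- \<gamma> * x\<bar> \<le> b * \<gamma> * Y" if "\<bar>x\<bar> \<le> b * Y" for x b Y
      using that \<open>\<gamma> > 0\<close> by (simp add: abs_mult)
    have a1: "\<bar>coeff_1 \<gamma> z\<bar> \<le> Q * y" "\<bar>coeff_2 \<gamma> z\<bar> \<le> Q * y"
      using z1 z2 Q \<open>\<gamma> > 0\<close> by (auto simp: coeff_1_def coeff_2_def abs_mult intro!: mult_mono)
    have a12: "\<bar>coeff_12 \<gamma> z\<bar> \<le> 2 * \<gamma> * y^2"
      unfolding coeff_12_def
    proof (rule \<gamma>mult)
      show "\<bar>z$1 * z$2 + z$3\<bar> \<le> 2 * y^2"
        using abs_mult_le[OF z1 z2] z3 by (simp add: power2_eq_square)
    qed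
    have a112: "\<bar>coeff_112 \<alpha> \<gamma> z\<bar> \<le> q * y^3"
      unfolding coeff_112_def q_def
    proof (rule \<gamma>mult)
      have "\<bar>z$1 * z$3\<bar> \<le> y^3" using abs_mult_le[OF z1 z3] by (simp add: eval_nat_numeral)
      then show "\<bar>z$1 * z$3 + z$4 + \<alpha> * (z$2)^3\<bar> \<le> (2 + \<bar>\<alpha>\<bar>) * y^3"
        using abs_mult_le[OF order_refl z23, of \<alpha>] z4 by (simp add: algebra_simps)
    qed
    have a1112: "\<bar>coeff_1112 \<alpha> \<kappa> \<theta> \<gamma> z\<bar> \<le> (\<bar>\<alpha> + 2 * \<kappa> - \<theta>\<bar> + \<bar>\<alpha> + 3 * \<kappa>\<bar> + 2) * \<gamma> * y^4"
      unfolding coeff_1112_def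
    proof (rule \<gamma>mult)
      have 1: "\<bar>(\<alpha> + 2 * \<kappa> - \<theta>) * z$1 * (z$2)^3\<bar> \<le> \<bar>\<alpha> + 2 * \<kappa> - \<theta>\<bar> * y * y^3"
        by (intro abs_mult_le order_refl z1 z23)
      have 2: "\<bar>(\<alpha> + 3 * \<kappa>) * (z$2)^2 * z$3\<bar> \<le> \<bar>\<alpha> + 3 * \<kappa>\<bar> * y^2 * y^2"
        by (intro abs_mult_le order_refl z3 z22)
      have 3: "\<bar>z$1 * z$4\<bar> \<le> y * y^3" by (intro abs_mult_le z1 z4)
      have "\<bar>(\<alpha> + 2 * \<kappa> - \<theta>) * z$1 * (z$2)^3 + (\<alpha> + 3 * \<kappa>) * (z$2)^2 * z$3 + z$1 * z$4 + z$5\<bar>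
         \<le> \<bar>\<alpha> + 2 * \<kappa> - \<theta>\<bar> * y * y^3 + \<bar>\<alpha> + 3 * \<kappa>\<bar> * y^2 * y^2 + y * y^3 + y^4"
        by (intro abs_add_le 1 2 3 z5)
      then show "\<bar>(\<alpha> + 2 * \<kappa> - \<theta>) * z$1 * (z$2)^3 + (\<alpha> + 3 * \<kappa>) * (z$2)^2 * z$3 + z$1 * z$4 + z$5\<bar>
         \<le> (\<bar>\<alpha> + 2 * \<kappa> - \<theta>\<bar> + \<bar>\<alpha> + 3 * \<kappa>\<bar> + 2) * y^4"
        by (simp add: algebra_simps eval_nat_numeral)
    qed
    note pws = amp1_powers[of \<alpha> \<kappa> \<theta> \<gamma> z]
    note nn = amp1_nonneg[of _ \<alpha> \<kappa> \<theta> \<gamma> z]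
    have A: "amp1 \<alpha> \<kappa> \<theta> \<gamma> z Osc12 \<le> Q * y"
    proof (rule le_by_power[OF _ Q(4) Q(1) ry(2)])
      show "amp1 \<alpha> \<kappa> \<theta> \<gamma> z Osc12 ^ 2 \<le> q2 * y ^ 2"
        unfolding pws q2_def using mult_left_mono[OF a12, of "4 * pi * k12"] by (simp add: mult_ac)
    qed simp
    have B: "2 * amp1 \<alpha> \<kappa> \<theta> \<gamma> z Osc112 \<le> Q * y"
    proof (rule le_by_power[OF _ Q(5) Q(1) ry(2)])
      have "(2 * amp1 \<alpha> \<kappa> \<theta> \<gamma> z Osc112) ^ 3 = 8 * ((4 * pi * k112)^2 * \<bar>coeff_112 \<alpha> \<gamma> z\<bar>)"
        unfolding power_mult_distrib pws by simp
      also have "\<dots> \<le> 8 * ((4 * pi * k112)^2 * (q * y^3))"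
        by (intro mult_left_mono a112) auto
      finally show "(2 * amp1 \<alpha> \<kappa> \<theta> \<gamma> z Osc112) ^ 3 \<le> q3 * y ^ 3"
        by (simp add: q3_def q_def mult_ac)
    qed simp
    have C: "3 * amp1 \<alpha> \<kappa> \<theta> \<gamma> z Osc1112 \<le> Q * y"
    proof (rule le_by_power[OF _ Q(6) Q(1) ry(2)])
      have "(3 * amp1 \<alpha> \<kappa> \<theta> \<gamma> z Osc1112) ^ 4 = 81 * (16 * (2 * pi * k1112)^3 * \<bar>coeff_1112 \<alpha> \<kappa> \<theta> \<gamma> z\<bar>)"
        unfolding power_mult_distrib pws by simp
      also have "\<dots> \<le> 81 * (16 * (2 * pi * k1112)^3 * ((\<bar>\<alpha> + 2 * \<kappa> - \<theta>\<bar> + \<bar>\<alpha> + 3 * \<kappa>\<bar> + 2) * \<gamma> * y^4))"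
        by (intro mult_left_mono a1112) auto
      finally show "(3 * amp1 \<alpha> \<kappa> \<theta> \<gamma> z Osc1112) ^ 4 \<le> q4 * y ^ 4"
        unfolding q4_def by (simp only: mult.assoc)
    qed simp
    have sg: "\<bar>x * sgn a\<bar> \<le> x" if "0 \<le> x" for x a :: real
      using that by (simp add: abs_mult abs_sgn_eq)
    have "\<bar>amp1 \<alpha> \<kappa> \<theta> \<gamma> z i\<bar> \<le> Q * y"
    proof (cases i)
      case Drift then show ?thesis using a1 by simp
    qed (use A B C nn[of Osc12] nn[of Osc112] nn[of Osc1112] in \<open>simp_all del: amp1.simps\<close>)
    moreover have "\<bar>amp2 \<alpha> \<kappa> \<theta> \<gamma> z i\<bar> \<le> Q * y"
      using a1 A B C sg[OF nn[of Osc12], of "coeff_12 \<gamma> z"] sg[OF nn[of Osc112], of "coeff_112 \<alpha> \<gamma> z"]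
        sg[OF nn[of Osc1112], of "coeff_1112 \<alpha> \<kappa> \<theta> \<gamma> z"]
      by (cases i) (simp_all del: amp1.simps)
    moreover have "\<bar>coeff_112 \<alpha> \<gamma> z\<bar> \<le> (Q * y) ^ 3"
    proof -
      have "q \<le> Q ^ 3" using self_le_power[OF Q(1), of 3] Q(3) by simp
      then have "q * y ^ 3 \<le> (Q * y) ^ 3"
        using ry by (simp add: power_mult_distrib mult_right_mono)
      then show ?thesis using a112 by linarith
    qed
    ultimately show ?thesis unfolding y_def by blast
  qed
  then show ?thesis using that Q(1) by blast
qed

end

section \<open>Contraction over one sampling period\<close>

lemma polynomial_growth_le:
  fixes T T0 a b :: real
  assumes "0 \<le> T" "T \<le> T0" "0 \<le> a" "0 \<le> b"
  shows "4 * T + 3 * T^2 + a * T^3 + b * T^4 \<le> (4 + 3 * T0 + a * T0^2 + b * T0^3) * T"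
proof -
  have p: "T ^ n * T \<le> T0 ^ n * T" for n
    using assms by (intro mult_right_mono power_mono) auto
  have "3 * T^2 \<le> 3 * (T0 * T)" using p[of 1] by (simp add: power2_eq_square)
  moreover have "a * T^3 \<le> a * (T0^2 * T)"
    using p[of 2] \<open>0 \<le> a\<close> by (intro mult_left_mono) (simp_all add: eval_nat_numeral)
  moreover have "b * T^4 \<le> b * (T0^3 * T)"
    using p[of 3] \<open>0 \<le> b\<close> by (intro mult_left_mono) (simp_all add: eval_nat_numeral)
  ultimately show ?thesis by (simp add: algebra_simps)
qed

context oscillation
begin

definition closed_loop :: "real \<Rightarrow> real \<Rightarrow> real \<Rightarrow> real \<Rightarrow> real \<Rightarrow> real^5 \<Rightarrow> real \<Rightarrow> real^5" where
  "closed_loop \<alpha> \<kappa> \<theta> \<gamma> \<eta> z = modulated_oscillation.state k12 k112 k1112 \<eta>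
     (amp1 \<alpha> \<kappa> \<theta> \<gamma> z) (amp2 \<alpha> \<kappa> \<theta> \<gamma> z) \<alpha> \<kappa> \<theta> z"

lemma closed_loop_solves:
  assumes "0 < \<eta>" "\<eta> \<le> 1"
  defines "\<epsilon> \<equiv> \<eta> ^ 12"
  shows "closed_loop \<alpha> \<kappa> \<theta> \<gamma> \<eta> z 0 = z"
    and "s \<in> {0..1} \<Longrightarrow> (closed_loop \<alpha> \<kappa> \<theta> \<gamma> \<eta> z has_vector_derivative
      \<epsilon> *\<^sub>R (feedback_u1 \<alpha> \<kappa> \<theta> \<gamma> k12 k112 k1112 \<epsilon> (\<epsilon> * (real j + s)) z *\<^sub>R field_g1 \<kappa> (closed_loop \<alpha> \<kappa> \<theta> \<gamma> \<eta> z s)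
        + feedback_u2 \<alpha> \<kappa> \<theta> \<gamma> k12 k112 k1112 \<epsilon> (\<epsilon> * (real j + s)) z *\<^sub>R field_g2 \<alpha> \<theta> (closed_loop \<alpha> \<kappa> \<theta> \<gamma> \<eta> z s)))
      (at s within {0..1})"
proof -
  let ?c = "amp1 \<alpha> \<kappa> \<theta> \<gamma> z" and ?d = "amp2 \<alpha> \<kappa> \<theta> \<gamma> z"
  have le_sum: "\<bar>f i\<bar> \<le> (\<Sum>i\<in>UNIV. \<bar>f i\<bar>)" for f :: "mode \<Rightarrow> real" and i
    by (rule member_le_sum) auto
  interpret modulated_oscillation k12 k112 k1112 \<eta> "(\<Sum>i\<in>UNIV. \<bar>?c i\<bar>) + (\<Sum>i\<in>UNIV. \<bar>?d i\<bar>)" ?c ?d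
  proof unfold_locales
    show "\<bar>?c i\<bar> \<le> (\<Sum>i\<in>UNIV. \<bar>?c i\<bar>) + (\<Sum>i\<in>UNIV. \<bar>?d i\<bar>)"
      "\<bar>?d i\<bar> \<le> (\<Sum>i\<in>UNIV. \<bar>?c i\<bar>) + (\<Sum>i\<in>UNIV. \<bar>?d i\<bar>)" for i
      using le_sum[of ?c i] le_sum[of ?d i] by (auto intro: add_increasing add_increasing2 sum_nonneg)
  qed (use assms in \<open>auto intro!: add_nonneg_nonneg sum_nonneg\<close>)
  show "closed_loop \<alpha> \<kappa> \<theta> \<gamma> \<eta> z 0 = z"
    unfolding closed_loop_def by (rule state_0)
  assume "s \<in> {0..1}"
  from state_solves[OF this, of \<alpha> \<kappa> \<theta> z] show "(closed_loop \<alpha> \<kappa> \<theta> \<gamma> \<eta> z has_vector_derivative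
      \<epsilon> *\<^sub>R (feedback_u1 \<alpha> \<kappa> \<theta> \<gamma> k12 k112 k1112 \<epsilon> (\<epsilon> * (real j + s)) z *\<^sub>R field_g1 \<kappa> (closed_loop \<alpha> \<kappa> \<theta> \<gamma> \<eta> z s)
        + feedback_u2 \<alpha> \<kappa> \<theta> \<gamma> k12 k112 k1112 \<epsilon> (\<epsilon> * (real j + s)) z *\<^sub>R field_g2 \<alpha> \<theta> (closed_loop \<alpha> \<kappa> \<theta> \<gamma> \<eta> z s)))
      (at s within {0..1})"
    using feedback_as_modes[OF \<open>0 < \<eta>\<close>, of \<alpha> \<kappa> \<theta> \<gamma> j s z]
    by (simp add: closed_loop_def \<epsilon>_def v1_def v2_def scaleR_add_right)
qed

text \<open>All errors scale like the box, so one \<open>\<eta>0\<close> serves boxes of every size \<open>r\<close>. In the last coordinate the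
  damping is \<open>\<gamma> \<epsilon> (M r)^4\<close>, while the term with \<open>\<integral> V2^2 v1\<close> is at most a constant times
  \<open>\<epsilon> r (M r)^3\<close>: it is of degree one in \<open>z$2\<close>, which is bounded by \<open>r\<close> without the factor \<open>M\<close>. Hence
  it is dominated when \<open>M\<close> is large.\<close>

lemma closed_loop_contracts:
  assumes "\<gamma> > 0"
  obtains M Q \<eta>0 where "1 \<le> M" "1 \<le> Q" "0 < \<eta>0" "\<eta>0 \<le> 1" "\<gamma> * \<eta>0 \<le> 1"
    "\<And>\<eta> r z. 0 < \<eta> \<Longrightarrow> \<eta> < \<eta>0 \<Longrightarrow> 0 \<le> r \<Longrightarrow> z \<in> weighted_box M r \<Longrightarrow>
       closed_loop \<alpha> \<kappa> \<theta> \<gamma> \<eta> z 1 \<in> weighted_box M ((1 - \<gamma> * \<eta> ^ 12 / 8) * r)"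
    "\<And>\<eta> r z s. 0 < \<eta> \<Longrightarrow> \<eta> < \<eta>0 \<Longrightarrow> 0 \<le> r \<Longrightarrow> z \<in> weighted_box M r \<Longrightarrow> s \<in> {0..1} \<Longrightarrow>
       norm (closed_loop \<alpha> \<kappa> \<theta> \<gamma> \<eta> z s) \<le>
         (let T = 4 * (Q * (M * r)) in 4 * T + 3 * T^2 + (4 + 4 * \<bar>\<alpha>\<bar>) * T^3 + (5 + 8 * \<bar>\<kappa>\<bar> + 4 * \<bar>\<alpha>\<bar> + 6 * \<bar>\<theta>\<bar>) * T^4)"
proof -
  from amplitudes_in_weighted_box[OF assms, of \<alpha> \<kappa> \<theta>] obtain Q where Q: "1 \<le> Q"
    and amp: "\<And>M r z i. 1 \<le> M \<Longrightarrow> 0 \<le> r \<Longrightarrow> z \<in> weighted_box M r \<Longrightarrow>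
       \<bar>amp1 \<alpha> \<kappa> \<theta> \<gamma> z i\<bar> \<le> Q * (M * r) \<and> \<bar>amp2 \<alpha> \<kappa> \<theta> \<gamma> z i\<bar> \<le> Q * (M * r) \<and>
       \<bar>coeff_112 \<alpha> \<gamma> z\<bar> \<le> (Q * (M * r)) ^ 3" by blast
  define b where "b = \<bar>3 * \<kappa> + \<alpha> - 3/2 * \<theta>\<bar>"
  \<comment> \<open>\<open>1024 = 4 * 256\<close>: the \<open>j\<close>-term, bounded with the constant \<open>256\<close>, takes a quarter of the damping.\<close>
  define M where "M = max 1 (1024 * b * Q^3 / \<gamma>)"
  have M: "1 \<le> M" and bM: "1024 * b * Q^3 \<le> \<gamma> * M"
    using \<open>\<gamma> > 0\<close> by (auto simp: M_def max_def field_simps)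
  define D5 where "D5 = 17 * \<bar>3 * \<kappa> + \<alpha>\<bar> + 54 * \<bar>\<theta>\<bar> + 2144 * \<bar>\<kappa> + \<alpha>/3 - \<theta>/2\<bar> + 116"
  define D where "D = 17 * (Q * M)^2 + (51 + 2 * \<bar>\<alpha>\<bar>) * (Q * M)^3 + D5 * Q^4"
  define \<eta>0 where "\<eta>0 = min 1 (min (1 / \<gamma>) (\<gamma> / (4 * D)))"
  have D5: "0 \<le> D5" by (simp add: D5_def)
  have D_ge: "17 * (Q * M)^2 \<le> D" "(51 + 2 * \<bar>\<alpha>\<bar>) * (Q * M)^3 \<le> D" "D5 * Q^4 \<le> D" and "0 < D"
    using Q M D5 unfolding D_def by (auto intro!: add_pos_nonneg add_nonneg_nonneg)
  have \<eta>0: "0 < \<eta>0" "\<eta>0 \<le> 1" "\<gamma> * \<eta>0 \<le> 1" "4 * D * \<eta>0 \<le> \<gamma>"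
  proof -
    show "0 < \<eta>0" "\<eta>0 \<le> 1" using \<open>\<gamma> > 0\<close> \<open>0 < D\<close> by (simp_all add: \<eta>0_def)
    have "\<eta>0 \<le> 1 / \<gamma>" "\<eta>0 \<le> \<gamma> / (4 * D)" by (simp_all add: \<eta>0_def)
    then show "\<gamma> * \<eta>0 \<le> 1" "4 * D * \<eta>0 \<le> \<gamma>"
      using \<open>\<gamma> > 0\<close> \<open>0 < D\<close> by (simp_all add: field_simps)
  qed
  have main: "closed_loop \<alpha> \<kappa> \<theta> \<gamma> \<eta> z 1 \<in> weighted_box M ((1 - \<gamma> * \<eta> ^ 12 / 8) * r)"
    and bound: "s \<in> {0..1} \<Longrightarrow> norm (closed_loop \<alpha> \<kappa> \<theta> \<gamma> \<eta> z s) \<le>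
         (let T = 4 * (Q * (M * r)) in 4 * T + 3 * T^2 + (4 + 4 * \<bar>\<alpha>\<bar>) * T^3 + (5 + 8 * \<bar>\<kappa>\<bar> + 4 * \<bar>\<alpha>\<bar> + 6 * \<bar>\<theta>\<bar>) * T^4)"
    if eta: "0 < \<eta>" "\<eta> < \<eta>0" and r: "0 \<le> r" and z: "z \<in> weighted_box M r" for \<eta> r z s
  proof -
    let ?c = "amp1 \<alpha> \<kappa> \<theta> \<gamma> z" and ?d = "amp2 \<alpha> \<kappa> \<theta> \<gamma> z"
    define R where "R = Q * (M * r)"
    have rMr: "r \<le> M * r" using M r by (simp add: mult_le_cancel_right1)
    have "0 \<le> M * r" using rMr r by linarith
    then have MrR: "M * r \<le> R" and R: "0 \<le> R"
      using Q mult_right_mono[OF Q, of "M * r"] by (simp_all add: R_def)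
    have rR: "r \<le> R" using rMr MrR by linarith
    note zb = z[unfolded weighted_box_def, simplified]
    interpret modulated_oscillation k12 k112 k1112 \<eta> R ?c ?d
      by unfold_locales (use eta \<eta>0 R amp[OF M r z] in \<open>auto simp: R_def\<close>)
    define \<epsilon> where "\<epsilon> = \<eta> ^ 12"
    define g where "g = \<gamma> * \<epsilon>"
    have \<epsilon>: "0 < \<epsilon>" "\<epsilon> \<le> \<eta>" "\<epsilon> \<le> 1"
      using eta \<eta>0 power_decreasing[of 1 12 \<eta>] power_le_one[of \<eta> 12] by (simp_all add: \<epsilon>_def)
    have "\<gamma> * \<epsilon> \<le> \<gamma> * \<eta>0" using \<epsilon> eta \<open>\<gamma> > 0\<close> by simp
    with \<eta>0(3) have "\<gamma> * \<epsilon> \<le> 1" by linarith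
    then have g: "0 < g" "g \<le> 1" using \<epsilon> \<open>\<gamma> > 0\<close> by (simp_all add: g_def)
    let ?f = "closed_loop \<alpha> \<kappa> \<theta> \<gamma> \<eta> z 1"
    have f: "?f = flow \<alpha> \<kappa> \<theta> z (V1 1) (V2 1) (area 1) (moment112 1) (moment1112 1) (moment221 1) (moment2221 1)"
      unfolding closed_loop_def state_def ..
    have z2: "\<bar>z$2\<bar> \<le> R" and z3: "\<bar>z$3\<bar> \<le> R^2"
      using zb rR power_mono[OF rR r, of 2] by auto
    have scales: "0 \<le> \<eta> ^ 13" "\<eta> ^ 13 \<le> \<epsilon>" "\<epsilon> * \<epsilon> \<le> \<eta> ^ 13"
      unfolding \<epsilon>_def power_add[symmetric] using eta by (auto intro!: eta_powers)
    have ends: "V1 1 = \<epsilon> * coeff_1 \<gamma> z" "\<bar>V1 1\<bar> \<le> \<epsilon> * R" "V2 1 = \<epsilon> * coeff_2 \<gamma> z" "\<bar>V2 1\<bar> \<le> \<epsilon> * R"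
      using endpoint_le by (simp_all add: V_at_ends \<epsilon>_def)
    have n: "\<bar>area 1 - \<epsilon> * coeff_12 \<gamma> z\<bar> \<le> 16 * (\<eta> ^ 13 * R\<^sup>2)"
      using area_average unfolding area_def \<epsilon>_def averaged_amplitudes .
    have w: "\<bar>V1 1 * V2 1 - area 1\<bar> \<le> 18 * (\<epsilon> * R\<^sup>2)"
      using swapped_area_le by (simp add: \<epsilon>_def)
    have l: "\<bar>moment112 1 - \<epsilon> * (2 * coeff_112 \<alpha> \<gamma> z)\<bar> \<le> 64 * (\<eta> ^ 13 * R ^ 3)"
      using third_order_average unfolding moment112_def \<epsilon>_def averaged_amplitudes by simp
    have a112: "\<bar>coeff_112 \<alpha> \<gamma> z\<bar> \<le> R ^ 3" using amp[OF M r z] by (simp add: R_def)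
    have m: "\<bar>moment1112 1 - \<epsilon> * (6 * coeff_1112 \<alpha> \<kappa> \<theta> \<gamma> z)\<bar> \<le> 256 * (\<eta> ^ 13 * R ^ 4)"
      using fourth_order_average unfolding moment1112_def \<epsilon>_def averaged_amplitudes by simp
    note expansion = endpoint_expansion[OF scales \<epsilon>(3) R z2 z3 ends n w l a112 m swapped_moments_le(2),
        where j = "moment221 1", folded f D5_def]
    \<comment> \<open>By Bernoulli \<open>1 - g / 2 \<le> (1 - g / 8) ^ n\<close> for \<open>n \<le> 4\<close>: shrinking \<open>r\<close> uses up half of the damping.\<close>
    define \<rho> where "\<rho> = 1 - g / 8"
    have \<rho>: "0 \<le> \<rho>" "\<rho> \<le> 1" using g by (simp_all add: \<rho>_def)
    have \<rho>4: "1 - g / 2 \<le> \<rho> ^ 4"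
      using Bernoulli_inequality[of "- g / 8" 4] g by (simp add: \<rho>_def)
    have \<rho>n: "1 - g / 2 \<le> \<rho> ^ n" if "n \<le> 4" for n
      using \<rho>4 power_decreasing[OF that \<rho>] by linarith
    have abs_damped: "\<bar>(1 - g) * x\<bar> \<le> (1 - g) * B" if "\<bar>x\<bar> \<le> B" for x B
      using that g by (simp add: abs_mult mult_left_mono)
    have small: "A * \<eta> ^ 13 * B \<le> g / 4 * B" if "A \<le> D" "0 \<le> B" for A B
    proof -
      have "A * \<eta> ^ 13 = A * \<eta> * \<epsilon>" by (simp add: \<epsilon>_def eval_nat_numeral)
      also have "\<dots> \<le> D * \<eta>0 * \<epsilon>"
        using that eta \<epsilon> \<open>0 < D\<close> by (intro mult_right_mono mult_mono) auto
      also have "\<dots> \<le> \<gamma> / 4 * \<epsilon>" using \<eta>0(4) \<epsilon> by (intro mult_right_mono) auto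
      finally show ?thesis using that(2) by (intro mult_right_mono) (simp_all add: g_def)
    qed
    have f12: "\<bar>?f $ 1\<bar> \<le> \<rho> * r" "\<bar>?f $ 2\<bar> \<le> \<rho> * r"
    proof -
      have "(1 - g) * r \<le> \<rho> * r" using g r by (intro mult_right_mono) (simp_all add: \<rho>_def)
      then show "\<bar>?f $ 1\<bar> \<le> \<rho> * r" "\<bar>?f $ 2\<bar> \<le> \<rho> * r"
        using abs_damped[of "z$1" r] abs_damped[of "z$2" r] zb expansion(1,2) by (simp_all add: g_def)
    qed
    have finish: "\<bar>x\<bar> \<le> (\<rho> * B) ^ n" if "\<bar>x - (1 - g) * y\<bar> \<le> g / 2 * B ^ n" "\<bar>y\<bar> \<le> B ^ n" "n \<le> 4" "0 \<le> B"
      for x y B n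
    proof -
      have "\<bar>x\<bar> \<le> g / 2 * B ^ n + (1 - g) * B ^ n"
        using that(1) abs_damped[OF that(2)] by linarith
      also have "\<dots> = (1 - g / 2) * B ^ n" by (simp add: algebra_simps)
      also have "\<dots> \<le> \<rho> ^ n * B ^ n"
        using \<rho>n[OF that(3)] that(4) by (intro mult_right_mono) auto
      finally show ?thesis by (simp add: power_mult_distrib)
    qed
    have f3: "\<bar>?f $ 3\<bar> \<le> (\<rho> * r) ^ 2"
    proof (rule finish[of _ "z$3"])
      have "17 * (\<eta> ^ 13 * R^2) = 17 * (Q * M)^2 * \<eta> ^ 13 * r^2" by (simp add: R_def power_mult_distrib)
      also have "\<dots> \<le> g / 4 * r^2" by (rule small) (use D_ge in auto)
      also have "\<dots> \<le> g / 2 * r^2" using g by (intro mult_right_mono) auto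
      finally show "\<bar>?f $ 3 - (1 - g) * z$3\<bar> \<le> g / 2 * r^2" using expansion(3) by (simp add: g_def)
    qed (use zb r in auto)
    have f4: "\<bar>?f $ 4\<bar> \<le> (\<rho> * r) ^ 3"
    proof (rule finish[of _ "z$4"])
      have "(51 + 2 * \<bar>\<alpha>\<bar>) * (\<eta> ^ 13 * R^3) = (51 + 2 * \<bar>\<alpha>\<bar>) * (Q * M)^3 * \<eta> ^ 13 * r^3"
        by (simp add: R_def power_mult_distrib)
      also have "\<dots> \<le> g / 4 * r^3" by (rule small) (use D_ge r in auto)
      also have "\<dots> \<le> g / 2 * r^3" using g r by (intro mult_right_mono) auto
      finally show "\<bar>?f $ 4 - (1 - g) * z$4\<bar> \<le> g / 2 * r^3" using expansion(4) by (simp add: g_def)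
    qed (use zb r in auto)
    have f5: "\<bar>?f $ 5\<bar> \<le> (\<rho> * (M * r)) ^ 4"
    proof (rule finish[of _ "z$5"])
      have "D5 * (\<eta> ^ 13 * R^4) = D5 * Q^4 * \<eta> ^ 13 * (M * r)^4"
        by (simp add: R_def power_mult_distrib)
      also have "\<dots> \<le> g / 4 * (M * r)^4" by (rule small) (use D_ge in auto)
      finally have rem: "D5 * (\<eta> ^ 13 * R^4) \<le> g / 4 * (M * r)^4" .
      have "\<bar>(3 * \<kappa> + \<alpha> - 3/2 * \<theta>) * z$2 * moment221 1\<bar> \<le> b * r * (256 * (\<epsilon> * R^3))"
        using zb swapped_moments_le(1) by (intro abs_mult_le) (auto simp: b_def \<epsilon>_def)
      also have "\<dots> = (1024 * b * Q^3) * (\<epsilon> / 4 * (M^3 * r^4))"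
        by (simp add: R_def power_mult_distrib eval_nat_numeral)
      also have "\<dots> \<le> (\<gamma> * M) * (\<epsilon> / 4 * (M^3 * r^4))"
        using bM \<epsilon> M r by (intro mult_right_mono) auto
      also have "\<dots> = g / 4 * (M * r)^4"
        by (simp add: g_def power_mult_distrib eval_nat_numeral)
      finally have "\<bar>?f $ 5 - (1 - g) * z$5\<bar> \<le> g / 4 * (M * r)^4 + g / 4 * (M * r)^4"
        using expansion(5) rem unfolding g_def by linarith
      then show "\<bar>?f $ 5 - (1 - g) * z$5\<bar> \<le> g / 2 * (M * r)^4" by (simp add: algebra_simps)
    qed (use zb r M in auto)
    show "?f \<in> weighted_box M ((1 - \<gamma> * \<eta> ^ 12 / 8) * r)"
      using f12 f3 f4 f5 unfolding \<rho>_def g_def \<epsilon>_def weighted_box_def by (simp add: mult_ac)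
    assume s: "s \<in> {0..1}"
    define T where "T = 4 * R"
    have RT: "R \<le> T" using R by (simp add: T_def)
    have "norm (closed_loop \<alpha> \<kappa> \<theta> \<gamma> \<eta> z s) \<le> 4 * T + 3 * T^2 + (4 + 4 * \<bar>\<alpha>\<bar>) * T^3 + (5 + 8 * \<bar>\<kappa>\<bar> + 4 * \<bar>\<alpha>\<bar> + 6 * \<bar>\<theta>\<bar>) * T^4"
      unfolding closed_loop_def
    proof (rule control_solution_bound[OF state_solves])
      fix s
      have "\<eta> ^ 3 * R \<le> 1 * R" using eta_powers(2)[of 0 3] R by (intro mult_right_mono) auto
      then show "\<bar>v1 s\<bar> \<le> T" "\<bar>v2 s\<bar> \<le> T"
        using abs_V_le(1,2)[of s] by (simp_all add: T_def)
    next
      have pw: "r ^ n \<le> T ^ n" for n using rR RT r by (intro power_mono) auto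
      have "(M * r) ^ 4 \<le> T ^ 4" using MrR RT r M by (intro power_mono) auto
      then show "\<bar>state \<alpha> \<kappa> \<theta> z 0 $ 1\<bar> \<le> T" "\<bar>state \<alpha> \<kappa> \<theta> z 0 $ 2\<bar> \<le> T" "\<bar>state \<alpha> \<kappa> \<theta> z 0 $ 3\<bar> \<le> T^2"
        "\<bar>state \<alpha> \<kappa> \<theta> z 0 $ 4\<bar> \<le> T^3" "\<bar>state \<alpha> \<kappa> \<theta> z 0 $ 5\<bar> \<le> T^4"
        using zb pw[of 1] pw[of 2] pw[of 3] unfolding state_0 by auto
    qed (use s in auto)
    then show "norm (closed_loop \<alpha> \<kappa> \<theta> \<gamma> \<eta> z s) \<le>
         (let T = 4 * (Q * (M * r)) in 4 * T + 3 * T^2 + (4 + 4 * \<bar>\<alpha>\<bar>) * T^3 + (5 + 8 * \<bar>\<kappa>\<bar> + 4 * \<bar>\<alpha>\<bar> + 6 * \<bar>\<theta>\<bar>) * T^4)"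
      by (simp add: T_def R_def Let_def)
  qed
  show ?thesis using that[OF M Q \<eta>0(1-3) main bound] by blast
qed

end

section \<open>Exponential convergence\<close>

text \<open>Coprimality is stated with binary \<open>gcd\<close> so that the simplifier decides it for concrete coefficients.\<close>

lemma no_resonance_triple:
  fixes a b c :: real and p q r :: int
  assumes "no_resonance_upto N [a, b, c]" "gcd p (gcd q r) = 1" "\<bar>p\<bar> + \<bar>q\<bar> + \<bar>r\<bar> \<le> int N"
  shows "of_int p * a + of_int q * b + of_int r * c \<noteq> 0"
proof
  assume eq: "of_int p * a + of_int q * b + of_int r * c = 0"
  let ?K = "nat (\<bar>p\<bar> + \<bar>q\<bar> + \<bar>r\<bar>)"
  have "\<not> (p = 0 \<and> q = 0 \<and> r = 0)" using assms(2) by auto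
  then have "?K \<in> {1..N}" using assms(3) by auto
  moreover have "in_resonance [a, b, c] ?K"
    unfolding in_resonance_def
    by (rule exI[of _ "[p, q, r]"]) (use assms eq in \<open>simp add: eval_nat_numeral\<close>)
  ultimately show False using assms(1) by (auto simp: no_resonance_upto_def)
qed

lemma oscillation_of_no_resonance:
  assumes pos: "k12 > 0" "k112 > 0" "k1112 > 0"
    and 1: "no_resonance_upto 4 [real k12, real k112, real k1112]"
    and 2: "no_resonance_upto 4 [real k12, 2 * real k112, real k1112]"
    and 3: "no_resonance_upto 4 [real k12, real k112, 3 * real k1112]"
  shows "oscillation k12 k112 k1112"
proof
  show "k12 \<noteq> k112" using no_resonance_triple[OF 1, of 1 "-1" 0] by auto
  show "k12 \<noteq> k1112" using no_resonance_triple[OF 1, of 1 0 "-1"] by auto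
  show "k12 \<noteq> 3 * k1112" using no_resonance_triple[OF 3, of 1 0 "-1"] by auto
  show "k112 \<noteq> k1112" using no_resonance_triple[OF 1, of 0 1 "-1"] by auto
  show "k112 \<noteq> 3 * k1112" using no_resonance_triple[OF 3, of 0 1 "-1"] by auto
  show "k112 \<noteq> 6 * k1112" using no_resonance_triple[OF 3, of 0 1 "-2"] by auto
  show "k1112 \<noteq> 3 * k112" using no_resonance_triple[OF 1, of 0 3 "-1"] by auto
  show "k1112 \<noteq> 4 * k112" using no_resonance_triple[OF 2, of 0 2 "-1"] by auto
qed (use pos in auto)

theorem theorem1:
  fixes d0 d1 l1 l2 \<alpha> \<kappa> \<theta> \<gamma> :: real and k12 k112 k1112 :: nat
    and g1 g2 :: "real^5 \<Rightarrow> real^5"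
    and u1 u2 :: "real \<Rightarrow> real \<Rightarrow> real^5 \<Rightarrow> real"
  assumes "d0 > 0" "d1 > 0" "l1 > 0" "l2 > 0"
    and "\<alpha> = alpha_param d0 d1 l1 l2"
    and "\<kappa> = kappa_param d0 d1 l1 l2"
    and "\<theta> = theta_param d0 d1 l1 l2"
    and "g1 = field_g1 \<kappa>" and "g2 = field_g2 \<alpha> \<theta>"
    and "\<gamma> > 0" and "k12 > 0" "k112 > 0" "k1112 > 0"
    and "no_resonance_upto 4 [k12, k112, k1112]"
    and "no_resonance_upto 4 [k12, 2 * k112, k1112]"
    and "no_resonance_upto 4 [k12, k112, 3 * k1112]"
    and "no_resonance_upto 4 [k12, 2 * k112, 3 * k1112]"
    and "u1 = feedback_u1 \<alpha> \<kappa> \<theta> \<gamma> k12 k112 k1112"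
    and "u2 = feedback_u2 \<alpha> \<kappa> \<theta> \<gamma> k12 k112 k1112"
  shows "\<forall>\<Delta>>0. \<exists>\<epsilon>'>0. \<forall>\<epsilon>\<in>{0<..<\<epsilon>'}. \<forall>z0\<in>ball 0 \<Delta>.
    \<exists>z. pi_solution \<epsilon> g1 g2 (u1 \<epsilon>) (u2 \<epsilon>) z \<and> z 0 = z0 \<and>
      (\<forall>y. pi_solution \<epsilon> g1 g2 (u1 \<epsilon>) (u2 \<epsilon>) y \<and> y 0 = z0 \<longrightarrow> (\<forall>t\<ge>0. y t = z t)) \<and>
      (\<exists>C r. C > 0 \<and> r > 0 \<and> (\<forall>t\<ge>0. norm (z t) \<le> C * exp (- r * t)))"
proof (intro allI impI)
  fix \<Delta> :: real assume "\<Delta> > 0"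
  interpret oscillation k12 k112 k1112
    by (rule oscillation_of_no_resonance) (use assms in simp_all)
  obtain M Q \<eta>0 where MQ: "1 \<le> M" "1 \<le> Q" and \<eta>0: "0 < \<eta>0" "\<eta>0 \<le> 1" "\<gamma> * \<eta>0 \<le> 1"
    and contract: "\<And>\<eta> r z. 0 < \<eta> \<Longrightarrow> \<eta> < \<eta>0 \<Longrightarrow> 0 \<le> r \<Longrightarrow> z \<in> weighted_box M r \<Longrightarrow>
       closed_loop \<alpha> \<kappa> \<theta> \<gamma> \<eta> z 1 \<in> weighted_box M ((1 - \<gamma> * \<eta> ^ 12 / 8) * r)"
    and bound: "\<And>\<eta> r z s. 0 < \<eta> \<Longrightarrow> \<eta> < \<eta>0 \<Longrightarrow> 0 \<le> r \<Longrightarrow> z \<in> weighted_box M r \<Longrightarrow> s \<in> {0..1} \<Longrightarrow>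
       norm (closed_loop \<alpha> \<kappa> \<theta> \<gamma> \<eta> z s) \<le>
         (let T = 4 * (Q * (M * r)) in 4 * T + 3 * T^2 + (4 + 4 * \<bar>\<alpha>\<bar>) * T^3 + (5 + 8 * \<bar>\<kappa>\<bar> + 4 * \<bar>\<alpha>\<bar> + 6 * \<bar>\<theta>\<bar>) * T^4)"
    using closed_loop_contracts[OF \<open>\<gamma> > 0\<close>] by blast
  show "\<exists>\<epsilon>'>0. \<forall>\<epsilon>\<in>{0<..<\<epsilon>'}. \<forall>z0\<in>ball 0 \<Delta>.
    \<exists>z. pi_solution \<epsilon> g1 g2 (u1 \<epsilon>) (u2 \<epsilon>) z \<and> z 0 = z0 \<and>
      (\<forall>y. pi_solution \<epsilon> g1 g2 (u1 \<epsilon>) (u2 \<epsilon>) y \<and> y 0 = z0 \<longrightarrow> (\<forall>t\<ge>0. y t = z t)) \<and>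
      (\<exists>C r. C > 0 \<and> r > 0 \<and> (\<forall>t\<ge>0. norm (z t) \<le> C * exp (- r * t)))"
  proof (intro exI[of _ "\<eta>0 ^ 12"] conjI ballI)
    show "\<eta>0 ^ 12 > 0" using \<eta>0 by simp
    fix \<epsilon> and z0 :: "real^5" assume \<epsilon>: "\<epsilon> \<in> {0<..<\<eta>0 ^ 12}" and z0: "z0 \<in> ball 0 \<Delta>"
    define \<eta> where "\<eta> = root 12 \<epsilon>"
    have \<eta>: "0 < \<eta>" "\<eta> ^ 12 = \<epsilon>" using \<epsilon> by (simp_all add: \<eta>_def)
    have "\<eta> < \<eta>0" using \<epsilon> \<eta> \<eta>0 power_less_imp_less_base[of \<eta> 12 \<eta>0] by simp
    then have "\<eta> \<le> 1" using \<eta>0 by linarith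
    have "\<epsilon> > 0" using \<epsilon> by simp
    have "\<epsilon> \<le> \<eta>" using power_decreasing[of 1 12 \<eta>] \<eta> \<open>\<eta> \<le> 1\<close> by simp
    then have "\<gamma> * \<epsilon> \<le> \<gamma> * \<eta>0" using \<open>\<eta> < \<eta>0\<close> \<open>\<gamma> > 0\<close> by simp
    then have \<gamma>\<epsilon>: "\<gamma> * \<epsilon> \<le> 1" using \<eta>0 by linarith
    define F where "F = closed_loop \<alpha> \<kappa> \<theta> \<gamma> \<eta>"
    obtain z where z: "pi_solution \<epsilon> g1 g2 (u1 \<epsilon>) (u2 \<epsilon>) z"
      and z_eq: "\<And>j t. t \<in> {real j * \<epsilon>..real (Suc j) * \<epsilon>} \<Longrightarrow> z t = F (((\<lambda>z. F z 1) ^^ j) z0) (t / \<epsilon> - real j)"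
    proof (rule glue_pi_solution[OF \<open>\<epsilon> > 0\<close>])
      show "F w 0 = w" for w unfolding F_def by (rule closed_loop_solves) fact+
      show "(F w has_vector_derivative
         \<epsilon> *\<^sub>R (u1 \<epsilon> (\<epsilon> * (real j + s)) w *\<^sub>R g1 (F w s) + u2 \<epsilon> (\<epsilon> * (real j + s)) w *\<^sub>R g2 (F w s)))
         (at s within {0..1})" if "s \<in> {0..1}" for w s j
        using closed_loop_solves(2)[OF \<open>0 < \<eta>\<close> \<open>\<eta> \<le> 1\<close> that] unfolding F_def \<eta>(2) assms .
    qed blast
    define r0 where "r0 = max 1 \<Delta>"
    define \<rho> where "\<rho> = 1 - \<gamma> * \<epsilon> / 8"
    have r0: "1 \<le> r0" "\<Delta> \<le> r0" by (simp_all add: r0_def)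
    have \<rho>: "0 \<le> \<rho>" "\<rho> \<le> 1" "\<rho> \<le> exp (- (\<gamma> * \<epsilon> / 8))"
      using \<gamma>\<epsilon> \<open>\<gamma> > 0\<close> \<open>\<epsilon> > 0\<close> exp_ge_add_one_self[of "- (\<gamma> * \<epsilon> / 8)"] by (simp_all add: \<rho>_def)
    have "z0 \<in> weighted_box M r0"
    proof -
      have i: "\<bar>z0 $ i\<bar> \<le> r0" for i
        using component_le_norm_cart[of z0 i] z0 r0 by simp
      have "r0 \<le> r0 ^ n" if "n > 0" for n using self_le_power[OF r0(1) that] .
      then have p: "\<bar>z0 $ i\<bar> \<le> r0 ^ n" if "n > 0" for i n using i[of i] that order_trans by blast
      have "r0 \<le> M * r0" using MQ r0 by (simp add: mult_le_cancel_right1)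
      then have "r0 ^ 4 \<le> (M * r0) ^ 4" using r0 by (intro power_mono) auto
      then have "\<bar>z0 $ 5\<bar> \<le> (M * r0) ^ 4" using p[of 4 5] by linarith
      then show ?thesis using i p[of 2] p[of 3] by (simp add: weighted_box_def)
    qed
    then have nodes: "((\<lambda>z. F z 1) ^^ j) z0 \<in> weighted_box M (\<rho> ^ j * r0)" for j
    proof (induction j)
      case (Suc j)
      have "F (((\<lambda>z. F z 1) ^^ j) z0) 1 \<in> weighted_box M (\<rho> * (\<rho> ^ j * r0))"
        using contract[OF \<open>0 < \<eta>\<close> \<open>\<eta> < \<eta>0\<close> _ Suc.IH[OF Suc.prems]] \<rho> r0 by (simp add: F_def \<rho>_def \<eta>)
      then show ?case by (simp add: mult_ac)
    qed simp
    define T0 where "T0 = 4 * (Q * (M * r0))"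
    define K where "K = 4 + 3 * T0 + (4 + 4 * \<bar>\<alpha>\<bar>) * T0^2 + (5 + 8 * \<bar>\<kappa>\<bar> + 4 * \<bar>\<alpha>\<bar> + 6 * \<bar>\<theta>\<bar>) * T0^3"
    have T0: "T0 > 0" using MQ r0 by (simp add: T0_def)
    then have K: "K > 0" unfolding K_def by (intro add_pos_nonneg) auto
    \<comment> \<open>The factor \<open>exp (\<gamma> * \<epsilon> / 8)\<close> pays for going back from \<open>t\<close> to the last sampling instant.\<close>
    have decay: "norm (z t) \<le> (K * T0 * exp (\<gamma> * \<epsilon> / 8)) * exp (- (\<gamma> / 8) * t)" if "t \<ge> 0" for t
    proof -
      define j where "j = nat \<lfloor>t / \<epsilon>\<rfloor>"
      have "real j = real_of_int \<lfloor>t / \<epsilon>\<rfloor>" using \<open>t \<ge> 0\<close> \<open>\<epsilon> > 0\<close> by (simp add: j_def)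
      then have j: "real j \<le> t / \<epsilon>" "t / \<epsilon> \<le> real j + 1" by linarith+
      then have t: "t \<in> {real j * \<epsilon>..real (Suc j) * \<epsilon>}" using \<open>\<epsilon> > 0\<close> by (simp add: field_simps)
      have s: "t / \<epsilon> - real j \<in> {0..1}" using j by simp
      define T where "T = \<rho> ^ j * T0"
      have T: "0 \<le> T" "T \<le> T0" using \<rho> T0 by (simp_all add: T_def power_le_one mult_le_cancel_right1 mult_left_le_one_le)
      have T_eq: "4 * (Q * (M * (\<rho> ^ j * r0))) = T" by (simp add: T_def T0_def)
      have "norm (z t) \<le> 4 * T + 3 * T^2 + (4 + 4 * \<bar>\<alpha>\<bar>) * T^3 + (5 + 8 * \<bar>\<kappa>\<bar> + 4 * \<bar>\<alpha>\<bar> + 6 * \<bar>\<theta>\<bar>) * T^4"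
        using bound[OF \<open>0 < \<eta>\<close> \<open>\<eta> < \<eta>0\<close> _ nodes[of j] s] \<rho>(1) r0
        unfolding z_eq[OF t] F_def T_eq Let_def by (simp only: zero_le_mult_iff zero_le_power) simp
      also have "\<dots> \<le> K * T"
        unfolding K_def by (rule polynomial_growth_le) (use T in auto)
      also have "\<dots> = K * T0 * \<rho> ^ j" by (simp add: T_def)
      also have "\<dots> \<le> K * T0 * exp (- (\<gamma> * \<epsilon> / 8)) ^ j"
        using K T0 \<rho> by (intro mult_left_mono power_mono) auto
      also have "\<dots> = K * T0 * exp (- (\<gamma> / 8) * (real j * \<epsilon>))"
        by (simp add: exp_of_nat_mult[symmetric] mult_ac)
      also have "\<dots> \<le> K * T0 * exp (\<gamma> * \<epsilon> / 8 + - (\<gamma> / 8) * t)"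
      proof -
        have "\<gamma> / 8 * t \<le> \<gamma> / 8 * (real (Suc j) * \<epsilon>)"
          using t \<open>\<gamma> > 0\<close> by (intro mult_left_mono) auto
        then have "- (\<gamma> / 8) * (real j * \<epsilon>) \<le> \<gamma> * \<epsilon> / 8 + - (\<gamma> / 8) * t"
          by (simp add: algebra_simps)
        then show ?thesis using K T0 by (intro mult_left_mono) auto
      qed
      finally show ?thesis by (simp only: exp_add mult.assoc)
    qed
    show "\<exists>z. pi_solution \<epsilon> g1 g2 (u1 \<epsilon>) (u2 \<epsilon>) z \<and> z 0 = z0 \<and>
      (\<forall>y. pi_solution \<epsilon> g1 g2 (u1 \<epsilon>) (u2 \<epsilon>) y \<and> y 0 = z0 \<longrightarrow> (\<forall>t\<ge>0. y t = z t)) \<and>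
      (\<exists>C r. C > 0 \<and> r > 0 \<and> (\<forall>t\<ge>0. norm (z t) \<le> C * exp (- r * t)))"
    proof (intro exI[of _ z] conjI)
      show "z 0 = z0"
        using z_eq[of 0 0] \<open>\<epsilon> > 0\<close> closed_loop_solves(1)[OF \<open>0 < \<eta>\<close> \<open>\<eta> \<le> 1\<close>] by (simp add: F_def)
      then show "\<forall>y. pi_solution \<epsilon> g1 g2 (u1 \<epsilon>) (u2 \<epsilon>) y \<and> y 0 = z0 \<longrightarrow> (\<forall>t\<ge>0. y t = z t)"
        using pi_solution_unique[OF \<open>\<epsilon> > 0\<close> _ z[unfolded \<open>g1 = field_g1 \<kappa>\<close> \<open>g2 = field_g2 \<alpha> \<theta>\<close>]]
        unfolding \<open>g1 = field_g1 \<kappa>\<close> \<open>g2 = field_g2 \<alpha> \<theta>\<close> by auto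
      show "\<exists>C r. C > 0 \<and> r > 0 \<and> (\<forall>t\<ge>0. norm (z t) \<le> C * exp (- r * t))"
        using decay K T0 \<open>\<gamma> > 0\<close>
        by (intro exI[of _ "K * T0 * exp (\<gamma> * \<epsilon> / 8)"] exI[of _ "\<gamma> / 8"]) auto
    qed (rule z)
  qed
qed

end
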